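(* Let $G$ be a unimodular locally compact second countable group with Haar measure $m_G$, and let $(\mathcal G,\nu)$ be the transverse measured groupoid of an integrable transverse $G$-system $(X,\mu,Y)$. Then in every degree there is an isometric isomorphism of seminormed spaces $$\mathrm{H}_{\mathrm{mb}}^\bullet((\mathcal G,\nu);\underline{\mathbb R})\cong \mathrm{H}_{\mathrm{cb}}^\bullet(G;\mathrm L^\infty(X,\mu)).$$
   Context: Let $G$ act by a probability measure preserving Borel action on a standard Borel probability space $(X,\mu)$. For a Borel set $Y\subset X$ and $x\in X$ put $Y_x=\{g\in G: gx\in Y\}$. $Y$ is a cross section if $GY=X$ and each $Y_x$ is locally finite ($|Y_x\cap L|<\infty$ for all compact $L\subset G$); then $(X,\mu,Y)$ is a transverse $G$-system. It is integrable if $\int_X |Y_x\cap L|\,d\mu(x)<\infty$ for every compact $L\subset G$. The transverse measure $\nu$ is the unique $\sigma$-finite Borel measure on $Y$ with $\int_Y f\,d\nu=\int_X\sum_{g\in Y_x}f(gx)w(g)\,d\mu(x)$ for all Borel $f:Y\to[0,\infty]$ and all Borel $w:G\to[0,\infty]$ with $\int_G w\,dm_G=1$ (it is finite if and only if the system is integrable). Transverse measured groupoid $(\mathcal G,\nu)$: objects $\mathcal G^{(0)}=Y$, morphisms $\mathcal G^{(1)}=\{(g,y)\in G\times Y: gy\in Y\}$, $s(g,y)=y$, $t(g,y)=gy$, $(g,hy)(h,y)=(gh,y)$, $(g,y)^{-1}=(g^{-1},gy)$. The fibers $\mathcal G^y=t^{-1}(y)$ are countable and carry counting measure; $\nu$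 is invariant. Measurable bounded cohomology: let $\mathcal G^{[n]}=\{(\gamma_0,\dots,\gamma_{n-1})\in(\mathcal G^{(1)})^n: t(\gamma_0)=\dots=t(\gamma_{n-1})\}$ with the measure obtained by integrating the counting measures on $(\mathcal G^y)^n$ against $\nu$. $\mathrm L^\infty(\mathcal G^{[n]})^{\mathcal G}$ is the space of classes $[f]\in \mathrm L^\infty(\mathcal G^{[n]})$ such that for almost all $(\gamma_0,\dots,\gamma_{n-1})$ and all $\gamma\in\mathcal G^{(1)}$ with $t(\gamma)=t(\gamma_0)$ one has $f(\gamma^{-1}\gamma_0,\dots,\gamma^{-1}\gamma_{n-1})=f(\gamma_0,\dots,\gamma_{n-1})$. With the homogeneous differential $d^nf(\gamma_0,\dots,\gamma_{n+1})=\sum_j(-1)^jf(\gamma_0,\dots,\widehat{\gamma_j},\dots,\gamma_{n+1})$, $\mathrm{H}_{\mathrm{mb}}^k((\mathcal G,\nu);\underline{\mathbb R})$ is the $k$-th cohomology of $0\to \mathrm L^\infty(\mathcal G^{[1]})^{\mathcal G}\to \mathrm L^\infty(\mathcal G^{[2]})^{\mathcal G}\to\cdots$, with the quotient seminorm of the essential supremum norm. Continuous bounded cohomology: $\mathrm{H}_{\mathrm{cb}}^k(G;\mathrm L^\infty(X,\mu))$ is the $k$-th cohomology of $0\to \mathrm L^\infty(G\times X)^G\to \mathrm L^\infty(G^2\times X)^G\to\cdots$ (invariants for the diagonal action, left translation on the $G$-factors; homogeneous differential in the $G$-variables), with the quotient seminorm. *)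

theory Defs
  imports "HOL-Probability.Probability" "HOL-Probability.Essential_Supremum"
begin

section \<open>Seminormed spaces, quotients and cohomology\<close>

record 'v seminormed_space =
  carrier :: "'v set"
  vzero :: 'v
  vadd :: "'v \<Rightarrow> 'v \<Rightarrow> 'v"
  vscale :: "real \<Rightarrow> 'v \<Rightarrow> 'v"
  vnorm :: "'v \<Rightarrow> real"

definition coset :: "'v seminormed_space \<Rightarrow> 'v set \<Rightarrow> 'v \<Rightarrow> 'v set" where
  "coset V W v = {vadd V v w |w. w \<in> W}"

text \<open>The quotient of \<open>V\<close> by a linear subspace \<open>W\<close>.  The translate by \<open>W\<close> in the scaling
  is only needed for the scalar \<open>0\<close>, where \<open>{vscale V 0 a |a. a \<in> A}\<close> is not a full coset.\<close>

definition quotient_space :: "'v seminormed_space \<Rightarrow> 'v set \<Rightarrow> 'v set seminormed_space" where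
  "quotient_space V W =
    \<lparr> carrier = coset V W ` carrier V,
      vzero = W,
      vadd = (\<lambda>A B. {vadd V a b |a b. a \<in> A \<and> b \<in> B}),
      vscale = (\<lambda>c A. {vadd V (vscale V c a) w |a w. a \<in> A \<and> w \<in> W}),
      vnorm = (\<lambda>A. Inf (vnorm V ` A)) \<rparr>"

definition subspace_on :: "'v seminormed_space \<Rightarrow> 'v set \<Rightarrow> 'v seminormed_space" where
  "subspace_on V U = V\<lparr> carrier := U \<rparr>"

definition isometric_isomorphism ::
    "'v seminormed_space \<Rightarrow> 'w seminormed_space \<Rightarrow> ('v \<Rightarrow> 'w) \<Rightarrow> bool" where
  "isometric_isomorphism V W \<phi> \<longleftrightarrow>
     bij_betw \<phi> (carrier V) (carrier W) \<and>
     (\<forall>a\<in>carrier V. \<forall>b\<in>carrier V. \<phi> (vadd V a b) = vadd W (\<phi> a) (\<phi> b)) \<and>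
     (\<forall>c. \<forall>a\<in>carrier V. \<phi> (vscale V c a) = vscale W c (\<phi> a)) \<and>
     (\<forall>a\<in>carrier V. vnorm W (\<phi> a) = vnorm V a)"

text \<open>A cochain complex \<open>0 \<rightarrow> C 0 \<rightarrow> C 1 \<rightarrow> \<dots>\<close> with differentials \<open>d k\<close> from \<open>C k\<close> to \<open>C (k + 1)\<close>.\<close>

definition cocycles :: "(nat \<Rightarrow> 'v seminormed_space) \<Rightarrow> (nat \<Rightarrow> 'v \<Rightarrow> 'v) \<Rightarrow> nat \<Rightarrow> 'v set" where
  "cocycles C d k = {c \<in> carrier (C k). d k c = vzero (C (Suc k))}"

fun coboundaries :: "(nat \<Rightarrow> 'v seminormed_space) \<Rightarrow> (nat \<Rightarrow> 'v \<Rightarrow> 'v) \<Rightarrow> nat \<Rightarrow> 'v set" where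
  "coboundaries C d 0 = {vzero (C 0)}"
| "coboundaries C d (Suc k) = d k ` carrier (C k)"

definition cohomology ::
    "(nat \<Rightarrow> 'v seminormed_space) \<Rightarrow> (nat \<Rightarrow> 'v \<Rightarrow> 'v) \<Rightarrow> nat \<Rightarrow> 'v set seminormed_space" where
  "cohomology C d k = quotient_space (subspace_on (C k) (cocycles C d k)) (coboundaries C d k)"


section \<open>\<open>L\<^sup>\<infinity>\<close> spaces\<close>

text \<open>Essentially bounded measurable functions, before identification modulo null functions.\<close>

definition ess_bounded :: "'a measure \<Rightarrow> ('a \<Rightarrow> real) seminormed_space" where
  "ess_bounded M =
    \<lparr> carrier = {f \<in> borel_measurable M. \<exists>C. AE x in M. \<bar>f x\<bar> \<le> C},
      vzero = (\<lambda>_. 0),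
      vadd = (\<lambda>f g x. f x + g x),
      vscale = (\<lambda>c f x. c * f x),
      vnorm = (\<lambda>f. real_of_ereal (esssup M (\<lambda>x. ereal \<bar>f x\<bar>))) \<rparr>"

definition null_functions :: "'a measure \<Rightarrow> ('a \<Rightarrow> real) set" where
  "null_functions M = {f \<in> borel_measurable M. AE x in M. f x = 0}"

definition Linf :: "'a measure \<Rightarrow> ('a \<Rightarrow> real) set seminormed_space" where
  "Linf M = quotient_space (ess_bounded M) (null_functions M)"

definition Linf_class :: "'a measure \<Rightarrow> ('a \<Rightarrow> real) \<Rightarrow> ('a \<Rightarrow> real) set" where
  "Linf_class M f = coset (ess_bounded M) (null_functions M) f"

text \<open>The map induced on classes by a map of functions (used when it is independent of the
  representative).\<close>

definition Linf_lift ::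
    "'b measure \<Rightarrow> (('a \<Rightarrow> real) \<Rightarrow> 'b \<Rightarrow> real) \<Rightarrow> ('a \<Rightarrow> real) set \<Rightarrow> ('b \<Rightarrow> real) set" where
  "Linf_lift N D c = (\<Union>f\<in>c. Linf_class N (D f))"

text \<open>\<open>n\<close>-tuples are extensional functions on \<open>{..<n}\<close>; \<open>omit n j\<close> deletes entry \<open>j\<close> of an
  \<open>(n + 1)\<close>-tuple.\<close>

definition omit :: "nat \<Rightarrow> nat \<Rightarrow> (nat \<Rightarrow> 'a) \<Rightarrow> nat \<Rightarrow> 'a" where
  "omit n j u = (\<lambda>i\<in>{..<n}. u (if i < j then i else Suc i))"


section \<open>Measurable bounded cohomology of discrete measured groupoids\<close>

text \<open>\<open>units\<close> is the unit space together with its measure; \<open>arrows\<close> is the space of morphisms,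
  of which only the underlying measurable space is used.  \<open>gcomp G \<gamma> \<eta>\<close> is only meaningful
  when \<open>src G \<gamma> = tgt G \<eta>\<close>.\<close>

record ('o, 'm) measured_groupoid =
  units :: "'o measure"
  arrows :: "'m measure"
  src :: "'m \<Rightarrow> 'o"
  tgt :: "'m \<Rightarrow> 'o"
  gcomp :: "'m \<Rightarrow> 'm \<Rightarrow> 'm"
  ginv :: "'m \<Rightarrow> 'm"

definition tgt_fiber :: "('o, 'm) measured_groupoid \<Rightarrow> 'o \<Rightarrow> 'm set" where
  "tgt_fiber G y = {\<gamma> \<in> space (arrows G). tgt G \<gamma> = y}"

text \<open>The measure space \<open>G\<^sup>[\<^sup>n\<^sup>]\<close> of \<open>n\<close>-tuples of morphisms with common target.\<close>

definition fiber_power_space :: "('o, 'm) measured_groupoid \<Rightarrow> nat \<Rightarrow> (nat \<Rightarrow> 'm) measure" where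
  "fiber_power_space G n =
     restrict_space (PiM {..<n} (\<lambda>_. arrows G)) {\<gamma>. \<forall>i<n. \<forall>j<n. tgt G (\<gamma> i) = tgt G (\<gamma> j)}"

definition fiber_power :: "('o, 'm) measured_groupoid \<Rightarrow> nat \<Rightarrow> (nat \<Rightarrow> 'm) measure" where
  "fiber_power G n =
     measure_of (space (fiber_power_space G n)) (sets (fiber_power_space G n))
       (\<lambda>A. \<integral>\<^sup>+ y. emeasure (count_space UNIV) (A \<inter> ({..<n} \<rightarrow>\<^sub>E tgt_fiber G y)) \<partial>units G)"

definition groupoid_invariant ::
    "('o, 'm) measured_groupoid \<Rightarrow> nat \<Rightarrow> ((nat \<Rightarrow> 'm) \<Rightarrow> real) \<Rightarrow> bool" where
  "groupoid_invariant G n f \<longleftrightarrow>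
     (AE u in fiber_power G n. \<forall>\<gamma>\<in>space (arrows G). tgt G \<gamma> = tgt G (u 0) \<longrightarrow>
        f (\<lambda>i\<in>{..<n}. gcomp G (ginv G \<gamma>) (u i)) = f u)"

definition mb_cochains ::
    "('o, 'm) measured_groupoid \<Rightarrow> nat \<Rightarrow> ((nat \<Rightarrow> 'm) \<Rightarrow> real) set seminormed_space" where
  "mb_cochains G k = subspace_on (Linf (fiber_power G (Suc k)))
     {Linf_class (fiber_power G (Suc k)) f |f.
        f \<in> carrier (ess_bounded (fiber_power G (Suc k))) \<and> groupoid_invariant G (Suc k) f}"

definition mb_differential ::
    "('o, 'm) measured_groupoid \<Rightarrow> nat \<Rightarrow> ((nat \<Rightarrow> 'm) \<Rightarrow> real) set \<Rightarrow> ((nat \<Rightarrow> 'm) \<Rightarrow> real) set" where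
  "mb_differential G k = Linf_lift (fiber_power G (Suc (Suc k)))
     (\<lambda>f u. \<Sum>j\<le>Suc k. (- 1) ^ j * f (omit (Suc k) j u))"

definition H_mb ::
    "('o, 'm) measured_groupoid \<Rightarrow> nat \<Rightarrow> ((nat \<Rightarrow> 'm) \<Rightarrow> real) set set seminormed_space" where
  "H_mb G = cohomology (mb_cochains G) (mb_differential G)"


section \<open>Haar measure and measure preserving actions\<close>

text \<open>Groups are written additively, since the library provides topological groups as the type
  class \<^class>\<open>topological_group_add\<close>.  This class does not assume commutativity: \<open>g + h\<close> stands
  for the product \<open>g h\<close>, \<open>- g\<close> for the inverse and \<open>0\<close> for the neutral element.\<close>

text \<open>For locally compact second countable groups, regularity of \<open>m\<close> is automatic.\<close>

definition haar_measure :: "'g::topological_group_add measure \<Rightarrow> bool" where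
  "haar_measure m \<longleftrightarrow>
     sets m = sets borel \<and>
     (\<forall>K. compact K \<longrightarrow> emeasure m K < \<infinity>) \<and>
     emeasure m UNIV \<noteq> 0 \<and>
     (\<forall>g. distr m borel (\<lambda>h. g + h) = m)"

text \<open>The group is unimodular when its left Haar measure \<open>m\<close> is also right invariant.\<close>

definition unimodular :: "'g::topological_group_add measure \<Rightarrow> bool" where
  "unimodular m \<longleftrightarrow> (\<forall>g. distr m borel (\<lambda>h. h + g) = m)"

definition standard_borel :: "'x measure \<Rightarrow> bool" where
  "standard_borel M \<longleftrightarrow>
     (\<exists>T. completely_metrizable_space T \<and> second_countable T \<and> topspace T = space M \<and>
          sets M = sigma_sets (topspace T) {U. openin T U})"

definition pmp_action :: "'x measure \<Rightarrow> ('g::topological_group_add \<Rightarrow> 'x \<Rightarrow> 'x) \<Rightarrow> bool" where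
  "pmp_action \<mu> act \<longleftrightarrow>
     (\<lambda>(g, x). act g x) \<in> measurable (borel \<Otimes>\<^sub>M \<mu>) \<mu> \<and>
     (\<forall>x\<in>space \<mu>. act 0 x = x) \<and>
     (\<forall>g h. \<forall>x\<in>space \<mu>. act (g + h) x = act g (act h x)) \<and>
     (\<forall>g. distr \<mu> \<mu> (act g) = \<mu>)"


section \<open>Transverse systems and their groupoids\<close>

definition hitting_set :: "('g \<Rightarrow> 'x \<Rightarrow> 'x) \<Rightarrow> 'x set \<Rightarrow> 'x \<Rightarrow> 'g set" where
  "hitting_set act Y x = {g. act g x \<in> Y}"

definition cross_section ::
    "'x measure \<Rightarrow> ('g::topological_group_add \<Rightarrow> 'x \<Rightarrow> 'x) \<Rightarrow> 'x set \<Rightarrow> bool" where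
  "cross_section \<mu> act Y \<longleftrightarrow>
     Y \<in> sets \<mu> \<and>
     (\<Union>g. act g ` Y) = space \<mu> \<and>
     (\<forall>x\<in>space \<mu>. \<forall>L. compact L \<longrightarrow> finite (hitting_set act Y x \<inter> L))"

definition transverse_system ::
    "'x measure \<Rightarrow> ('g::topological_group_add \<Rightarrow> 'x \<Rightarrow> 'x) \<Rightarrow> 'x set \<Rightarrow> bool" where
  "transverse_system \<mu> act Y \<longleftrightarrow>
     prob_space \<mu> \<and> standard_borel \<mu> \<and> pmp_action \<mu> act \<and> cross_section \<mu> act Y"

definition integrable_system ::
    "'x measure \<Rightarrow> ('g::topological_group_add \<Rightarrow> 'x \<Rightarrow> 'x) \<Rightarrow> 'x set \<Rightarrow> bool" where
  "integrable_system \<mu> act Y \<longleftrightarrow>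
     (\<forall>L. compact L \<longrightarrow>
        (\<integral>\<^sup>+ x. emeasure (count_space UNIV) (hitting_set act Y x \<inter> L) \<partial>\<mu>) < \<infinity>)"

definition transverse_measure ::
    "'g::topological_group_add measure \<Rightarrow> 'x measure \<Rightarrow> ('g \<Rightarrow> 'x \<Rightarrow> 'x) \<Rightarrow> 'x set \<Rightarrow> 'x measure \<Rightarrow> bool" where
  "transverse_measure m \<mu> act Y \<nu> \<longleftrightarrow>
     sigma_finite_measure \<nu> \<and>
     sets \<nu> = sets (restrict_space \<mu> Y) \<and>
     (\<forall>f\<in>borel_measurable \<nu>. \<forall>w\<in>borel_measurable borel. (\<integral>\<^sup>+ g. w g \<partial>m) = 1 \<longrightarrow>
        (\<integral>\<^sup>+ y. f y \<partial>\<nu>) =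
        (\<integral>\<^sup>+ x. (\<integral>\<^sup>+ g. f (act g x) * w g \<partial>count_space (hitting_set act Y x)) \<partial>\<mu>))"

text \<open>A morphism \<open>(g, y)\<close> goes from \<open>y\<close> to \<open>act g y\<close>; the composite of \<open>(g, act h y)\<close> and
  \<open>(h, y)\<close> is \<open>(g + h, y)\<close>.  Here \<open>\<nu>\<close> is a measure on \<open>Y\<close>, so that \<open>space \<nu> = Y\<close>.\<close>

definition transverse_groupoid ::
    "('g::topological_group_add \<Rightarrow> 'x \<Rightarrow> 'x) \<Rightarrow> 'x set \<Rightarrow> 'x measure \<Rightarrow> ('x, 'g \<times> 'x) measured_groupoid" where
  "transverse_groupoid act Y \<nu> =
    \<lparr> units = \<nu>,
      arrows = restrict_space (borel \<Otimes>\<^sub>M \<nu>) {(g, y). y \<in> Y \<and> act g y \<in> Y},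
      src = (\<lambda>(g, y). y),
      tgt = (\<lambda>(g, y). act g y),
      gcomp = (\<lambda>(g, y') (h, y). (g + h, y)),
      ginv = (\<lambda>(g, y). (- g, act g y)) \<rparr>"


section \<open>Continuous bounded cohomology with coefficients in \<open>L\<^sup>\<infinity>\<close>\<close>

definition cb_measure :: "'g measure \<Rightarrow> 'x measure \<Rightarrow> nat \<Rightarrow> ((nat \<Rightarrow> 'g) \<times> 'x) measure" where
  "cb_measure m \<mu> n = PiM {..<n} (\<lambda>_. m) \<Otimes>\<^sub>M \<mu>"

definition group_invariant ::
    "'g::topological_group_add measure \<Rightarrow> 'x measure \<Rightarrow> ('g \<Rightarrow> 'x \<Rightarrow> 'x) \<Rightarrow> nat
      \<Rightarrow> ((nat \<Rightarrow> 'g) \<times> 'x \<Rightarrow> real) \<Rightarrow> bool" where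
  "group_invariant m \<mu> act n f \<longleftrightarrow>
     (\<forall>g. AE (u, x) in cb_measure m \<mu> n. f (\<lambda>i\<in>{..<n}. g + u i, act g x) = f (u, x))"

definition cb_cochains ::
    "'g::topological_group_add measure \<Rightarrow> 'x measure \<Rightarrow> ('g \<Rightarrow> 'x \<Rightarrow> 'x) \<Rightarrow> nat
      \<Rightarrow> ((nat \<Rightarrow> 'g) \<times> 'x \<Rightarrow> real) set seminormed_space" where
  "cb_cochains m \<mu> act k = subspace_on (Linf (cb_measure m \<mu> (Suc k)))
     {Linf_class (cb_measure m \<mu> (Suc k)) f |f.
        f \<in> carrier (ess_bounded (cb_measure m \<mu> (Suc k))) \<and> group_invariant m \<mu> act (Suc k) f}"

definition cb_differential ::
    "'g measure \<Rightarrow> 'x measure \<Rightarrow> nat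
      \<Rightarrow> ((nat \<Rightarrow> 'g) \<times> 'x \<Rightarrow> real) set \<Rightarrow> ((nat \<Rightarrow> 'g) \<times> 'x \<Rightarrow> real) set" where
  "cb_differential m \<mu> k = Linf_lift (cb_measure m \<mu> (Suc (Suc k)))
     (\<lambda>f (u, x). \<Sum>j\<le>Suc k. (- 1) ^ j * f (omit (Suc k) j u, x))"

definition H_cb ::
    "'g::topological_group_add measure \<Rightarrow> 'x measure \<Rightarrow> ('g \<Rightarrow> 'x \<Rightarrow> 'x) \<Rightarrow> nat
      \<Rightarrow> ((nat \<Rightarrow> 'g) \<times> 'x \<Rightarrow> real) set set seminormed_space" where
  "H_cb m \<mu> act = cohomology (cb_cochains m \<mu> act) (cb_differential m \<mu>)"

end

theory Submission
  imports Defs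
begin

text \<open>Both complexes are described by the same strictly \<open>G\<close>-invariant bounded Borel functions
  \<open>F (u, x)\<close> of a tuple \<open>u\<close> of group elements and a point \<open>x\<close> of \<open>X\<close>, considered modulo two different
  ideals of null functions.  For \<open>H\<^sub>c\<^sub>b\<close>, \<open>F (\<sqdot>, x)\<close> has to vanish almost everywhere for almost every
  \<open>x\<close>; for \<open>H\<^sub>m\<^sub>b\<close> it has to vanish on the tuples of elements of the countable set
  \<open>V x = {v. act (- v) x \<in> Y}\<close>, since the arrows with target \<open>y\<close> are indexed by \<open>V y\<close>.

  Averaging each entry of \<open>u\<close> over an equivariant family of probability measures on \<open>G\<close> is a chain map
  that does not increase norms and is homotopic to the identity by the prism operator.  If the measures
  are equivalent to Haar measure it is well defined on the classes for \<open>H\<^sub>c\<^sub>b\<close>, and if they are carried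
  by \<open>V x\<close> it is well defined on those for \<open>H\<^sub>m\<^sub>b\<close>.  The two averagings are therefore mutually inverse
  isometries on cohomology.

  Measurability of the second family rests on the measurability of the counting functions of
  \<open>Y\<^sub>x \<inter> L\<close> for compact \<open>L\<close>, which follows from the measurable projection theorem, an instance of
  Choquet's capacity argument.\<close>

section \<open>Averaging and the prism operator\<close>

text \<open>Averaging over measures compatible with one ideal turns a bound that holds only modulo
  that ideal into a bound at every tuple, for almost every \<open>x\<close>. The averaged cochain is
  then controlled modulo the other ideal as well, which is why one operation leads from either
  complex into the other. The same gain tames the composite: after the first averaging a cocycle is
  closed at every tuple, so the second homotopy needs no compatibility between its measures and the
  ideal. Both ideals are written as an iterated quantifier along a filter depending on
  \<open>x\<close>, namely Haar conullity or the principal filter of \<open>V x\<close>. Exceptional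
  sets live in X for one complex and in Y for the other. Invariant Borel sets are conull for \<mu>
  exactly when they are conull for \<nu>, so every condition is arranged as an invariant Borel
  subset of X. The obstacle is measurability: counting hitting points involves projections, which
  are measurable only for the completion of \<mu>, while the kernels have to be Borel and
  equivariant; the bad null set must therefore be traded for an invariant one.\<close>

definition face :: "nat \<Rightarrow> (nat \<Rightarrow> 'a) \<Rightarrow> nat \<Rightarrow> 'a" where
  "face j u = (\<lambda>i. u (if i < j then i else Suc i))"

text \<open>Arguments are infinite sequences rather than tuples, so \<open>face\<close> and
  \<open>dup\<close> compose without length bookkeeping; that a cochain reads finitely many entries
  is recorded separately in \<open>cochain\<close>.\<close>

definition dup :: "nat \<Rightarrow> (nat \<Rightarrow> 'a) \<Rightarrow> nat \<Rightarrow> 'a" where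
  "dup j u = (\<lambda>i. u (if i \<le> j then i else i - 1))"

definition avg :: "('a \<Rightarrow> 'a measure) \<Rightarrow> nat \<Rightarrow> ((nat \<Rightarrow> 'a) \<Rightarrow> real) \<Rightarrow> (nat \<Rightarrow> 'a) \<Rightarrow> real" where
  "avg \<kappa> l f u = (\<integral>k. f (u(l := k)) \<partial>\<kappa> (u l))"

fun avgs :: "('a \<Rightarrow> 'a measure) \<Rightarrow> nat \<Rightarrow> nat \<Rightarrow> ((nat \<Rightarrow> 'a) \<Rightarrow> real) \<Rightarrow> (nat \<Rightarrow> 'a) \<Rightarrow> real" where
  "avgs \<kappa> j 0 f = f"
| "avgs \<kappa> j (Suc d) f = avg \<kappa> j (avgs \<kappa> (Suc j) d f)"

text \<open>With \<open>k_i\<close> drawn from \<open>\<kappa> (u i)\<close>, the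
  \<open>j\<close>-th term is the mean of \<open>f(u_0,...,u_j,k_j,...,k_(n-1))\<close>: duplicating
  entry \<open>j\<close> and averaging the last \<open>n - j\<close> of the resulting
  \<open>n + 1\<close> entries places both \<open>u_j\<close> and its random replacement in the
  tuple.\<close>

definition prism :: "('a \<Rightarrow> 'a measure) \<Rightarrow> nat \<Rightarrow> ((nat \<Rightarrow> 'a) \<Rightarrow> real) \<Rightarrow> (nat \<Rightarrow> 'a) \<Rightarrow> real" where
  "prism \<kappa> n f u = (\<Sum>j<n. (- 1) ^ j * avgs \<kappa> (Suc j) (n - j) f (dup j u))"

definition coface :: "nat \<Rightarrow> ((nat \<Rightarrow> 'a) \<Rightarrow> real) \<Rightarrow> (nat \<Rightarrow> 'a) \<Rightarrow> real" where
  "coface n f u = (\<Sum>i\<le>n. (- 1) ^ i * f (face i u))"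

lemma dup_face_less: "i < j \<Longrightarrow> face i (dup j u) = dup (j - 1) (face i u)"
  by (auto simp: face_def dup_def fun_eq_iff)

lemma dup_face_same: "face j (dup j u) = u" "face (Suc j) (dup j u) = u"
  by (auto simp: face_def dup_def fun_eq_iff)

lemma dup_face_greater: "Suc j < i \<Longrightarrow> face i (dup j u) = dup j (face (i - 1) u)"
  by (auto simp: face_def dup_def fun_eq_iff)

definition seq_bounded :: "'a measure \<Rightarrow> ((nat \<Rightarrow> 'a) \<Rightarrow> real) set" where
  "seq_bounded N = {f. f \<in> borel_measurable (PiM UNIV (\<lambda>_. N)) \<and> (\<exists>B. \<forall>u. \<bar>f u\<bar> \<le> B)}"

locale averaging =
  fixes N :: "'a measure" and \<kappa> :: "'a \<Rightarrow> 'a measure"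
  assumes space_N: "space N = UNIV"
    and kernel: "\<kappa> \<in> measurable N (prob_algebra N)"
begin

lemma kernel_sets: "sets (\<kappa> g) = sets N" and kernel_prob: "prob_space (\<kappa> g)"
  using measurable_space[OF kernel, of g] by (auto simp: space_N space_prob_algebra)

lemma upd_measurable:
  "(\<lambda>(u, k). u(l :: nat := k)) \<in> measurable (PiM UNIV (\<lambda>_. N) \<Otimes>\<^sub>M N) (PiM UNIV (\<lambda>_. N))"
proof (rule measurable_PiM_single')
  fix i :: nat
  show "(\<lambda>p. (case p of (u, k) \<Rightarrow> (u :: nat \<Rightarrow> 'a)(l := k)) i) \<in> measurable (PiM UNIV (\<lambda>_. N) \<Otimes>\<^sub>M N) N"
    by (cases "i = l") (auto simp: case_prod_beta)
qed (auto simp: space_N)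

lemma integrable_kernel:
  assumes "f \<in> seq_bounded N"
  shows "integrable (\<kappa> g) (\<lambda>k. f (u(l := k)))"
proof -
  interpret prob_space "\<kappa> g" by (rule kernel_prob)
  obtain B where B: "\<And>u. \<bar>f u\<bar> \<le> B" using assms by (auto simp: seq_bounded_def)
  have f: "f \<in> borel_measurable (PiM UNIV (\<lambda>_. N))" using assms by (auto simp: seq_bounded_def)
  have "(\<lambda>k. u(l := k)) \<in> measurable N (PiM UNIV (\<lambda>_. N))"
    using measurable_Pair2[OF upd_measurable, of u l] by (simp add: space_PiM space_N)
  hence "(\<lambda>k. f (u(l := k))) \<in> borel_measurable N"
    using measurable_compose f by blast
  hence "(\<lambda>k. f (u(l := k))) \<in> borel_measurable (\<kappa> g)"
    by (simp cong: measurable_cong_sets add: kernel_sets)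
  thus ?thesis by (intro integrable_const_bound[where B=B]) (auto simp: B)
qed

text \<open>No measurability is required: a function that is not integrable has Bochner integral 0,
  and \<open>B\<close> is nonnegative as it bounds an absolute value.\<close>

lemma avg_bounded: 
  assumes "\<And>u. \<bar>f u\<bar> \<le> B"
  shows "\<bar>avg \<kappa> l f u\<bar> \<le> B"
proof -
  interpret prob_space "\<kappa> (u l)" by (rule kernel_prob)
  have "0 \<le> B" using assms[of u] by linarith
  show ?thesis
  proof (cases "integrable (\<kappa> (u l)) (\<lambda>k. f (u(l := k)))")
    case True
    have "\<bar>avg \<kappa> l f u\<bar> \<le> (\<integral>k. \<bar>f (u(l := k))\<bar> \<partial>\<kappa> (u l))"
      unfolding avg_def by (rule integral_abs_bound)
    also have "\<dots> \<le> (\<integral>k. B \<partial>\<kappa> (u l))"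
      by (intro integral_mono) (use True assms in auto)
    finally show ?thesis by (simp add: prob_space)
  qed (simp add: avg_def not_integrable_integral_eq \<open>0 \<le> B\<close>)
qed

lemma avg_in_seq_bounded:
  assumes "f \<in> seq_bounded N" shows "avg \<kappa> l f \<in> seq_bounded N"
proof -
  obtain B where B: "\<And>u. \<bar>f u\<bar> \<le> B" using assms by (auto simp: seq_bounded_def)
  have f[measurable]: "f \<in> borel_measurable (PiM UNIV (\<lambda>_. N))" using assms by (auto simp: seq_bounded_def)
  \<comment> \<open>Adding \<open>B\<close> makes the integrand nonnegative, so the measurability of
    nonnegative integrals against a kernel applies; \<open>B\<close> is subtracted again
    afterwards.\<close>
  have *: "(\<lambda>(u, k). ennreal (f (u(l := k)) + B)) \<in> borel_measurable (PiM UNIV (\<lambda>_. N) \<Otimes>\<^sub>M N)"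
    using measurable_compose[OF upd_measurable f] by (simp add: case_prod_beta')
  have "(\<lambda>u. \<kappa> (u l)) \<in> measurable (PiM UNIV (\<lambda>_. N)) (subprob_algebra N)"
    by (rule measurable_compose[OF _ measurable_prob_algebraD[OF kernel]]) simp
  from nn_integral_measurable_subprob_algebra2[OF * this]
  have "(\<lambda>u. enn2real (\<integral>\<^sup>+k. ennreal (f (u(l := k)) + B) \<partial>\<kappa> (u l)) - B) \<in> borel_measurable (PiM UNIV (\<lambda>_. N))"
    by simp
  also have "(\<lambda>u. enn2real (\<integral>\<^sup>+k. ennreal (f (u(l := k)) + B) \<partial>\<kappa> (u l)) - B) = avg \<kappa> l f"
  proof
    fix u :: "nat \<Rightarrow> 'a"
    interpret prob_space "\<kappa> (u l)" by (rule kernel_prob)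
    note int = integrable_kernel[OF assms, of "u l" u l]
    have "0 \<le> f v + B" for v using B[of v] by linarith
    hence "enn2real (\<integral>\<^sup>+k. ennreal (f (u(l := k)) + B) \<partial>\<kappa> (u l)) = (\<integral>k. f (u(l := k)) + B \<partial>\<kappa> (u l))"
      using int by (subst integral_eq_nn_integral) auto
    thus "enn2real (\<integral>\<^sup>+k. ennreal (f (u(l := k)) + B) \<partial>\<kappa> (u l)) - B = avg \<kappa> l f u"
      using int by (simp add: avg_def prob_space)
  qed
  finally have "avg \<kappa> l f \<in> borel_measurable (PiM UNIV (\<lambda>_. N))" .
  moreover have "\<forall>u. \<bar>avg \<kappa> l f u\<bar> \<le> B" using avg_bounded[of f B] B by blast
  ultimately show ?thesis by (auto simp: seq_bounded_def)
qed

lemma avgs_in_seq_bounded: "f \<in> seq_bounded N \<Longrightarrow> avgs \<kappa> j d f \<in> seq_bounded N"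
  by (induction d arbitrary: j) (auto intro: avg_in_seq_bounded)

lemma avg_face_less: "l < i \<Longrightarrow> avg \<kappa> l (\<lambda>u. f (face i u)) u = avg \<kappa> l f (face i u)"
  unfolding avg_def by (intro Bochner_Integration.integral_cong) (auto simp: face_def fun_eq_iff fun_upd_def intro!: arg_cong[where f=f])

text \<open>\<open>face l\<close> forgets the entry being averaged, so the integrand is constant and
  only the total mass one of the kernel remains.\<close>

lemma avg_face_same: "avg \<kappa> l (\<lambda>u. f (face l u)) u = f (face l u)"
proof -
  interpret prob_space "\<kappa> (u l)" by (rule kernel_prob)
  have "face l (u(l := k)) = face l u" for k by (auto simp: face_def)
  thus ?thesis by (simp add: avg_def prob_space)
qed

lemma avg_face_greater: "i < l \<Longrightarrow> avg \<kappa> l (\<lambda>u. f (face i u)) u = avg \<kappa> (l - 1) f (face i u)"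
proof -
  assume "i < l"
  hence "face i (u(l := k)) = (face i u)(l - 1 := k)" "face i u (l - 1) = u l" for k 
    by (auto simp: face_def fun_eq_iff)
  thus ?thesis by (simp add: avg_def)
qed

lemma avgs_face_less: "i < j \<Longrightarrow> avgs \<kappa> j d (\<lambda>u. f (face i u)) u = avgs \<kappa> (j - 1) d f (face i u)"
proof (induction d arbitrary: j u)
  case (Suc d)
  have "avgs \<kappa> (Suc j) d (\<lambda>u. f (face i u)) = (\<lambda>u. avgs \<kappa> j d f (face i u))"
    using Suc.IH[of "Suc j"] Suc.prems by auto
  thus ?case using avg_face_greater[OF Suc.prems] Suc.prems by simp
qed simp

text \<open>The deleted entry \<open>i\<close> is one of the \<open>d + 1\<close> averaged entries
  and integrates out, which leaves a block of \<open>d\<close> averages starting at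
  \<open>j\<close>.\<close>

lemma avgs_face_ge:
  "j \<le> i \<Longrightarrow> i \<le> j + d \<Longrightarrow> avgs \<kappa> j (Suc d) (\<lambda>u. f (face i u)) u = avgs \<kappa> j d f (face i u)"
proof (induction d arbitrary: j u)
  case 0 thus ?case by (simp add: avg_face_same)
next
  case (Suc d)
  show ?case
  proof (cases "i = j")
    case True
    have "avgs \<kappa> (Suc j) (Suc d) (\<lambda>u. f (face i u)) = (\<lambda>u. avgs \<kappa> j (Suc d) f (face i u))"
      using avgs_face_less[of i "Suc j"] True by (auto simp del: avgs.simps)
    thus ?thesis using True avg_face_same[of j "avgs \<kappa> j (Suc d) f"] by simp
  next
    case False
    have "avgs \<kappa> (Suc j) (Suc d) (\<lambda>u. f (face i u)) = (\<lambda>u. avgs \<kappa> (Suc j) d f (face i u))"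
      using Suc.IH[of "Suc j"] Suc.prems False by auto
    thus ?thesis using False Suc.prems by (simp add: avg_face_less)
  qed
qed

lemma avg_add: "f \<in> seq_bounded N \<Longrightarrow> g \<in> seq_bounded N \<Longrightarrow>
   avg \<kappa> l (\<lambda>u. f u + g u) = (\<lambda>u. avg \<kappa> l f u + avg \<kappa> l g u)"
  by (simp add: avg_def[abs_def] integrable_kernel)

lemma avg_scale: "avg \<kappa> l (\<lambda>u. c * f u) = (\<lambda>u. c * avg \<kappa> l f u)"
  by (simp add: avg_def[abs_def])

lemma avgs_add: "f \<in> seq_bounded N \<Longrightarrow> g \<in> seq_bounded N \<Longrightarrow>
   avgs \<kappa> j d (\<lambda>u. f u + g u) = (\<lambda>u. avgs \<kappa> j d f u + avgs \<kappa> j d g u)"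
  by (induction d arbitrary: j) (auto simp: avg_add avgs_in_seq_bounded)

lemma avgs_scale: "avgs \<kappa> j d (\<lambda>u. c * f u) = (\<lambda>u. c * avgs \<kappa> j d f u)"
  by (induction d arbitrary: j) (auto simp: avg_scale)

lemma seq_bounded_add: "f \<in> seq_bounded N \<Longrightarrow> g \<in> seq_bounded N \<Longrightarrow> (\<lambda>u. f u + g u) \<in> seq_bounded N"
proof -
  assume a: "f \<in> seq_bounded N" "g \<in> seq_bounded N"
  then obtain B C where "\<And>u. \<bar>f u\<bar> \<le> B" "\<And>u. \<bar>g u\<bar> \<le> C" by (auto simp: seq_bounded_def)
  hence "\<bar>f u + g u\<bar> \<le> B + C" for u
    by (meson abs_triangle_ineq add_mono order_trans)
  thus ?thesis using a by (auto simp: seq_bounded_def)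
qed

lemma seq_bounded_scale: "f \<in> seq_bounded N \<Longrightarrow> (\<lambda>u. c * f u) \<in> seq_bounded N"
proof -
  assume a: "f \<in> seq_bounded N"
  then obtain B where "\<And>u. \<bar>f u\<bar> \<le> B" by (auto simp: seq_bounded_def)
  hence "\<bar>c * f u\<bar> \<le> \<bar>c\<bar> * B" for u
    by (simp add: abs_mult mult_left_mono)
  thus ?thesis using a by (auto simp: seq_bounded_def)
qed

lemma seq_bounded_zero: "(\<lambda>u. 0) \<in> seq_bounded N"
  by (auto simp: seq_bounded_def)

text \<open>The second conjunct feeds the induction: additivity applies to the next summand only if
  the partial sum is itself bounded and measurable.\<close>

lemma avgs_sum: 
  assumes "finite I" "\<And>i. i \<in> I \<Longrightarrow> f i \<in> seq_bounded N"
  shows "avgs \<kappa> j d (\<lambda>u. \<Sum>i\<in>I. c i * f i u) = (\<lambda>u. \<Sum>i\<in>I. c i * avgs \<kappa> j d (f i) u) \<and>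
    (\<lambda>u. \<Sum>i\<in>I. c i * f i u) \<in> seq_bounded N"
  using assms
proof (induction I rule: finite_induct)
  case empty thus ?case using avgs_scale[of j d 0 "\<lambda>_. 0"] by (simp add: seq_bounded_zero)
next
  case (insert i I)
  hence "(\<lambda>u. \<Sum>i\<in>I. c i * f i u) \<in> seq_bounded N" "(\<lambda>u. c i * f i u) \<in> seq_bounded N"
    by (auto intro: seq_bounded_scale)
  with insert show ?case by (auto simp: avgs_add avgs_scale seq_bounded_add)
qed

lemma seq_bounded_face: "f \<in> seq_bounded N \<Longrightarrow> (\<lambda>u. f (face i u)) \<in> seq_bounded N"
proof -
  assume f: "f \<in> seq_bounded N"
  have "face i \<in> measurable (PiM UNIV (\<lambda>_. N)) (PiM UNIV (\<lambda>_. N))"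
    by (rule measurable_PiM_single') (auto simp: face_def space_N)
  thus ?thesis using f by (auto simp: seq_bounded_def intro: measurable_compose)
qed

text \<open>Every face occurring in \<open>coface n\<close> deletes one of the \<open>n + 1\<close>
  averaged entries, so \<open>avgs_face_ge\<close> applies to each summand. Averaging all entries is
  thus a chain map.\<close>

lemma avgs_coface:
  assumes "f \<in> seq_bounded N"
  shows "avgs \<kappa> 0 (Suc n) (coface n f) u = coface n (avgs \<kappa> 0 n f) u"
proof -
  have "avgs \<kappa> 0 (Suc n) (coface n f) u = (\<Sum>i\<le>n. (- 1) ^ i * avgs \<kappa> 0 (Suc n) (\<lambda>u. f (face i u)) u)"
    unfolding coface_def[abs_def] using avgs_sum[of "{..n}" "\<lambda>i u. f (face i u)"] assms
    by (simp add: seq_bounded_face del: avgs.simps)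
  also have "\<dots> = (\<Sum>i\<le>n. (- 1) ^ i * avgs \<kappa> 0 n f (face i u))"
    by (intro sum.cong refl arg_cong2[where f="(*)"] avgs_face_ge) auto
  finally show ?thesis by (simp add: coface_def)
qed

text \<open>\<open>prism\<close> is the prism operator.  Writing \<open>S\<^sub>j\<close> for its terms and \<open>\<delta>\<^sub>i\<close> for composition with \<open>face i\<close>,
  \<open>S\<^sub>j \<delta>\<^sub>i\<close> equals \<open>\<delta>\<^sub>i S\<^sub>j\<^sub>-\<^sub>1\<close> for \<open>i < j\<close> and \<open>\<delta>\<^sub>i\<^sub>-\<^sub>1 S\<^sub>j\<close> for \<open>i > j + 1\<close>, while the
  terms with \<open>i = j\<close> and \<open>i = j + 1\<close> telescope.\<close>

lemma prism_homotopy: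
  assumes "f \<in> seq_bounded N"
  shows "prism \<kappa> (Suc n) (coface (Suc n) f) u + coface n (prism \<kappa> n f) u =
    avgs \<kappa> 0 (Suc n) f u - f u"
proof -
  define T where "T j i = (- 1) ^ (i + j) * avgs \<kappa> (Suc j) (Suc n - j) (\<lambda>u. f (face i u)) (dup j u)" for i j
  define R where "R j i = (- 1) ^ (i + j) * avgs \<kappa> (Suc j) (n - j) f (dup j (face i u))" for i j
  \<comment> \<open>The telescoping terms: entries from \<open>j\<close> to \<open>n\<close> are
    averaged and the earlier ones kept, so \<open>A 0\<close> is the full average and
    \<open>A (Suc n)\<close> is \<open>f\<close> itself.\<close>
  define A where "A j = avgs \<kappa> j (Suc n - j) f u" for j
  have 1: "prism \<kappa> (Suc n) (coface (Suc n) f) u = (\<Sum>j\<le>n. \<Sum>i\<le>Suc n. T j i)"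
  proof -
    have "avgs \<kappa> (Suc j) (Suc n - j) (coface (Suc n) f) v = 
       (\<Sum>i\<le>Suc n. (- 1) ^ i * avgs \<kappa> (Suc j) (Suc n - j) (\<lambda>u. f (face i u)) v)" for j v
      unfolding coface_def[abs_def] using avgs_sum[of "{..Suc n}" "\<lambda>i u. f (face i u)"] assms
      by (simp add: seq_bounded_face del: avgs.simps sum.atMost_Suc)
    thus ?thesis unfolding prism_def T_def
      by (simp add: sum_distrib_left power_add mult_ac lessThan_Suc_atMost del: avgs.simps sum.atMost_Suc)
  qed
  have 2: "coface n (prism \<kappa> n f) u = (\<Sum>j<n. \<Sum>i\<le>n. R j i)"
    unfolding coface_def prism_def R_def
    by (subst sum.swap) (simp add: sum_distrib_left power_add mult_ac del: avgs.simps sum.atMost_Suc)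
  have less: "T j i = - R (j - 1) i" if "i < j" "j \<le> n" for i j
  proof -
    have "j = Suc (j - 1)" using that(1) by simp
    then obtain j' where j: "j = Suc j'" ..
    have "avgs \<kappa> (Suc j) (Suc n - j) (\<lambda>u. f (face i u)) (dup j u) =
        avgs \<kappa> j (Suc n - j) f (dup j' (face i u))"
      using avgs_face_less[of i "Suc j" "Suc n - j" f "dup j u"] dup_face_less[of i j u] that j by simp
    thus ?thesis using j by (simp add: T_def R_def)
  qed
  have same: "T j j = A j" if "j \<le> n" for j
    using avgs_face_less[of j "Suc j" "Suc n - j" f "dup j u"]
    by (simp add: T_def A_def dup_face_same flip: mult_2)
  have ge: "avgs \<kappa> (Suc j) (Suc n - j) (\<lambda>u. f (face i u)) (dup j u) =
        avgs \<kappa> (Suc j) (n - j) f (face i (dup j u))" if "j < i" "i \<le> Suc n" "j \<le> n" for i j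
    using avgs_face_ge[of "Suc j" i "n - j" f "dup j u"] that by (simp add: Suc_diff_le)
  have next_same: "T j (Suc j) = - A (Suc j)" if "j \<le> n" for j
    using ge[of j "Suc j"] that
    by (simp add: T_def A_def dup_face_same flip: mult_2)
  have greater: "T j i = - R j (i - 1)" if "Suc j < i" "i \<le> Suc n" for i j
  proof -
    have "i = Suc (i - 1)" using that(1) by simp
    then obtain i' where i: "i = Suc i'" ..
    show ?thesis using ge[of j i] that i by (simp add: T_def R_def dup_face_greater)
  qed
  have row: "(\<Sum>i\<le>Suc n. T j i) = (A j - A (Suc j)) - (\<Sum>i<j. R (j - 1) i) - (\<Sum>i\<in>{j<..n}. R j i)"
    if "j \<le> n" for j
  proof -
    have "{..Suc n} = {..<j} \<union> {j, Suc j} \<union> {Suc j<..Suc n}" using that by auto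
    hence "(\<Sum>i\<le>Suc n. T j i) = (\<Sum>i<j. T j i) + (T j j + T j (Suc j)) + (\<Sum>i\<in>{Suc j<..Suc n}. T j i)"
      by (subst \<open>{..Suc n} = _\<close>, subst sum.union_disjoint, simp, simp, force, subst sum.union_disjoint) auto
    also have "(\<Sum>i\<in>{Suc j<..Suc n}. T j i) = (\<Sum>i\<in>{j<..n}. T j (Suc i))"
      by (rule sum.reindex_bij_witness[of _ Suc "\<lambda>i. i - 1"]) auto
    also have "\<dots> = (\<Sum>i\<in>{j<..n}. - R j i)" by (intro sum.cong) (auto simp: greater)
    also have "(\<Sum>i<j. T j i) = (\<Sum>i<j. - R (j - 1) i)" using that by (intro sum.cong) (auto simp: less)
    finally show ?thesis using that by (simp add: same next_same sum_negf)
  qed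
  have "(\<Sum>j\<le>n. \<Sum>i\<le>Suc n. T j i) = (\<Sum>j\<le>n. A j - A (Suc j)) - (\<Sum>j\<le>n. \<Sum>i<j. R (j - 1) i) 
      - (\<Sum>j\<le>n. \<Sum>i\<in>{j<..n}. R j i)"
    by (simp add: row sum_subtractf del: sum.atMost_Suc)
  also have "(\<Sum>j\<le>n. A j - A (Suc j)) = A 0 - A (Suc n)"
    by (induction n) auto
  also have "(\<Sum>j\<le>n. \<Sum>i<j. R (j - 1) i) = (\<Sum>j<n. \<Sum>i\<le>j. R j i)"
    unfolding lessThan_Suc_atMost[symmetric] sum.lessThan_Suc_shift by simp
  also have "(\<Sum>j\<le>n. \<Sum>i\<in>{j<..n}. R j i) = (\<Sum>j<n. \<Sum>i\<in>{j<..n}. R j i)"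
    by (simp flip: lessThan_Suc_atMost)
  \<comment> \<open>For fixed \<open>j < n\<close>, row \<open>j + 1\<close> has contributed the
    faces \<open>i \<le> j\<close> and row \<open>j\<close> the faces \<open>i > j\<close>; together
    they form the whole coboundary of the \<open>j\<close>-th prism term.\<close>
  also have "A 0 - A (Suc n) - (\<Sum>j<n. \<Sum>i\<le>j. R j i) - (\<Sum>j<n. \<Sum>i\<in>{j<..n}. R j i) = 
     A 0 - A (Suc n) - (\<Sum>j<n. \<Sum>i\<le>n. R j i)"
  proof -
    have "(\<Sum>i\<le>j. R j i) + (\<Sum>i\<in>{j<..n}. R j i) = (\<Sum>i\<le>n. R j i)" if "j < n" for j
    proof -
      have "{..n} = {..j} \<union> {j<..n}" using that by auto
      thus ?thesis by (simp add: sum.union_disjoint ivl_disj_int)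
    qed
    hence "(\<Sum>j<n. \<Sum>i\<le>j. R j i) + (\<Sum>j<n. \<Sum>i\<in>{j<..n}. R j i) = (\<Sum>j<n. \<Sum>i\<le>n. R j i)"
      by (simp flip: sum.distrib)
    thus ?thesis by linarith
  qed
  finally show ?thesis unfolding 1 2 by (simp add: A_def del: avgs.simps(2))
qed

end

section \<open>Iterated quantifiers along a filter\<close>

text \<open>A single notion covering both ideals: for \<open>ae_filter m\<close> it is the Fubini
  form of "almost every \<open>n\<close>-tuple" (\<open>AE_PiM_iff_iter\<close>), for
  \<open>principal V\<close> it means "all tuples with entries in \<open>V\<close>"
  (\<open>iter_principal\<close>). Entries from position \<open>n\<close> on are
  unrestricted.\<close>

fun iter :: "'a filter \<Rightarrow> nat \<Rightarrow> ((nat \<Rightarrow> 'a) \<Rightarrow> bool) \<Rightarrow> bool" where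
  "iter \<F> 0 Q \<longleftrightarrow> (\<forall>u. Q u)"
| "iter \<F> (Suc n) Q \<longleftrightarrow> (\<forall>\<^sub>F g in \<F>. iter \<F> n (\<lambda>u. Q (case_nat g u)))"

lemma iter_mono: "iter \<F> n Q \<Longrightarrow> (\<And>u. Q u \<Longrightarrow> R u) \<Longrightarrow> iter \<F> n R"
proof (induction n arbitrary: Q R)
  case (Suc n)
  show ?case using Suc.prems(1) unfolding iter.simps
    by (rule eventually_mono) (erule Suc.IH, rule Suc.prems(2))
qed auto

lemma iter_all: "\<forall>u. Q u \<Longrightarrow> iter \<F> n Q"
  by (induction n arbitrary: Q) (auto intro: always_eventually)

lemma iter_le: "iter \<F> j Q \<Longrightarrow> j \<le> n \<Longrightarrow> iter \<F> n Q"
proof (induction j arbitrary: n Q)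
  case 0 thus ?case by (auto intro: iter_all)
next
  case (Suc j)
  then obtain n' where n': "n = Suc n'" "j \<le> n'" by (cases n) auto
  have "\<forall>\<^sub>F g in \<F>. iter \<F> j (\<lambda>u. Q (case_nat g u))" using Suc.prems by simp
  hence "\<forall>\<^sub>F g in \<F>. iter \<F> n' (\<lambda>u. Q (case_nat g u))"
    by (rule eventually_mono) (rule Suc.IH[OF _ n'(2)])
  thus ?case by (simp add: n')
qed

lemma iter_conj: "iter \<F> n Q \<Longrightarrow> iter \<F> n R \<Longrightarrow> iter \<F> n (\<lambda>u. Q u \<and> R u)"
proof (induction n arbitrary: Q R)
  case (Suc n)
  have "\<forall>\<^sub>F g in \<F>. iter \<F> n (\<lambda>u. Q (case_nat g u))" "\<forall>\<^sub>F g in \<F>. iter \<F> n (\<lambda>u. R (case_nat g u))"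
    using Suc.prems by simp_all
  hence "\<forall>\<^sub>F g in \<F>. iter \<F> n (\<lambda>u. Q (case_nat g u) \<and> R (case_nat g u))"
    by (rule eventually_elim2) (rule Suc.IH)
  thus ?case by simp
qed auto

lemma iter_ball: "finite I \<Longrightarrow> (\<And>i. i \<in> I \<Longrightarrow> iter \<F> n (Q i)) \<Longrightarrow> iter \<F> n (\<lambda>u. \<forall>i\<in>I. Q i u)"
  by (induction I rule: finite_induct) (auto intro: iter_all iter_conj)

lemma dup_case_nat: "dup 0 (case_nat g u) = case_nat g (case_nat g u)"
    "dup (Suc j) (case_nat g u) = case_nat g (dup j u)"
  by (auto simp: dup_def fun_eq_iff split: nat.split)

text \<open>Repeating a variable is in general illegal under almost-everywhere quantifiers, since
  diagonals may be null. Here only the first \<open>j + 1\<close> entries are constrained, and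
  \<open>dup j\<close> leaves those in place; the repeated copy falls among the universally
  quantified entries.\<close>

lemma iter_dup: "iter \<F> (Suc j) Q \<Longrightarrow> iter \<F> (Suc j) (\<lambda>u. Q (dup j u))"
proof (induction j arbitrary: Q)
  case 0 thus ?case by (auto simp: dup_case_nat elim: eventually_mono)
next
  case (Suc j)
  have "\<forall>\<^sub>F g in \<F>. iter \<F> (Suc j) (\<lambda>u. Q (case_nat g u))"
    using Suc.prems by (subst (asm) iter.simps)
  hence "\<forall>\<^sub>F g in \<F>. iter \<F> (Suc j) (\<lambda>u. Q (dup (Suc j) (case_nat g u)))"
    by (rule eventually_mono) (unfold dup_case_nat, rule Suc.IH)
  thus ?case by (subst iter.simps)
qed

context averaging begin

text \<open>The assumption says that the kernel at every point, typical or not, charges only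
  filter-large sets. Hence averaging the last constrained entry removes the condition on it
  altogether.\<close>

lemma iter_avg:
  assumes "\<And>g Q. eventually Q \<F> \<Longrightarrow> AE k in \<kappa> g. Q k" and "0 \<le> B"
  shows "iter \<F> (Suc j) (\<lambda>u. \<bar>f u\<bar> \<le> B) \<Longrightarrow> iter \<F> j (\<lambda>u. \<bar>avg \<kappa> j f u\<bar> \<le> B)"
proof (induction j arbitrary: f)
  case 0
  show ?case unfolding iter.simps
  proof
    fix u :: "nat \<Rightarrow> 'a"
    interpret prob_space "\<kappa> (u 0)" by (rule kernel_prob)
    have "\<forall>\<^sub>F g in \<F>. \<forall>v. \<bar>f (case_nat g v)\<bar> \<le> B" using 0 by simp
    hence "AE k in \<kappa> (u 0). \<forall>v. \<bar>f (case_nat k v)\<bar> \<le> B" by (rule assms)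
    hence ae: "AE k in \<kappa> (u 0). \<bar>f (u(0 := k))\<bar> \<le> B"
    proof (rule AE_mp, intro AE_I2 impI)
      fix k assume "\<forall>v. \<bar>f (case_nat k v)\<bar> \<le> B"
      moreover have "u(0 := k) = case_nat k (\<lambda>i. u (Suc i))" by (auto split: nat.split)
      ultimately show "\<bar>f (u(0 := k))\<bar> \<le> B" by simp
    qed
    show "\<bar>avg \<kappa> 0 f u\<bar> \<le> B"
    proof (cases "integrable (\<kappa> (u 0)) (\<lambda>k. f (u(0 := k)))")
      case True
      have "\<bar>avg \<kappa> 0 f u\<bar> \<le> (\<integral>k. \<bar>f (u(0 := k))\<bar> \<partial>\<kappa> (u 0))"
        unfolding avg_def by (rule integral_abs_bound)
      also have "\<dots> \<le> (\<integral>k. B \<partial>\<kappa> (u 0))"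
        by (intro integral_mono_AE) (use True ae in auto)
      finally show ?thesis by (simp add: prob_space)
    qed (simp add: avg_def not_integrable_integral_eq assms)
  qed
next
  case (Suc j)
  have "avg \<kappa> (Suc j) f (case_nat g u) = avg \<kappa> j (\<lambda>v. f (case_nat g v)) u" for g u
  proof -
    have "(case_nat g u)(Suc j := k) = case_nat g (u(j := k))" for k by (auto split: nat.split)
    thus ?thesis by (simp add: avg_def)
  qed
  moreover have "\<forall>\<^sub>F g in \<F>. iter \<F> j (\<lambda>u. \<bar>avg \<kappa> j (\<lambda>v. f (case_nat g v)) u\<bar> \<le> B)"
  proof (rule eventually_mono)
    show "\<forall>\<^sub>F g in \<F>. iter \<F> (Suc j) (\<lambda>u. \<bar>f (case_nat g u)\<bar> \<le> B)"
      using Suc.prems by (subst (asm) iter.simps)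
  qed (rule Suc.IH)
  ultimately show ?case by simp
qed

text \<open>For \<open>j = 0\<close> nothing remains of the filter: the bound holds at every
  sequence. This is the gain that makes an averaged cochain meaningful modulo any other
  ideal.\<close>

lemma iter_avgs:
  assumes "\<And>g Q. eventually Q \<F> \<Longrightarrow> AE k in \<kappa> g. Q k" and "0 \<le> B"
  shows "iter \<F> (j + d) (\<lambda>u. \<bar>f u\<bar> \<le> B) \<Longrightarrow> iter \<F> j (\<lambda>u. \<bar>avgs \<kappa> j d f u\<bar> \<le> B)"
proof (induction d arbitrary: j)
  case (Suc d)
  show ?case unfolding avgs.simps
    by (rule iter_avg[OF assms], assumption, rule Suc.IH) (use Suc.prems in simp)
qed simp

text \<open>In the \<open>j\<close>-th term the entries after \<open>j\<close> are averaged away,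
  which leaves a condition on the first \<open>j + 1\<close> entries only; this survives
  \<open>dup j\<close>, and \<open>j + 1 \<le> n\<close>. Vanishing is treated as the bound
  0.\<close>

lemma iter_prism:
  assumes "\<And>g Q. eventually Q \<F> \<Longrightarrow> AE k in \<kappa> g. Q k" and "iter \<F> (Suc n) (\<lambda>u. f u = 0)"
  shows "iter \<F> n (\<lambda>u. prism \<kappa> n f u = 0)"
proof -
  have "iter \<F> n (\<lambda>u. avgs \<kappa> (Suc j) (n - j) f (dup j u) = 0)" if "j < n" for j
  proof -
    have "iter \<F> (Suc j) (\<lambda>u. \<bar>avgs \<kappa> (Suc j) (n - j) f u\<bar> \<le> 0)"
    proof (rule iter_avgs)
      have "Suc j + (n - j) = Suc n" using that by simp
      thus "iter \<F> (Suc j + (n - j)) (\<lambda>u. \<bar>f u\<bar> \<le> 0)" using assms(2) by (simp only: abs_le_zero_iff)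
    qed (erule assms(1), simp)
    from iter_dup[OF this] have "iter \<F> (Suc j) (\<lambda>u. avgs \<kappa> (Suc j) (n - j) f (dup j u) = 0)"
      by (simp only: abs_le_zero_iff)
    thus ?thesis by (rule iter_le) (use that in simp)
  qed
  hence "iter \<F> n (\<lambda>u. \<forall>j\<in>{..<n}. avgs \<kappa> (Suc j) (n - j) f (dup j u) = 0)"
    by (intro iter_ball) auto
  thus ?thesis
  proof (rule iter_mono)
    fix u assume *: "\<forall>j\<in>{..<n}. avgs \<kappa> (Suc j) (n - j) f (dup j u) = 0"
    show "prism \<kappa> n f u = 0" unfolding prism_def
      by (rule sum.neutral) (use * in simp)
  qed
qed

end

section \<open>Isometric isomorphisms of cohomology\<close>

text \<open>Presents a complex of seminormed spaces as the image under \<open>r\<close> of a complex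
  of honest functions. As \<open>A\<close> and \<open>D\<close> are shared by both complexes,
  comparison maps and homotopies can be written down on functions, and only their compatibility with
  the two maps \<open>r\<close> remains to be checked.\<close>

locale cochain_presentation =
  fixes A :: "nat \<Rightarrow> ('p \<Rightarrow> real) set" and D :: "nat \<Rightarrow> ('p \<Rightarrow> real) \<Rightarrow> 'p \<Rightarrow> real"
    and C :: "nat \<Rightarrow> 'v seminormed_space" and d :: "nat \<Rightarrow> 'v \<Rightarrow> 'v"
    and r :: "nat \<Rightarrow> ('p \<Rightarrow> real) \<Rightarrow> 'v"
  assumes A_zero: "(\<lambda>_. 0) \<in> A k"
    and A_add: "F \<in> A k \<Longrightarrow> G \<in> A k \<Longrightarrow> (\<lambda>p. F p + G p) \<in> A k"
    and A_scale: "F \<in> A k \<Longrightarrow> (\<lambda>p. c * F p) \<in> A k"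
    and D_in: "F \<in> A k \<Longrightarrow> D k F \<in> A (Suc k)"
    and D_add: "F \<in> A k \<Longrightarrow> G \<in> A k \<Longrightarrow> D k (\<lambda>p. F p + G p) = (\<lambda>p. D k F p + D k G p)"
    and D_scale: "F \<in> A k \<Longrightarrow> D k (\<lambda>p. c * F p) = (\<lambda>p. c * D k F p)"
    and carrier_eq: "carrier (C k) = r k ` A k"
    and r_add: "F \<in> A k \<Longrightarrow> G \<in> A k \<Longrightarrow> vadd (C k) (r k F) (r k G) = r k (\<lambda>p. F p + G p)"
    and r_scale: "F \<in> A k \<Longrightarrow> vscale (C k) c (r k F) = r k (\<lambda>p. c * F p)"
    and r_zero: "vzero (C k) = r k (\<lambda>_. 0)"
    and d_r: "F \<in> A k \<Longrightarrow> d k (r k F) = r (Suc k) (D k F)"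
    and norm_nonneg: "F \<in> A k \<Longrightarrow> 0 \<le> vnorm (C k) (r k F)"
begin

text \<open>Cocycles are taken relative to \<open>r\<close>: \<open>D k F\<close> has to be null in
  \<open>C\<close>, not zero as a function, so the two presentations have different
  \<open>Z\<close>. The set \<open>B\<close> below does not involve \<open>r\<close>.\<close>

definition Z where "Z k = {F \<in> A k. r (Suc k) (D k F) = vzero (C (Suc k))}"

fun B where "B 0 = {\<lambda>_. 0}" | "B (Suc k) = D k ` A k"

definition cls where "cls k F = {r k (\<lambda>p. F p + E p) | E. E \<in> B k}"

lemma B_in: "E \<in> B k \<Longrightarrow> E \<in> A k"
  by (cases k) (auto intro: A_zero D_in)

lemma B_zero: "(\<lambda>_. 0) \<in> B k"
proof (cases k)
  case (Suc k')
  have "D k' (\<lambda>p. 0 * 0) = (\<lambda>p. 0 * D k' (\<lambda>_. 0) p)" by (rule D_scale[OF A_zero])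
  hence "D k' (\<lambda>_. 0) = (\<lambda>_. 0)" by simp
  thus ?thesis using A_zero Suc by (metis B.simps(2) image_eqI)
qed simp

lemma B_add: "E \<in> B k \<Longrightarrow> F \<in> B k \<Longrightarrow> (\<lambda>p. E p + F p) \<in> B k"
proof (cases k)
  case (Suc k')
  moreover assume "E \<in> B k" "F \<in> B k"
  ultimately obtain E' F' where "E' \<in> A k'" "F' \<in> A k'" "E = D k' E'" "F = D k' F'" by auto
  thus ?thesis using A_add[of E' k' F'] D_add[of E' k' F'] Suc by (metis B.simps(2) image_eqI)
qed simp

lemma B_scale: "E \<in> B k \<Longrightarrow> (\<lambda>p. c * E p) \<in> B k"
proof (cases k)
  case (Suc k')
  moreover assume "E \<in> B k"
  ultimately obtain E' where "E' \<in> A k'" "E = D k' E'" by auto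
  thus ?thesis using A_scale[of E' k' c] D_scale[of E' k' c] Suc by (metis B.simps(2) image_eqI)
qed simp

lemma coboundaries_eq: "coboundaries C d k = r k ` B k"
proof (cases k)
  case (Suc k')
  have "d k' ` carrier (C k') = r k ` (D k' ` A k')"
    unfolding carrier_eq image_image using d_r Suc by (intro image_cong) auto
  thus ?thesis using Suc by simp
qed (simp add: r_zero)

lemma Z_in: "F \<in> Z k \<Longrightarrow> F \<in> A k" by (simp add: Z_def)

lemma cocycles_eq: "cocycles C d k = r k ` Z k"
  unfolding cocycles_def Z_def carrier_eq by (auto simp: d_r)

lemma coset_eq: "F \<in> A k \<Longrightarrow> coset (subspace_on (C k) U) (coboundaries C d k) (r k F) = cls k F"
  unfolding coset_def coboundaries_eq cls_def subspace_on_def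
  by (force simp: r_add B_in)

lemma cohomology_carrier: "carrier (cohomology C d k) = cls k ` Z k"
proof -
  have "carrier (cohomology C d k) = coset (subspace_on (C k) (cocycles C d k)) (coboundaries C d k) ` r k ` Z k"
    by (simp add: cohomology_def quotient_space_def subspace_on_def cocycles_eq)
  also have "\<dots> = cls k ` Z k"
    unfolding image_image by (intro image_cong refl coset_eq Z_in)
  finally show ?thesis .
qed

lemma cls_memI: "E \<in> B k \<Longrightarrow> r k (\<lambda>p. F p + E p) \<in> cls k F"
  by (auto simp: cls_def)

lemma cls_memI0: "r k (\<lambda>p. F p + 0) \<in> cls k F"
  by (rule cls_memI[OF B_zero])

lemma cohomology_vadd:
  assumes F: "F \<in> A k" and G: "G \<in> A k"
  shows "vadd (cohomology C d k) (cls k F) (cls k G) = cls k (\<lambda>p. F p + G p)"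
proof -
  have "vadd (cohomology C d k) (cls k F) (cls k G) = {vadd (C k) a b |a b. a \<in> cls k F \<and> b \<in> cls k G}"
    by (simp add: cohomology_def quotient_space_def subspace_on_def)
  also have "\<dots> = cls k (\<lambda>p. F p + G p)"
  proof (intro set_eqI iffI)
    fix a assume "a \<in> {vadd (C k) a b |a b. a \<in> cls k F \<and> b \<in> cls k G}"
    then obtain E E' where E: "E \<in> B k" "E' \<in> B k" 
      "a = vadd (C k) (r k (\<lambda>p. F p + E p)) (r k (\<lambda>p. G p + E' p))" by (auto simp: cls_def)
    hence "a = r k (\<lambda>p. (F p + E p) + (G p + E' p))" using F G by (simp add: r_add A_add B_in)
    also have "(\<lambda>p. (F p + E p) + (G p + E' p)) = (\<lambda>p. (F p + G p) + (E p + E' p))" by auto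
    finally show "a \<in> cls k (\<lambda>p. F p + G p)" using cls_memI[OF B_add[OF E(1,2)], of "\<lambda>p. F p + G p"] by simp
  next
    fix a assume "a \<in> cls k (\<lambda>p. F p + G p)"
    then obtain E where E: "E \<in> B k" "a = r k (\<lambda>p. (F p + G p) + E p)" by (auto simp: cls_def)
    have "(\<lambda>p. (F p + G p) + E p) = (\<lambda>p. (F p + E p) + (G p + 0))" by auto
    hence "a = vadd (C k) (r k (\<lambda>p. F p + E p)) (r k (\<lambda>p. G p + 0))"
      using E F G by (simp add: r_add A_add B_in)
    thus "a \<in> {vadd (C k) a b |a b. a \<in> cls k F \<and> b \<in> cls k G}"
      using cls_memI[OF E(1), of F] cls_memI0[of k G] by blast
  qed
  finally show ?thesis .
qed

lemma cohomology_vscale: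
  assumes F: "F \<in> A k"
  shows "vscale (cohomology C d k) c (cls k F) = cls k (\<lambda>p. c * F p)"
proof -
  have "vscale (cohomology C d k) c (cls k F) =
    {vadd (C k) (vscale (C k) c a) w |a w. a \<in> cls k F \<and> w \<in> r k ` B k}"
    by (simp add: cohomology_def quotient_space_def subspace_on_def coboundaries_eq)
  also have "\<dots> = cls k (\<lambda>p. c * F p)"
  proof (intro set_eqI iffI)
    fix a assume "a \<in> {vadd (C k) (vscale (C k) c a) w |a w. a \<in> cls k F \<and> w \<in> r k ` B k}"
    then obtain E E' where E: "E \<in> B k" "E' \<in> B k" 
      "a = vadd (C k) (vscale (C k) c (r k (\<lambda>p. F p + E p))) (r k E')" by (auto simp: cls_def)
    hence "a = r k (\<lambda>p. c * (F p + E p) + E' p)" using F by (simp add: r_add r_scale A_add A_scale B_in)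
    also have "(\<lambda>p. c * (F p + E p) + E' p) = (\<lambda>p. c * F p + (c * E p + E' p))" by (auto simp: algebra_simps)
    finally show "a \<in> cls k (\<lambda>p. c * F p)"
      using cls_memI[OF B_add[OF B_scale[OF E(1)] E(2)], of "\<lambda>p. c * F p" c] by simp
  next
    fix a assume "a \<in> cls k (\<lambda>p. c * F p)"
    then obtain E where E: "E \<in> B k" "a = r k (\<lambda>p. c * F p + E p)" by (auto simp: cls_def)
    hence "a = vadd (C k) (vscale (C k) c (r k (\<lambda>p. F p + 0))) (r k E)"
      using F by (simp add: r_add r_scale A_scale B_in)
    thus "a \<in> {vadd (C k) (vscale (C k) c a) w |a w. a \<in> cls k F \<and> w \<in> r k ` B k}"
      using cls_memI0[of k F] E(1) by blast
  qed
  finally show ?thesis .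
qed

lemma cohomology_vnorm: "vnorm (cohomology C d k) S = Inf (vnorm (C k) ` S)"
  by (simp add: cohomology_def quotient_space_def subspace_on_def)

text \<open>No cancellation law is assumed in \<open>C k\<close>. Adding the class of
  \<open>- G\<close> and using additivity of \<open>r\<close> replaces it; the form
  \<open>(- 1) * G p\<close> makes the closure assumptions apply literally.\<close>

lemma r_eq_zero_iff:
  assumes F: "F \<in> A k" and G: "G \<in> A k"
  shows "r k (\<lambda>p. F p + (- 1) * G p) = vzero (C k) \<longleftrightarrow> r k F = r k G"
proof
  have mG: "(\<lambda>p. (- 1) * G p) \<in> A k" using A_scale[OF G] .
  assume "r k F = r k G"
  hence "vadd (C k) (r k F) (r k (\<lambda>p. (- 1) * G p)) = vadd (C k) (r k G) (r k (\<lambda>p. (- 1) * G p))" by simp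
  thus "r k (\<lambda>p. F p + (- 1) * G p) = vzero (C k)"
    by (simp only: r_add[OF F mG] r_add[OF G mG] r_zero) simp
next
  assume *: "r k (\<lambda>p. F p + (- 1) * G p) = vzero (C k)"
  have mFG: "(\<lambda>p. F p + (- 1) * G p) \<in> A k" using A_add[OF F A_scale[OF G]] .
  have "vadd (C k) (r k (\<lambda>p. F p + (- 1) * G p)) (r k G) = vadd (C k) (r k (\<lambda>_. 0)) (r k G)"
    by (simp only: * r_zero)
  thus "r k F = r k G" by (simp only: r_add[OF mFG G] r_add[OF A_zero G]) simp
qed

lemma cls_eq_iff:
  assumes F: "F \<in> A k" and G: "G \<in> A k"
  shows "cls k F = cls k G \<longleftrightarrow> (\<exists>E\<in>B k. r k F = r k (\<lambda>p. G p + E p))"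
proof
  assume "cls k F = cls k G"
  moreover have "r k F \<in> cls k F" using cls_memI0[of k F] by simp
  ultimately show "\<exists>E\<in>B k. r k F = r k (\<lambda>p. G p + E p)" by (auto simp: cls_def)
next
  have sub: "cls k F \<subseteq> cls k G" if E: "E \<in> B k" "r k F = r k (\<lambda>p. G p + E p)"
    and F: "F \<in> A k" and G: "G \<in> A k" for F G E
  proof
    fix a assume "a \<in> cls k F"
    then obtain E' where E': "E' \<in> B k" "a = r k (\<lambda>p. F p + E' p)" by (auto simp: cls_def)
    hence "a = vadd (C k) (r k (\<lambda>p. G p + E p)) (r k E')" using F E by (simp add: B_in flip: r_add)
    also have "\<dots> = r k (\<lambda>p. G p + (E p + E' p))"
      using G E E' by (simp add: r_add A_add B_in add.assoc)
    finally show "a \<in> cls k G" using cls_memI[OF B_add[OF E(1) E'(1)], of G] by simp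
  qed
  assume "\<exists>E\<in>B k. r k F = r k (\<lambda>p. G p + E p)"
  then obtain E where E: "E \<in> B k" "r k F = r k (\<lambda>p. G p + E p)" by blast
  have mE: "(\<lambda>p. (- 1) * E p) \<in> B k" by (rule B_scale[OF E(1)])
  have "vadd (C k) (r k F) (r k (\<lambda>p. (- 1) * E p)) = vadd (C k) (r k (\<lambda>p. G p + E p)) (r k (\<lambda>p. (- 1) * E p))"
    by (simp only: E(2))
  hence "r k (\<lambda>p. F p + (- 1) * E p) = r k (\<lambda>p. G p + E p + (- 1) * E p)"
    by (simp only: r_add[OF F B_in[OF mE]] r_add[OF A_add[OF G B_in[OF E(1)]] B_in[OF mE]])
  hence "r k G = r k (\<lambda>p. F p + (- 1) * E p)" by simp
  from sub[OF mE this G F] sub[OF E F G] show "cls k F = cls k G" by blast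
qed

end

locale presentation_map =
  P: cochain_presentation A D C d r + P': cochain_presentation A D C' d' r'
  for A :: "nat \<Rightarrow> ('p \<Rightarrow> real) set" and D and C :: "nat \<Rightarrow> 'v seminormed_space" and d r
    and C' :: "nat \<Rightarrow> 'w seminormed_space" and d' r' +
  fixes \<Phi> :: "nat \<Rightarrow> ('p \<Rightarrow> real) \<Rightarrow> 'p \<Rightarrow> real"
  assumes map_in: "F \<in> A k \<Longrightarrow> \<Phi> k F \<in> A k"
    and map_add: "F \<in> A k \<Longrightarrow> G \<in> A k \<Longrightarrow> \<Phi> k (\<lambda>p. F p + G p) = (\<lambda>p. \<Phi> k F p + \<Phi> k G p)"
    and map_scale: "F \<in> A k \<Longrightarrow> \<Phi> k (\<lambda>p. c * F p) = (\<lambda>p. c * \<Phi> k F p)"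
    and map_D: "F \<in> A k \<Longrightarrow> \<Phi> (Suc k) (D k F) = D k (\<Phi> k F)"
    and map_norm: "F \<in> A k \<Longrightarrow> vnorm (C' k) (r' k (\<Phi> k F)) \<le> vnorm (C k) (r k F)"
    and map_zero: "F \<in> A k \<Longrightarrow> r k F = vzero (C k) \<Longrightarrow> r' k (\<Phi> k F) = vzero (C' k)"
begin

lemma map_B: "E \<in> P.B k \<Longrightarrow> \<Phi> k E \<in> P'.B k"
proof (cases k)
  case 0
  assume "E \<in> P.B k"
  hence "E = (\<lambda>_. 0)" using 0 by simp
  moreover have "\<Phi> k (\<lambda>p. 0 * 0) = (\<lambda>p. 0 * \<Phi> k (\<lambda>_. 0) p)" by (rule map_scale[OF P.A_zero])
  ultimately show ?thesis using 0 by simp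
next
  case (Suc k')
  assume "E \<in> P.B k"
  thus ?thesis using Suc map_D map_in by (auto intro!: image_eqI)
qed

lemma map_Z: "F \<in> P.Z k \<Longrightarrow> \<Phi> k F \<in> P'.Z k"
  using map_zero[OF P.D_in, of F k] map_D[of F k] map_in[of F k] by (auto simp: P.Z_def P'.Z_def)

lemma map_r_cong: "F \<in> A k \<Longrightarrow> G \<in> A k \<Longrightarrow> r k F = r k G \<Longrightarrow> r' k (\<Phi> k F) = r' k (\<Phi> k G)"
proof -
  assume F: "F \<in> A k" and G: "G \<in> A k" and eq: "r k F = r k G"
  have "r' k (\<Phi> k (\<lambda>p. F p + (- 1) * G p)) = vzero (C' k)"
    using P.r_eq_zero_iff[OF F G] eq by (intro map_zero P.A_add[OF F P.A_scale[OF G]]) simp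
  moreover have "\<Phi> k (\<lambda>p. F p + (- 1) * G p) = (\<lambda>p. \<Phi> k F p + (- 1) * \<Phi> k G p)"
    by (simp only: map_add[OF F P.A_scale[OF G]] map_scale[OF G])
  ultimately show ?thesis using P'.r_eq_zero_iff[OF map_in[OF F] map_in[OF G]] by simp
qed

lemma map_cls_cong:
  assumes "F \<in> A k" "G \<in> A k" "P.cls k F = P.cls k G"
  shows "P'.cls k (\<Phi> k F) = P'.cls k (\<Phi> k G)"
proof -
  obtain E where E: "E \<in> P.B k" "r k F = r k (\<lambda>p. G p + E p)" using assms P.cls_eq_iff by blast
  hence "r' k (\<Phi> k F) = r' k (\<lambda>p. \<Phi> k G p + \<Phi> k E p)"
    using map_r_cong[of F k "\<lambda>p. G p + E p"] assms P.A_add P.B_in map_add[of G k E] by simp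
  thus ?thesis using P'.cls_eq_iff map_B[OF E(1)] map_in assms by blast
qed

text \<open>Any representative \<open>F + E\<close> of the source class is sent to a representative
  of the target class whose norm is no larger, so the infimum over the target class can only be
  smaller.\<close>

lemma map_cls_norm:
  assumes F: "F \<in> A k"
  shows "Inf (vnorm (C' k) ` P'.cls k (\<Phi> k F)) \<le> Inf (vnorm (C k) ` P.cls k F)"
proof (rule cInf_mono)
  show "vnorm (C k) ` P.cls k F \<noteq> {}" using P.B_zero by (auto simp: P.cls_def)
  have "0 \<le> a" if "a \<in> vnorm (C' k) ` P'.cls k (\<Phi> k F)" for a
    using that P'.norm_nonneg map_in[OF F] P'.A_add P'.B_in by (auto simp: P'.cls_def)
  thus "bdd_below (vnorm (C' k) ` P'.cls k (\<Phi> k F))" by (rule bdd_belowI)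
next
  fix a assume "a \<in> vnorm (C k) ` P.cls k F"
  then obtain E where E: "E \<in> P.B k" "a = vnorm (C k) (r k (\<lambda>p. F p + E p))" by (auto simp: P.cls_def)
  have "vnorm (C' k) (r' k (\<lambda>p. \<Phi> k F p + \<Phi> k E p)) \<le> a"
    using map_norm[OF P.A_add[OF F P.B_in[OF E(1)]]] map_add[OF F P.B_in[OF E(1)]] E(2) by simp
  thus "\<exists>b\<in>vnorm (C' k) ` P'.cls k (\<Phi> k F). b \<le> a"
    using P'.cls_memI[OF map_B[OF E(1)]] by blast
qed

end

text \<open>Two norm-nonincreasing maps that are inverse to each other on cohomology must both be
  isometric. Assumptions 3 and 4 express the homotopies where they matter: on relative cocycles, up
  to a coboundary, and after applying \<open>r\<close>.\<close>

theorem cohomology_isometric_isomorphism: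
  fixes A :: "nat \<Rightarrow> ('p \<Rightarrow> real) set" and C :: "nat \<Rightarrow> 'v seminormed_space" and C' :: "nat \<Rightarrow> 'w seminormed_space"
  assumes 1: "presentation_map A D C d r C' d' r' \<Phi>"
    and 2: "presentation_map A D C' d' r' C d r \<Psi>"
    and 3: "\<And>F. F \<in> A k \<Longrightarrow> r (Suc k) (D k F) = vzero (C (Suc k)) \<Longrightarrow>
      \<exists>E\<in>(case k of 0 \<Rightarrow> {\<lambda>_. 0} | Suc k' \<Rightarrow> D k' ` A k'). r k (\<Psi> k (\<Phi> k F)) = r k (\<lambda>p. F p + E p)"
    and 4: "\<And>F. F \<in> A k \<Longrightarrow> r' (Suc k) (D k F) = vzero (C' (Suc k)) \<Longrightarrow>
      \<exists>E\<in>(case k of 0 \<Rightarrow> {\<lambda>_. 0} | Suc k' \<Rightarrow> D k' ` A k'). r' k (\<Phi> k (\<Psi> k F)) = r' k (\<lambda>p. F p + E p)"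
  shows "\<exists>\<phi>. isometric_isomorphism (cohomology C d k) (cohomology C' d' k) \<phi>"
proof -
  interpret M: presentation_map A D C d r C' d' r' \<Phi> by (rule 1)
  interpret M': presentation_map A D C' d' r' C d r \<Psi> by (rule 2)
  have B: "M.P.B k = (case k of 0 \<Rightarrow> {\<lambda>_. 0} | Suc k' \<Rightarrow> D k' ` A k')"
          "M.P'.B k = (case k of 0 \<Rightarrow> {\<lambda>_. 0} | Suc k' \<Rightarrow> D k' ` A k')"
    by (cases k; simp)+
  have PsiPhi: "M.P.cls k (\<Psi> k (\<Phi> k F)) = M.P.cls k F" if "F \<in> M.P.Z k" for F
    using 3[of F] that M.map_in M'.map_in unfolding B(1)[symmetric]
    by (subst M.P.cls_eq_iff) (auto simp: M.P.Z_def)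
  have PhiPsi: "M.P'.cls k (\<Phi> k (\<Psi> k F)) = M.P'.cls k F" if "F \<in> M.P'.Z k" for F
    using 4[of F] that M.map_in M'.map_in unfolding B(2)[symmetric]
    by (subst M.P'.cls_eq_iff) (auto simp: M.P'.Z_def)
  \<comment> \<open>The isomorphism is a function of cosets, so a representative has to be chosen;
    by \<open>map_cls_cong\<close> its value does not depend on the choice.\<close>
  define rep where "rep S = (SOME F. F \<in> M.P.Z k \<and> S = M.P.cls k F)" for S
  have rep: "rep (M.P.cls k F) \<in> M.P.Z k \<and> M.P.cls k F = M.P.cls k (rep (M.P.cls k F))" if "F \<in> M.P.Z k" for F
  proof -
    have "\<exists>G. G \<in> M.P.Z k \<and> M.P.cls k F = M.P.cls k G" using that by blast
    thus ?thesis unfolding rep_def by (rule someI_ex)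
  qed
  define \<phi> where "\<phi> S = M.P'.cls k (\<Phi> k (rep S))" for S
  have \<phi>: "\<phi> (M.P.cls k F) = M.P'.cls k (\<Phi> k F)" if "F \<in> M.P.Z k" for F
    unfolding \<phi>_def using rep[OF that] that M.P.Z_in by (intro M.map_cls_cong) auto
  have Z_add: "(\<lambda>p. F p + G p) \<in> M.P.Z k" if "F \<in> M.P.Z k" "G \<in> M.P.Z k" for F G
  proof -
    have FG: "F \<in> A k" "G \<in> A k" and z: "r (Suc k) (D k F) = vzero (C (Suc k))" "r (Suc k) (D k G) = vzero (C (Suc k))"
      using that by (auto simp: M.P.Z_def)
    have "r (Suc k) (D k (\<lambda>p. F p + G p)) = vadd (C (Suc k)) (r (Suc k) (\<lambda>_. 0)) (r (Suc k) (\<lambda>_. 0))"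
      using z by (simp add: M.P.D_add[OF FG] M.P.D_in[OF FG(1)] M.P.D_in[OF FG(2)] M.P.r_zero flip: M.P.r_add)
    thus ?thesis using FG by (simp add: M.P.r_add M.P.A_zero M.P.Z_def M.P.r_zero M.P.A_add)
  qed
  have Z_scale: "(\<lambda>p. c * F p) \<in> M.P.Z k" if "F \<in> M.P.Z k" for F c
  proof -
    have F: "F \<in> A k" and z: "r (Suc k) (D k F) = vzero (C (Suc k))"
      using that by (auto simp: M.P.Z_def)
    have "r (Suc k) (D k (\<lambda>p. c * F p)) = vscale (C (Suc k)) c (r (Suc k) (\<lambda>_. 0))"
      using z by (simp add: M.P.D_scale[OF F] M.P.D_in[OF F] M.P.r_zero flip: M.P.r_scale)
    thus ?thesis using F by (simp add: M.P.r_scale M.P.A_zero M.P.Z_def M.P.r_zero M.P.A_scale)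
  qed
  have "isometric_isomorphism (cohomology C d k) (cohomology C' d' k) \<phi>"
    unfolding isometric_isomorphism_def
  proof (intro conjI ballI allI)
    show "bij_betw \<phi> (carrier (cohomology C d k)) (carrier (cohomology C' d' k))"
      unfolding M.P.cohomology_carrier M.P'.cohomology_carrier bij_betw_def
    proof (intro conjI inj_onI)
      fix S T assume "S \<in> M.P.cls k ` M.P.Z k" "T \<in> M.P.cls k ` M.P.Z k" and eq: "\<phi> S = \<phi> T"
      then obtain F G where FG: "F \<in> M.P.Z k" "G \<in> M.P.Z k" "S = M.P.cls k F" "T = M.P.cls k G" by blast
      hence "M.P'.cls k (\<Phi> k F) = M.P'.cls k (\<Phi> k G)" using eq \<phi> by simp
      hence "M.P.cls k (\<Psi> k (\<Phi> k F)) = M.P.cls k (\<Psi> k (\<Phi> k G))"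
        using FG M.map_in M.P.Z_in by (intro M'.map_cls_cong) auto
      thus "S = T" using FG PsiPhi by simp
    next
      show "\<phi> ` M.P.cls k ` M.P.Z k = M.P'.cls k ` M.P'.Z k"
      proof (intro set_eqI iffI)
        fix S assume "S \<in> \<phi> ` M.P.cls k ` M.P.Z k"
        thus "S \<in> M.P'.cls k ` M.P'.Z k" using \<phi> M.map_Z by auto
      next
        fix S assume "S \<in> M.P'.cls k ` M.P'.Z k"
        then obtain F where F: "F \<in> M.P'.Z k" "S = M.P'.cls k F" by blast
        hence "S = \<phi> (M.P.cls k (\<Psi> k F))" using \<phi>[OF M'.map_Z[OF F(1)]] PhiPsi by simp
        thus "S \<in> \<phi> ` M.P.cls k ` M.P.Z k" using M'.map_Z[OF F(1)] by blast
      qed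
    qed
  next
    fix S T assume "S \<in> carrier (cohomology C d k)" "T \<in> carrier (cohomology C d k)"
    then obtain F G where FG: "F \<in> M.P.Z k" "G \<in> M.P.Z k" "S = M.P.cls k F" "T = M.P.cls k G"
      unfolding M.P.cohomology_carrier by blast
    note A = FG(1,2)[THEN M.P.Z_in]
    show "\<phi> (vadd (cohomology C d k) S T) = vadd (cohomology C' d' k) (\<phi> S) (\<phi> T)"
      using FG A by (simp add: M.P.cohomology_vadd M.P'.cohomology_vadd \<phi> Z_add M.map_in M.map_add)
  next
    fix c S assume "S \<in> carrier (cohomology C d k)"
    then obtain F where F: "F \<in> M.P.Z k" "S = M.P.cls k F"
      unfolding M.P.cohomology_carrier by blast
    note A = F(1)[THEN M.P.Z_in]
    show "\<phi> (vscale (cohomology C d k) c S) = vscale (cohomology C' d' k) c (\<phi> S)"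
      using F A by (simp add: M.P.cohomology_vscale M.P'.cohomology_vscale \<phi> Z_scale M.map_in M.map_scale)
  next
    fix S assume "S \<in> carrier (cohomology C d k)"
    then obtain F where F: "F \<in> M.P.Z k" "S = M.P.cls k F"
      unfolding M.P.cohomology_carrier by blast
    note A = F(1)[THEN M.P.Z_in]
    have "Inf (vnorm (C k) ` M.P.cls k F) \<le> Inf (vnorm (C' k) ` M.P'.cls k (\<Phi> k F))"
      using M'.map_cls_norm[OF M.map_in[OF A]] PsiPhi[OF F(1)] by simp
    with M.map_cls_norm[OF A] show "vnorm (cohomology C' d' k) (\<phi> S) = vnorm (cohomology C d k) S"
      using F by (simp add: M.P.cohomology_vnorm M.P'.cohomology_vnorm \<phi>)
  qed
  thus ?thesis by blast
qed

section \<open>Calculus of classes of essentially bounded functions\<close>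

lemma null_functions_add: "f \<in> null_functions M \<Longrightarrow> g \<in> null_functions M \<Longrightarrow> (\<lambda>x. f x + g x) \<in> null_functions M"
  by (auto simp: null_functions_def)

lemma Linf_class_mem_iff:
  "h \<in> Linf_class M f \<longleftrightarrow> (\<exists>w\<in>null_functions M. h = (\<lambda>x. f x + w x))"
  by (auto simp: Linf_class_def coset_def ess_bounded_def)

lemma Linf_class_eq_iff:
  assumes "f \<in> borel_measurable M" "g \<in> borel_measurable M"
  shows "Linf_class M f = Linf_class M g \<longleftrightarrow> (AE x in M. f x = g x)"
proof
  assume "Linf_class M f = Linf_class M g"
  moreover have "f \<in> Linf_class M f"
    by (auto simp: Linf_class_def coset_def ess_bounded_def null_functions_def intro!: exI[of _ "\<lambda>_. 0"])
  ultimately obtain w where "f = (\<lambda>x. g x + w x)" "AE x in M. w x = 0"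
    by (auto simp: Linf_class_def coset_def ess_bounded_def null_functions_def)
  thus "AE x in M. f x = g x" by auto
next
  have sub: "Linf_class M f \<subseteq> Linf_class M g"
    if fg: "f \<in> borel_measurable M" "g \<in> borel_measurable M" "AE x in M. f x = g x" for f g
  proof
    fix h assume "h \<in> Linf_class M f"
    then obtain w where w: "h = (\<lambda>x. f x + w x)" "w \<in> borel_measurable M" "AE x in M. w x = 0"
      by (auto simp: Linf_class_def coset_def ess_bounded_def null_functions_def)
    have "AE x in M. f x - g x + w x = 0" using fg(3) w(3) by eventually_elim simp
    hence "(\<lambda>x. f x - g x + w x) \<in> null_functions M" using fg w by (auto simp: null_functions_def)
    moreover have "h = (\<lambda>x. g x + (f x - g x + w x))" using w by auto
    ultimately show "h \<in> Linf_class M g"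
      unfolding Linf_class_mem_iff by (intro bexI)
  qed
  assume "AE x in M. f x = g x"
  moreover from this have "AE x in M. g x = f x" by auto
  ultimately show "Linf_class M f = Linf_class M g" using sub assms by blast
qed

lemma Linf_vadd: "vadd (Linf M) (Linf_class M f) (Linf_class M g) = Linf_class M (\<lambda>x. f x + g x)"
proof (intro set_eqI iffI)
  fix h assume "h \<in> vadd (Linf M) (Linf_class M f) (Linf_class M g)"
  then obtain v w where *: "v \<in> null_functions M" "w \<in> null_functions M" "h = (\<lambda>x. (f x + v x) + (g x + w x))"
    by (auto simp: Linf_def quotient_space_def Linf_class_mem_iff) (auto simp: ess_bounded_def)
  hence "h = (\<lambda>x. (f x + g x) + (v x + w x))" by auto
  thus "h \<in> Linf_class M (\<lambda>x. f x + g x)" using null_functions_add[OF *(1,2)] unfolding Linf_class_mem_iff by (rule bexI)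
next
  fix h assume "h \<in> Linf_class M (\<lambda>x. f x + g x)"
  then obtain w where *: "w \<in> null_functions M" "h = (\<lambda>x. (f x + g x) + w x)" unfolding Linf_class_mem_iff by blast
  have "h = vadd (ess_bounded M) (\<lambda>x. f x + w x) (\<lambda>x. g x + 0)" using *(2) by (auto simp: ess_bounded_def)
  moreover have "(\<lambda>x. f x + w x) \<in> Linf_class M f" using * unfolding Linf_class_mem_iff by blast
  moreover have "(\<lambda>x. g x + 0) \<in> Linf_class M g" unfolding Linf_class_mem_iff
    by (intro bexI[of _ "\<lambda>_. 0"]) (auto simp: null_functions_def)
  ultimately show "h \<in> vadd (Linf M) (Linf_class M f) (Linf_class M g)"
    by (auto simp: Linf_def quotient_space_def)
qed

lemma Linf_vscale: "vscale (Linf M) c (Linf_class M f) = Linf_class M (\<lambda>x. c * f x)"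
proof (intro set_eqI iffI)
  fix h assume "h \<in> vscale (Linf M) c (Linf_class M f)"
  then obtain v w where *: "v \<in> null_functions M" "w \<in> null_functions M" "h = (\<lambda>x. c * (f x + v x) + w x)"
    by (auto simp: Linf_def quotient_space_def Linf_class_mem_iff) (auto simp: ess_bounded_def)
  hence "h = (\<lambda>x. c * f x + (c * v x + w x))" by (auto simp: algebra_simps)
  moreover have "(\<lambda>x. c * v x + w x) \<in> null_functions M" using * by (auto simp: null_functions_def)
  ultimately show "h \<in> Linf_class M (\<lambda>x. c * f x)" unfolding Linf_class_mem_iff by (intro bexI)
next
  fix h assume "h \<in> Linf_class M (\<lambda>x. c * f x)"
  then obtain w where *: "w \<in> null_functions M" "h = (\<lambda>x. c * f x + w x)" unfolding Linf_class_mem_iff by blast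
  have "h = vadd (ess_bounded M) (vscale (ess_bounded M) c (\<lambda>x. f x + 0)) w" using *(2) by (auto simp: ess_bounded_def)
  moreover have "(\<lambda>x. f x + 0) \<in> Linf_class M f" unfolding Linf_class_mem_iff
    by (intro bexI[of _ "\<lambda>_. 0"]) (auto simp: null_functions_def)
  ultimately show "h \<in> vscale (Linf M) c (Linf_class M f)" using *(1)
    by (auto simp: Linf_def quotient_space_def)
qed

lemma Linf_vzero: "vzero (Linf M) = Linf_class M (\<lambda>_. 0)"
  by (auto simp: Linf_def quotient_space_def Linf_class_mem_iff)

text \<open>The essential supremum ignores null functions, so the infimum defining the quotient
  seminorm runs over a single value.\<close>

lemma Linf_vnorm:
  assumes "f \<in> borel_measurable M"
  shows "vnorm (Linf M) (Linf_class M f) = real_of_ereal (esssup M (\<lambda>x. ereal \<bar>f x\<bar>))"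
proof -
  have "vnorm (ess_bounded M) h = real_of_ereal (esssup M (\<lambda>x. ereal \<bar>f x\<bar>))" if "h \<in> Linf_class M f" for h
  proof -
    obtain w where w: "w \<in> borel_measurable M" "AE x in M. w x = 0" "h = (\<lambda>x. f x + w x)" 
    proof -
      obtain w where "w \<in> null_functions M" "h = (\<lambda>x. f x + w x)" using \<open>h \<in> Linf_class M f\<close> unfolding Linf_class_mem_iff by (rule bexE)
      thus thesis using that[of w] by (simp add: null_functions_def)
    qed
    have "AE x in M. ereal \<bar>h x\<bar> = ereal \<bar>f x\<bar>" using w(2) unfolding w(3) by eventually_elim simp
    hence "esssup M (\<lambda>x. ereal \<bar>h x\<bar>) = esssup M (\<lambda>x. ereal \<bar>f x\<bar>)"
      by (intro esssup_AE_cong) (use w assms in auto)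
    thus ?thesis by (simp add: ess_bounded_def)
  qed
  moreover have "f \<in> Linf_class M f" 
    unfolding Linf_class_mem_iff by (intro bexI[of _ "\<lambda>_. 0"]) (auto simp: null_functions_def)
  ultimately have "vnorm (ess_bounded M) ` Linf_class M f = {real_of_ereal (esssup M (\<lambda>x. ereal \<bar>f x\<bar>))}"
    by force
  thus ?thesis by (simp add: Linf_def quotient_space_def)
qed

text \<open>If \<open>M\<close> is null then \<open>esssup\<close> is \<open>-\<infinity>\<close>, which \<open>real_of_ereal\<close> sends to \<open>0\<close>.\<close>

lemma Linf_vnorm_le_iff:
  assumes f: "f \<in> borel_measurable M" and C: "AE x in M. \<bar>f x\<bar> \<le> C" and B: "0 \<le> B"
  shows "vnorm (Linf M) (Linf_class M f) \<le> B \<longleftrightarrow> (AE x in M. \<bar>f x\<bar> \<le> B)"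
proof -
  let ?s = "esssup M (\<lambda>x. ereal \<bar>f x\<bar>)"
  have meas: "(\<lambda>x. ereal \<bar>f x\<bar>) \<in> borel_measurable M" using f by simp
  have le: "AE x in M. ereal \<bar>f x\<bar> \<le> ?s" by (rule esssup_AE)
  have "?s \<le> ereal C" using C by (intro esssup_I meas) simp
  hence "?s \<noteq> \<infinity>" by auto
  have iff: "?s \<le> ereal B \<longleftrightarrow> (AE x in M. \<bar>f x\<bar> \<le> B)"
  proof
    assume "?s \<le> ereal B"
    thus "AE x in M. \<bar>f x\<bar> \<le> B" using le
      by (auto elim!: eventually_mono) (metis ereal_less_eq(3) order_trans)
  qed (auto intro!: esssup_I meas)
  have "real_of_ereal ?s \<le> B \<longleftrightarrow> ?s \<le> ereal B"
    using \<open>?s \<noteq> \<infinity>\<close> B by (cases ?s) auto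
  thus ?thesis by (simp add: Linf_vnorm[OF f] iff)
qed

lemma Linf_vnorm_nonneg:
  assumes f: "f \<in> borel_measurable M"
  shows "0 \<le> vnorm (Linf M) (Linf_class M f)"
proof (cases "emeasure M (space M) = 0")
  case True
  have "esssup M (\<lambda>x. ereal \<bar>f x\<bar>) = - \<infinity>" by (rule esssup_zero_space) (use True f in auto)
  thus ?thesis by (simp add: Linf_vnorm[OF f])
next
  case False
  have "esssup M (\<lambda>x. 0 :: ereal) \<le> esssup M (\<lambda>x. ereal \<bar>f x\<bar>)" by (intro esssup_mono) auto
  hence "0 \<le> esssup M (\<lambda>x. ereal \<bar>f x\<bar>)" using esssup_const[OF False, of "0::ereal"] by simp
  thus ?thesis by (simp add: Linf_vnorm[OF f] real_of_ereal_pos)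
qed

text \<open>If changing \<open>f\<close> by a null function alters \<open>D f\<close> only on a null
  set, the union in \<open>Linf_lift\<close> is a union of copies of one class.\<close>

lemma Linf_lift_class:
  assumes f: "f \<in> borel_measurable M" "Df \<in> borel_measurable N"
    and D: "\<And>w. w \<in> null_functions M \<Longrightarrow> D (\<lambda>x. f x + w x) \<in> borel_measurable N \<and> (AE x in N. D (\<lambda>x. f x + w x) x = Df x)"
  shows "Linf_lift N D (Linf_class M f) = Linf_class N Df"
proof -
  have "Linf_class N (D h) = Linf_class N Df" if "h \<in> Linf_class M f" for h
  proof -
    obtain w where "w \<in> null_functions M" "h = (\<lambda>x. f x + w x)" using \<open>h \<in> Linf_class M f\<close> unfolding Linf_class_mem_iff by (rule bexE)
    thus ?thesis using D[of w] f by (simp add: Linf_class_eq_iff)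
  qed
  moreover have "f \<in> Linf_class M f" 
    unfolding Linf_class_mem_iff by (intro bexI[of _ "\<lambda>_. 0"]) (auto simp: null_functions_def)
  ultimately show ?thesis unfolding Linf_lift_def by blast
qed

section \<open>The measurable projection theorem\<close>

lemma Hausdorff_space_euclidean_t2: "Hausdorff_space (euclidean :: 'a::t2_space topology)"
  unfolding Hausdorff_space_def disjnt_def by (simp, metis hausdorff)

text \<open>Local compactness and the Hausdorff property give regularity, so each point of
  \<open>U\<close> lies in a basic open set whose closure stays inside \<open>U\<close>, and there
  are countably many of these. No metric on the group is involved. The result makes complements of
  closed sets accessible to a paving by closed rectangles.\<close>

lemma open_fsigma:
  fixes U :: "'g::{t2_space, second_countable_topology} set"
  assumes lc: "locally_compact_space (euclidean :: 'g topology)" and U: "open U"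
  shows "\<exists>F :: nat \<Rightarrow> 'g set. (\<forall>n. closed (F n)) \<and> U = (\<Union>n. F n)"
proof -
  obtain \<B> :: "'g set set" where \<B>: "countable \<B>" "topological_basis \<B>"
    using ex_countable_basis by blast
  have reg: "regular_space (euclidean :: 'g topology)"
    by (rule locally_compact_Hausdorff_imp_regular_space[OF lc Hausdorff_space_euclidean_t2])
  \<comment> \<open>Inserting the empty set keeps the family nonempty even for
    \<open>U = {}\<close>, so that it is the range of a sequence.\<close>
  define \<C> where "\<C> = insert {} {closure b | b. b \<in> \<B> \<and> closure b \<subseteq> U}"
  have "countable \<C>" using \<B>(1) unfolding \<C>_def by (auto intro: countable_subset[of _ "closure ` \<B>"])
  have "U = \<Union>\<C>"
  proof
    show "U \<subseteq> \<Union>\<C>"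
    proof
      fix x assume x: "x \<in> U"
      obtain V C where V: "open V" "closed C" "x \<in> V" "V \<subseteq> C" "C \<subseteq> U"
        using reg x U unfolding neighbourhood_base_of_closedin[symmetric] neighbourhood_base_of
        by simp meson
      then obtain b where b: "b \<in> \<B>" "x \<in> b" "b \<subseteq> V" using \<B>(2) by (metis topological_basisE)
      hence "closure b \<subseteq> C" using V by (meson closure_minimal order_trans)
      hence "closure b \<in> \<C>" using b V unfolding \<C>_def by blast
      thus "x \<in> \<Union>\<C>" using b(2) closure_subset[of b] by blast
    qed
  qed (auto simp: \<C>_def)
  moreover have "\<C> \<noteq> {}" by (auto simp: \<C>_def)
  ultimately obtain F :: "nat \<Rightarrow> 'g set" where F: "range F = \<C>"
    using \<open>countable \<C>\<close> range_from_nat_into by metis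
  have "closed (F n)" for n
  proof -
    have "F n \<in> \<C>" using F by blast
    thus ?thesis by (auto simp: \<C>_def)
  qed
  thus ?thesis using F \<open>U = \<Union>\<C>\<close> by blast
qed


text \<open>Basic open sets contained in some compact set already cover a locally compact space;
  with a countable basis, finite unions of the enclosing compact sets exhaust it.\<close>

lemma compact_exhaustion:
  assumes lc: "locally_compact_space (euclidean :: 'g::second_countable_topology topology)"
  obtains L :: "nat \<Rightarrow> 'g::second_countable_topology set" where "\<And>n. compact (L n)" "incseq L" "(\<Union>n. L n) = UNIV"
proof -
  obtain \<B> :: "'g set set" where \<B>: "countable \<B>" "topological_basis \<B>"
    using ex_countable_basis by blast
  define \<C> where "\<C> = {b \<in> \<B>. \<exists>K. compact K \<and> b \<subseteq> K}"
  obtain K where K: "\<And>b. b \<in> \<C> \<Longrightarrow> compact (K b)" "\<And>b. b \<in> \<C> \<Longrightarrow> b \<subseteq> K b"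
  proof -
    have "\<forall>b\<in>\<C>. \<exists>K. compact K \<and> b \<subseteq> K" by (auto simp: \<C>_def)
    from bchoice[OF this] that show ?thesis by blast
  qed
  have cover: "\<exists>b\<in>\<C>. x \<in> b" for x
  proof -
    obtain U K where U: "open U" "compact K" "x \<in> U" "U \<subseteq> K"
      using lc unfolding locally_compact_space_def by simp meson
    then obtain b where "b \<in> \<B>" "x \<in> b" "b \<subseteq> U" using \<B>(2) by (metis topological_basisE)
    thus ?thesis using U unfolding \<C>_def by blast
  qed
  have "countable \<C>" using \<B>(1) by (auto simp: \<C>_def)
  moreover have "\<C> \<noteq> {}" using cover by blast
  ultimately
  have C: "range (from_nat_into \<C>) = \<C>" by (simp add: range_from_nat_into)
  define L where "L n = (\<Union>i\<le>n. K (from_nat_into \<C> i))" for n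
  show ?thesis
  proof
    show "compact (L n)" for n
      unfolding L_def using K(1) C by (intro compact_UN) auto
    show "incseq L" by (fastforce simp: L_def incseq_def)
    show "(\<Union>n. L n) = UNIV"
    proof (intro set_eqI iffI UNIV_I)
      fix x
      obtain b where b: "b \<in> \<C>" "x \<in> b" using cover by blast
      then obtain n where "b = from_nat_into \<C> n" using C by (metis imageE)
      hence "x \<in> L n" using K(2)[OF b(1)] b by (auto simp: L_def)
      thus "x \<in> (\<Union>n. L n)" by blast
    qed
  qed
qed

section \<open>Suslin sets over closed rectangles\<close>

text \<open>Finite unions of rectangles with a closed and a measurable side. This class suits the
  capacity argument: it is stable under finite unions and intersections, the part of a member over
  any \<open>L\<close> has a measurable projection, and its sections are closed, so compactness can
  be used along the group.\<close>

inductive_set paving :: "'x measure \<Rightarrow> ('g::topological_space \<times> 'x) set set" for M :: "'x measure" where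
  empty: "{} \<in> paving M"
| rect: "closed K \<Longrightarrow> A \<in> sets M \<Longrightarrow> C \<in> paving M \<Longrightarrow> K \<times> A \<union> C \<in> paving M"

lemma paving_rect: "closed K \<Longrightarrow> A \<in> sets M \<Longrightarrow> K \<times> A \<in> paving M"
  using paving.rect[OF _ _ paving.empty] by fastforce

lemma paving_Un: "C \<in> paving M \<Longrightarrow> D \<in> paving M \<Longrightarrow> C \<union> D \<in> paving M"
  by (induction C rule: paving.induct) (auto simp: Un_assoc intro: paving.rect)

lemma paving_Union: "finite I \<Longrightarrow> (\<And>i. i \<in> I \<Longrightarrow> C i \<in> paving M) \<Longrightarrow> (\<Union>i\<in>I. C i) \<in> paving M"
  by (induction I rule: finite_induct) (auto intro: paving.empty paving_Un)

lemma paving_Int_rect: "D \<in> paving M \<Longrightarrow> closed K \<Longrightarrow> A \<in> sets M \<Longrightarrow> (K \<times> A) \<inter> D \<in> paving M"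
proof (induction D rule: paving.induct)
  case (rect L B D)
  have "(K \<times> A) \<inter> (L \<times> B \<union> D) = (K \<inter> L) \<times> (A \<inter> B) \<union> (K \<times> A) \<inter> D" by auto
  thus ?case using rect by (auto intro!: paving.rect)
qed (simp add: paving.empty)

lemma paving_Int: "C \<in> paving M \<Longrightarrow> D \<in> paving M \<Longrightarrow> C \<inter> D \<in> paving M"
  by (induction C rule: paving.induct)
     (auto simp: Int_Un_distrib2 intro: paving.empty paving_Un paving_Int_rect)

text \<open>The factor \<open>UNIV \<times> space M\<close> takes care of the empty index set, whose
  plain intersection is the whole type.\<close>

lemma paving_Inter: "finite I \<Longrightarrow> (\<And>i. i \<in> I \<Longrightarrow> C i \<in> paving M) \<Longrightarrow> (UNIV \<times> space M) \<inter> (\<Inter>i\<in>I. C i) \<in> paving M"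
proof (induction I rule: finite_induct)
  case empty thus ?case using paving_rect[of UNIV "space M" M] by simp
next
  case (insert i I)
  have "UNIV \<times> space M \<inter> (\<Inter>i\<in>insert i I. C i) = C i \<inter> (UNIV \<times> space M \<inter> (\<Inter>i\<in>I. C i))" by auto
  thus ?case using insert by (auto intro: paving_Int)
qed

lemma paving_section_closed: "C \<in> paving M \<Longrightarrow> closed {g. (g, x) \<in> C}"
proof (induction C rule: paving.induct)
  case (rect K A C)
  have "{g. (g, x) \<in> K \<times> A \<union> C} = (if x \<in> A then K else {}) \<union> {g. (g, x) \<in> C}" by auto
  moreover have "closed (if x \<in> A then K else {})" using rect by simp
  ultimately show ?case using closed_Un rect(4) by metis
qed simp

lemma paving_proj: 
  assumes "C \<in> paving M" shows "snd ` (C \<inter> (L \<times> space M)) \<in> sets M"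
  using assms
proof (induction C rule: paving.induct)
  case (rect K A C)
  have "snd ` ((K \<times> A \<union> C) \<inter> (L \<times> space M)) = (if K \<inter> L = {} then {} else A) \<union> snd ` (C \<inter> (L \<times> space M))"
    using sets.sets_into_space[OF rect(2)] by force
  thus ?case using rect by simp
qed simp

text \<open>A scheme indexed by finite sequences, encoded by infinite ones of which only the first
  \<open>n\<close> terms are read. Monotonicity in \<open>n\<close> is built in, as it is what
  allows finite levels to approximate a branch from outside.\<close>

definition suslin_scheme :: "'x measure \<Rightarrow> (nat \<Rightarrow> (nat \<Rightarrow> nat) \<Rightarrow> ('g::topological_space \<times> 'x) set) \<Rightarrow> bool" where
  "suslin_scheme M P \<longleftrightarrow>
    (\<forall>n \<sigma>. P n \<sigma> \<in> paving M) \<and>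
    (\<forall>n \<sigma> \<tau>. (\<forall>i<n. \<sigma> i = \<tau> i) \<longrightarrow> P n \<sigma> = P n \<tau>) \<and>
    (\<forall>n \<sigma>. P (Suc n) \<sigma> \<subseteq> P n \<sigma>)"

lemma suslin_schemeD:
  assumes "suslin_scheme M P"
  shows "P n \<sigma> \<in> paving M" "(\<And>i. i < n \<Longrightarrow> \<sigma> i = \<tau> i) \<Longrightarrow> P n \<sigma> = P n \<tau>" "P (Suc n) \<sigma> \<subseteq> P n \<sigma>"
  using assms by (auto simp: suslin_scheme_def)

definition suslin :: "'x measure \<Rightarrow> ('g::topological_space \<times> 'x) set \<Rightarrow> bool" where
  "suslin M E \<longleftrightarrow> (\<exists>P. suslin_scheme M P \<and> E = {z. \<exists>\<sigma>. \<forall>n. z \<in> P n \<sigma>})"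

lemma suslin_paving: "C \<in> paving M \<Longrightarrow> suslin M C"
  unfolding suslin_def suslin_scheme_def by (intro exI[of _ "\<lambda>_ _. C"]) auto

text \<open>The term \<open>\<sigma> 0\<close> selects a member of the union and the shifted
  remainder runs its scheme; level 0, where nothing has been selected yet, is the whole
  space.\<close>

lemma suslin_UN:
  fixes E :: "nat \<Rightarrow> ('g::topological_space \<times> 'x) set"
  assumes "\<And>i. suslin M (E i)" shows "suslin M (\<Union>i. E i)"
proof -
  obtain P where P: "\<And>i. suslin_scheme M (P i)" "\<And>i. E i = {z. \<exists>\<sigma>. \<forall>n. z \<in> P i n \<sigma>}"
  proof -
    have "\<forall>i. \<exists>P. suslin_scheme M P \<and> E i = {z. \<exists>\<sigma>. \<forall>n. z \<in> P n \<sigma>}"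
      using assms unfolding suslin_def by blast
    from choice[OF this] that show ?thesis by blast
  qed
  define R where "R n \<sigma> = (case n of 0 \<Rightarrow> UNIV \<times> space M | Suc n \<Rightarrow> P (\<sigma> 0) n (\<lambda>i. \<sigma> (Suc i)))" for n and \<sigma> :: "nat \<Rightarrow> nat"
  have sub: "C \<subseteq> UNIV \<times> space M" if "C \<in> paving M" for C :: "('g \<times> 'x) set"
    using that by (induction rule: paving.induct) (auto dest: sets.sets_into_space)
  have "suslin_scheme M R"
    unfolding suslin_scheme_def
  proof (intro conjI allI impI)
    fix n \<sigma> show "R n \<sigma> \<in> paving M"
      using P(1) by (auto simp: R_def suslin_scheme_def intro: paving_rect split: nat.split)
  next
    fix n :: nat and \<sigma> \<tau> :: "nat \<Rightarrow> nat" assume eq: "\<forall>i<n. \<sigma> i = \<tau> i"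
    show "R n \<sigma> = R n \<tau>"
    proof (cases n)
      case (Suc n')
      have "P i n' (\<lambda>i. \<sigma> (Suc i)) = P i n' (\<lambda>i. \<tau> (Suc i))" for i
        using eq Suc by (intro suslin_schemeD(2)[OF P(1)]) simp
      thus ?thesis using eq Suc by (simp add: R_def)
    qed (simp add: R_def)
  next
    fix n \<sigma> show "R (Suc n) \<sigma> \<subseteq> R n \<sigma>"
    proof (cases n)
      case 0
      thus ?thesis using sub[OF suslin_schemeD(1)[OF P(1)]] by (simp add: R_def)
    next
      case (Suc n')
      thus ?thesis using suslin_schemeD(3)[OF P(1)] by (simp add: R_def)
    qed
  qed
  moreover have "(\<Union>i. E i) = {z. \<exists>\<sigma>. \<forall>n. z \<in> R n \<sigma>}"
  proof (intro set_eqI iffI)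
    fix z assume "z \<in> (\<Union>i. E i)"
    then obtain i \<sigma> where z: "\<forall>n. z \<in> P i n \<sigma>" using P(2) by auto
    hence "z \<in> UNIV \<times> space M" using sub[OF suslin_schemeD(1)[OF P(1)]] by blast
    hence "\<forall>n. z \<in> R n (case_nat i \<sigma>)" using z by (auto simp: R_def split: nat.split)
    thus "z \<in> {z. \<exists>\<sigma>. \<forall>n. z \<in> R n \<sigma>}" by auto
  next
    fix z assume "z \<in> {z. \<exists>\<sigma>. \<forall>n. z \<in> R n \<sigma>}"
    then obtain \<sigma> where z: "\<forall>n. z \<in> R n \<sigma>" by auto
    have "z \<in> P (\<sigma> 0) n (\<lambda>i. \<sigma> (Suc i))" for n using spec[OF z, of "Suc n"] by (simp add: R_def)
    thus "z \<in> (\<Union>i. E i)" using P(2) by auto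
  qed
  ultimately show ?thesis unfolding suslin_def by blast
qed

text \<open>Guarantees in \<open>suslin_INT\<close> that the stage with code \<open>t\<close>
  consults the common sequence only at positions below \<open>t\<close>.\<close>

lemma prod_encode_strict_mono2: "l < j \<Longrightarrow> prod_encode (i, l) < prod_encode (i, j)"
proof -
  have "triangle a < triangle b" if "a < b" for a b
    using that
  proof (induction b)
    case (Suc b) thus ?case by (cases "a = b") auto
  qed simp
  thus "l < j \<Longrightarrow> ?thesis" by (simp add: prod_encode_def)
qed

text \<open>One sequence codes countably many through its rows
  \<open>l \<mapsto> \<sigma> (prod_encode (i, l))\<close>. Stage \<open>prod_encode (i, j)\<close>
  is level \<open>j\<close> of the \<open>i\<close>-th scheme run on row \<open>i\<close>, and
  \<open>R n\<close> intersects the first \<open>n\<close> stages.\<close>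

lemma suslin_INT:
  fixes E :: "nat \<Rightarrow> ('g::topological_space \<times> 'x) set"
  assumes "\<And>i. suslin M (E i)" shows "suslin M (\<Inter>i. E i)"
proof -
  obtain P where P: "\<And>i. suslin_scheme M (P i)" "\<And>i. E i = {z. \<exists>\<sigma>. \<forall>n. z \<in> P i n \<sigma>}"
  proof -
    have "\<forall>i. \<exists>P. suslin_scheme M P \<and> E i = {z. \<exists>\<sigma>. \<forall>n. z \<in> P n \<sigma>}"
      using assms unfolding suslin_def by blast
    from choice[OF this] that show ?thesis by blast
  qed
  define Q where "Q t \<sigma> = (case prod_decode t of (i, j) \<Rightarrow> P i j (\<lambda>l. \<sigma> (prod_encode (i, l))))" for t and \<sigma> :: "nat \<Rightarrow> nat"
  define R where "R n \<sigma> = (UNIV \<times> space M) \<inter> (\<Inter>t\<in>{..<n}. Q t \<sigma>)" for n \<sigma>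
  have sub: "C \<subseteq> UNIV \<times> space M" if "C \<in> paving M" for C :: "('g \<times> 'x) set"
    using that by (induction rule: paving.induct) (auto dest: sets.sets_into_space)
  have "suslin_scheme M R"
    unfolding suslin_scheme_def
  proof (intro conjI allI impI)
    fix n \<sigma> show "R n \<sigma> \<in> paving M"
      unfolding R_def using P(1)
      by (intro paving_Inter) (auto simp: Q_def suslin_scheme_def split: prod.split)
  next
    fix n :: nat and \<sigma> \<tau> :: "nat \<Rightarrow> nat" assume eq: "\<forall>i<n. \<sigma> i = \<tau> i"
    have "Q t \<sigma> = Q t \<tau>" if "t < n" for t
    proof -
      obtain i j where ij: "prod_decode t = (i, j)" by (cases "prod_decode t")
      hence t: "t = prod_encode (i, j)" by (metis prod_decode_inverse)
      have "\<forall>l<j. \<sigma> (prod_encode (i, l)) = \<tau> (prod_encode (i, l))"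
        using prod_encode_strict_mono2 eq that t by (meson order.strict_trans)
      hence "P i j (\<lambda>l. \<sigma> (prod_encode (i, l))) = P i j (\<lambda>l. \<tau> (prod_encode (i, l)))"
        by (intro suslin_schemeD(2)[OF P(1)]) simp
      thus ?thesis by (simp add: Q_def ij)
    qed
    thus "R n \<sigma> = R n \<tau>" by (simp add: R_def)
  next
    fix n \<sigma> show "R (Suc n) \<sigma> \<subseteq> R n \<sigma>" by (auto simp: R_def)
  qed
  moreover have "(\<Inter>i. E i) = {z. \<exists>\<sigma>. \<forall>n. z \<in> R n \<sigma>}"
  proof (intro set_eqI iffI)
    fix z assume "z \<in> (\<Inter>i. E i)"
    hence "\<forall>i. \<exists>\<sigma>. \<forall>n. z \<in> P i n \<sigma>" using P(2) by auto
    then obtain s where s: "\<And>i n. z \<in> P i n (s i)" by metis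
    define \<sigma> where "\<sigma> t = (case prod_decode t of (i, l) \<Rightarrow> s i l)" for t
    have "z \<in> UNIV \<times> space M" using sub[OF suslin_schemeD(1)[OF P(1)]] s by blast
    moreover have "(\<lambda>l. \<sigma> (prod_encode (i, l))) = s i" for i by (simp add: \<sigma>_def)
    ultimately have "\<forall>n. z \<in> R n \<sigma>" using s by (auto simp: R_def Q_def split: prod.split)
    thus "z \<in> {z. \<exists>\<sigma>. \<forall>n. z \<in> R n \<sigma>}" by auto
  next
    fix z assume "z \<in> {z. \<exists>\<sigma>. \<forall>n. z \<in> R n \<sigma>}"
    then obtain \<sigma> where z: "\<forall>n. z \<in> R n \<sigma>" by auto
    have "z \<in> P i j (\<lambda>l. \<sigma> (prod_encode (i, l)))" for i j
    proof -
      have "z \<in> Q (prod_encode (i, j)) \<sigma>"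
        using spec[OF z, of "Suc (prod_encode (i, j))"] unfolding R_def by blast
      thus ?thesis by (simp add: Q_def)
    qed
    thus "z \<in> (\<Inter>i. E i)" using P(2) by auto
  qed
  ultimately show ?thesis unfolding suslin_def by blast
qed

lemma suslin_Un: "suslin M A \<Longrightarrow> suslin M B \<Longrightarrow> suslin M (A \<union> B)"
proof -
  assume "suslin M A" "suslin M B"
  hence "suslin M (\<Union>i::nat. if i = 0 then A else B)" by (intro suslin_UN) auto
  also have "(\<Union>i::nat. if i = 0 then A else B) = A \<union> B" by (auto split: if_splits)
  finally show ?thesis .
qed

text \<open>The sets which are Suslin together with their complement form a \<open>\<sigma>\<close>-algebra.\<close>

lemma suslin_if_sets:
  fixes E :: "('g::topological_space \<times> 'x) set"
  assumes E: "E \<in> sets (borel \<Otimes>\<^sub>M M)"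
    and fsigma: "\<And>U :: 'g set. open U \<Longrightarrow> \<exists>F :: nat \<Rightarrow> 'g set. (\<forall>n. closed (F n)) \<and> U = (\<Union>n. F n)"
  shows "suslin M E"
proof -
  let ?Z = "UNIV \<times> space M :: ('g \<times> 'x) set"
  have open_rect: "suslin M (U \<times> A)" if U: "open U" and A: "A \<in> sets M" for U :: "'g set" and A
  proof -
    obtain F :: "nat \<Rightarrow> 'g set" where F: "\<And>n. closed (F n)" "U = (\<Union>n. F n)" using fsigma[OF U] by auto
    hence "U \<times> A = (\<Union>n. F n \<times> A)" by auto
    moreover have "suslin M (\<Union>n. F n \<times> A)"
      using F(1) A by (intro suslin_UN suslin_paving paving_rect)
    ultimately show ?thesis by simp
  qed
  have borel_rect: "suslin M (B \<times> A) \<and> suslin M ((- B) \<times> A)"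
    if B: "B \<in> sets borel" and A: "A \<in> sets M" for B :: "'g set" and A
  proof -
    have "B \<in> sigma_sets UNIV {K :: 'g set. closed K}"
      using B by (simp add: borel_eq_closed)
    thus ?thesis
    proof (induction rule: sigma_sets.induct)
      case (Basic K)
      hence "closed K" by simp
      thus ?case using A open_rect[of "- K" A] suslin_paving[OF paving_rect] by blast
    next
      case Empty
      show ?case using A suslin_paving[OF paving.empty] open_rect[of UNIV A] by simp
    next
      case (Compl K)
      have "UNIV - K = - K" by auto
      thus ?case using Compl by simp
    next
      case (Union K)
      have "(\<Union>i. K i) \<times> A = (\<Union>i. K i \<times> A)" "(- (\<Union>i. K i)) \<times> A = (\<Inter>i. (- K i) \<times> A)" by auto
      thus ?case using suslin_UN[of M "\<lambda>i. K i \<times> A"] suslin_INT[of M "\<lambda>i. (- K i) \<times> A"] Union by simp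
    qed
  qed
  have gen: "sets (borel \<Otimes>\<^sub>M M) = sigma_sets ?Z {B \<times> A | B A. B \<in> sets (borel :: 'g measure) \<and> A \<in> sets M}"
    by (simp add: sets_pair_measure)
  have "suslin M E \<and> suslin M (?Z - E)"
    using E unfolding gen
  proof (induction rule: sigma_sets.induct)
    case (Basic a)
    then obtain B A where a: "a = B \<times> A" "B \<in> sets borel" "A \<in> sets M" by auto
    have "?Z - a = (- B) \<times> space M \<union> UNIV \<times> (space M - A)"
      using a by auto
    moreover have "suslin M ((- B) \<times> space M \<union> UNIV \<times> (space M - A))"
      using borel_rect[OF a(2), of "space M"] open_rect[of UNIV "space M - A"] a(3) by (intro suslin_Un) auto
    ultimately show ?case using borel_rect[OF a(2,3)] a(1) by simp
  next
    case Empty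
    show ?case using paving_rect[of UNIV "space M" M] suslin_paving paving.empty by fastforce
  next
    case (Compl a)
    have "a \<subseteq> ?Z" using Compl(1) by (rule sigma_sets_into_sp[rotated]) (auto dest: sets.sets_into_space)
    hence "?Z - (?Z - a) = a" by auto
    thus ?case using Compl by auto
  next
    case (Union a)
    have "?Z - (\<Union>i. a i) = (\<Inter>i. ?Z - a i)" by auto
    thus ?case using suslin_UN[of M a] suslin_INT[of M "\<lambda>i. ?Z - a i"] Union by simp
  qed
  thus ?thesis ..
qed

section \<open>Capacitability of projections\<close>

text \<open>Koenig's lemma for the finitely branching tree of sequences bounded by \<open>k\<close>.
  A prefix is \<open>good\<close> if it extends to admissible bounded sequences at every later
  level; a good prefix has a good one-term extension, and iterating yields an infinite
  branch.\<close>

lemma koenig: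
  fixes k :: "nat \<Rightarrow> nat"
  assumes "\<And>n. \<exists>\<sigma>. (\<forall>i<n. \<sigma> i \<le> k i) \<and> Q n \<sigma>"
    and dep: "\<And>n \<sigma> \<tau>. (\<forall>i<n. \<sigma> i = \<tau> i) \<Longrightarrow> Q n \<sigma> = Q n \<tau>"
    and dec: "\<And>n \<sigma>. Q (Suc n) \<sigma> \<Longrightarrow> Q n \<sigma>"
  shows "\<exists>\<sigma>. \<forall>n. Q n \<sigma>"
proof -
  define good where "good n s \<longleftrightarrow> (\<forall>N\<ge>n. \<exists>\<sigma>. (\<forall>i<n. \<sigma> i = s i) \<and> (\<forall>i<N. \<sigma> i \<le> k i) \<and> Q N \<sigma>)" for n s
  have decle: "Q n \<sigma>" if "Q N \<sigma>" "n \<le> N" for n N \<sigma>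
    using that(2,1) by (induction rule: dec_induct) (auto intro: dec)
  have step: "\<exists>b. good (Suc n) (s(n := b))" if g: "good n s" for n s
  proof (rule ccontr)
    assume "\<nexists>b. good (Suc n) (s(n := b))"
    hence "\<forall>b. \<exists>N\<ge>Suc n. \<forall>\<sigma>. (\<forall>i<Suc n. \<sigma> i = (s(n := b)) i) \<and> (\<forall>i<N. \<sigma> i \<le> k i) \<longrightarrow> \<not> Q N \<sigma>"
      unfolding good_def by metis
    then obtain N where N: "\<And>b. N b \<ge> Suc n" 
      "\<And>b \<sigma>. (\<forall>i<Suc n. \<sigma> i = (s(n := b)) i) \<Longrightarrow> (\<forall>i<N b. \<sigma> i \<le> k i) \<Longrightarrow> \<not> Q (N b) \<sigma>" by metis
    \<comment> \<open>If every continuation \<open>b\<close> fails at some level \<open>N b\<close>,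
      the finitely many relevant ones with \<open>b \<le> k n\<close> all fail at the largest of
      these levels, whereas \<open>s\<close> does extend to that level.\<close>
    define N' where "N' = Max (N ` {..k n})"
    have N': "N b \<le> N'" if "b \<le> k n" for b using that by (auto simp: N'_def)
    have "n < N'" using N(1)[of 0] N'[of 0] by simp
    then obtain \<sigma> where \<sigma>: "\<forall>i<n. \<sigma> i = s i" "\<forall>i<N'. \<sigma> i \<le> k i" "Q N' \<sigma>"
      using g unfolding good_def by (meson less_imp_le)
    have b: "\<sigma> n \<le> k n" using \<sigma>(2) \<open>n < N'\<close> by auto
    have "\<forall>i<Suc n. \<sigma> i = (s(n := \<sigma> n)) i" using \<sigma>(1) by auto
    moreover have "\<forall>i<N (\<sigma> n). \<sigma> i \<le> k i" using \<sigma>(2) N'[OF b] by auto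
    ultimately have "\<not> Q (N (\<sigma> n)) \<sigma>" by (rule N(2))
    thus False using decle[OF \<sigma>(3) N'[OF b]] by simp
  qed
  then obtain b where b: "\<And>n s. good n s \<Longrightarrow> good (Suc n) (s(n := b n s))" by metis
  define S where "S = rec_nat (\<lambda>_. 0) (\<lambda>n s. s(n := b n s))"
  have S: "good n (S n)" for n
    by (induction n) (use assms(1) b in \<open>auto simp: S_def good_def\<close>)
  \<comment> \<open>Entries of a prefix never change once set, so the diagonal of the stages is the
    required branch.\<close>
  have stable: "S N i = S (Suc i) i" if "Suc i \<le> N" for N i
    using that by (induction rule: dec_induct) (auto simp: S_def)
  have "Q n (\<lambda>i. S (Suc i) i)" for n
  proof -
    obtain \<sigma> where "\<forall>i<n. \<sigma> i = S n i" "Q n \<sigma>" using S[of n, unfolded good_def, rule_format, of n] by auto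
    moreover have "\<forall>i<n. S n i = S (Suc i) i" using stable Suc_leI by blast
    ultimately show ?thesis using dep[of n \<sigma> "\<lambda>i. S (Suc i) i"] by metis
  qed
  thus ?thesis by blast
qed

text \<open>Choquet's argument. Bounds on the successive terms of the branches are chosen so that
  the projection keeps outer measure above \<open>c\<close>. The levels of the bounded tree are
  members of the paving, they decrease, and their intersection lies in \<open>E\<close> by Koenig's
  lemma. Compactness of \<open>L\<close> lets projection and decreasing intersection commute, so
  \<open>pr E\<close> contains a measurable set of measure at least \<open>c\<close>. Inner and
  outer approximation then meet.\<close>

lemma measurable_projection_compact:
  fixes E :: "('g::t2_space \<times> 'x) set"
  assumes "finite_measure M" and E: "suslin M E" and L: "compact L"
  shows "snd ` (E \<inter> (L \<times> space M)) \<in> sets (completion M)"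
proof -
  interpret finite_measure M by fact
  obtain P where P: "suslin_scheme M P" "E = {z. \<exists>\<sigma>. \<forall>n. z \<in> P n \<sigma>}"
    using E unfolding suslin_def by blast
  define pr where "pr C = snd ` (C \<inter> (L \<times> space M))" for C :: "('g \<times> 'x) set"
  let ?o = "outer_measure_of M"
  have pr_space: "pr C \<subseteq> space M" for C by (auto simp: pr_def)
  have pr_mono: "C \<subseteq> D \<Longrightarrow> pr C \<subseteq> pr D" for C D by (auto simp: pr_def)
  define Ek where "Ek k n = {z. \<exists>\<sigma>. (\<forall>i<n. \<sigma> i \<le> k i) \<and> (\<forall>j. z \<in> P j \<sigma>)}" for k :: "nat \<Rightarrow> nat" and n
  have inner: "\<exists>T\<in>sets M. T \<subseteq> pr E \<and> c \<le> emeasure M T" if c: "c < ?o (pr E)" for c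
  proof -
    have step: "\<exists>b. c < ?o (pr (Ek (k(n := b)) (Suc n)))" if k: "c < ?o (pr (Ek k n))" for k n
    proof -
      let ?A = "\<lambda>b. pr (Ek (k(n := b)) (Suc n))"
      have "incseq ?A"
      proof (intro incseq_SucI pr_mono subsetI)
        fix b z assume "z \<in> Ek (k(n := b)) (Suc n)"
        then obtain \<sigma> where \<sigma>: "\<forall>i<Suc n. \<sigma> i \<le> (k(n := b)) i" "\<forall>j. z \<in> P j \<sigma>" unfolding Ek_def by blast
        have "\<forall>i<Suc n. \<sigma> i \<le> (k(n := Suc b)) i"
          using \<sigma>(1) by (metis fun_upd_apply le_SucI)
        thus "z \<in> Ek (k(n := Suc b)) (Suc n)" using \<sigma>(2) unfolding Ek_def by blast
      qed
      moreover have "Ek k n = (\<Union>b. Ek (k(n := b)) (Suc n))"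
      proof (intro set_eqI iffI)
        fix z assume "z \<in> Ek k n"
        then obtain \<sigma> where \<sigma>: "\<forall>i<n. \<sigma> i \<le> k i" "\<forall>j. z \<in> P j \<sigma>" unfolding Ek_def by blast
        hence "\<forall>i<Suc n. \<sigma> i \<le> (k(n := \<sigma> n)) i" by (auto simp: less_Suc_eq)
        thus "z \<in> (\<Union>b. Ek (k(n := b)) (Suc n))" using \<sigma>(2) unfolding Ek_def by blast
      next
        fix z assume "z \<in> (\<Union>b. Ek (k(n := b)) (Suc n))"
        then obtain b \<sigma> where \<sigma>: "\<forall>i<Suc n. \<sigma> i \<le> (k(n := b)) i" "\<forall>j. z \<in> P j \<sigma>" unfolding Ek_def by blast
        have "\<forall>i<n. \<sigma> i \<le> k i" using \<sigma>(1) by (metis fun_upd_apply less_Suc_eq nat_neq_iff)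
        thus "z \<in> Ek k n" using \<sigma>(2) unfolding Ek_def by blast
      qed
      hence "pr (Ek k n) = (\<Union>b. ?A b)" by (auto simp: pr_def)
      \<comment> \<open>Outer measure is continuous along increasing sequences of arbitrary sets,
        which is essential because these projections are not yet known to be measurable.\<close>
      ultimately have "?o (pr (Ek k n)) = (SUP b. ?o (?A b))"
        using SUP_outer_measure_of_incseq[of ?A M] pr_space by auto
      thus ?thesis using k by (auto simp: less_SUP_iff)
    qed
    then obtain b where b: "\<And>k n. c < ?o (pr (Ek k n)) \<Longrightarrow> c < ?o (pr (Ek (k(n := b k n)) (Suc n)))"
      by metis
    define S where "S = rec_nat (\<lambda>_. 0) (\<lambda>n s. s(n := b s n))"
    have S: "c < ?o (pr (Ek (S n) n))" for n
    proof (induction n)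
      case 0
      have "Ek (S 0) 0 = E" by (auto simp: Ek_def P(2))
      thus ?case using c by simp
    next
      case (Suc n)
      have "S (Suc n) = (S n)(n := b (S n) n)" by (simp add: S_def)
      thus ?case using b[OF Suc] by metis
    qed
    have stable: "S N i = S (Suc i) i" if "Suc i \<le> N" for N i
      using that by (induction rule: dec_induct) (auto simp: S_def)
    define k where "k i = S (Suc i) i" for i
    have Ek: "c < ?o (pr (Ek k n))" for n
    proof -
      have "\<forall>i<n. S n i = k i" using stable Suc_leI unfolding k_def by blast
      hence "Ek (S n) n = Ek k n" unfolding Ek_def by (intro Collect_cong ex_cong1 conj_cong refl) metis
      thus ?thesis using S by metis
    qed
    \<comment> \<open>Only finitely many prefixes of length \<open>n\<close> respect the bounds, so
      \<open>B n\<close> is a finite union and stays in the paving.\<close>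
    define B where "B n = (\<Union>\<sigma>\<in>(PiE {..<n} (\<lambda>i. {..k i})). P n \<sigma>)" for n
    have B_iff: "z \<in> B n \<longleftrightarrow> (\<exists>\<sigma>. (\<forall>i<n. \<sigma> i \<le> k i) \<and> z \<in> P n \<sigma>)" for z n
    proof
      assume "\<exists>\<sigma>. (\<forall>i<n. \<sigma> i \<le> k i) \<and> z \<in> P n \<sigma>"
      then obtain \<sigma> where \<sigma>: "\<forall>i<n. \<sigma> i \<le> k i" "z \<in> P n \<sigma>" by blast
      have "P n \<sigma> = P n (restrict \<sigma> {..<n})" by (rule suslin_schemeD(2)[OF P(1)]) simp
      moreover have "restrict \<sigma> {..<n} \<in> PiE {..<n} (\<lambda>i. {..k i})" using \<sigma> by auto
      ultimately show "z \<in> B n" using \<sigma> unfolding B_def by blast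
    next
      assume "z \<in> B n"
      then obtain \<sigma> where "\<sigma> \<in> PiE {..<n} (\<lambda>i. {..k i})" "z \<in> P n \<sigma>" unfolding B_def by blast
      moreover have "\<forall>i<n. \<sigma> i \<le> k i" using calculation(1) by (auto dest: PiE_mem)
      ultimately show "\<exists>\<sigma>. (\<forall>i<n. \<sigma> i \<le> k i) \<and> z \<in> P n \<sigma>" by blast
    qed
    have B_pav: "B n \<in> paving M" for n
      unfolding B_def using P(1) by (intro paving_Union finite_PiE) (auto simp: suslin_scheme_def)
    have B_dec: "B (Suc n) \<subseteq> B n" for n
    proof
      fix z assume "z \<in> B (Suc n)"
      then obtain \<sigma> where "\<forall>i<Suc n. \<sigma> i \<le> k i" "z \<in> P (Suc n) \<sigma>" unfolding B_iff by blast
      hence "\<forall>i<n. \<sigma> i \<le> k i" "z \<in> P n \<sigma>" using suslin_schemeD(3)[OF P(1)] by auto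
      thus "z \<in> B n" unfolding B_iff by blast
    qed
    have Ek_B: "Ek k n \<subseteq> B n" for n using B_iff unfolding Ek_def by blast
    have B_sets: "pr (B n) \<in> sets M" for n unfolding pr_def by (rule paving_proj[OF B_pav])
    have B_gt: "c < emeasure M (pr (B n))" for n
      using Ek[of n] outer_measure_of_mono[OF pr_mono[OF Ek_B[of n]], of M] B_sets[of n]
      by (auto elim: less_le_trans)
    have decB: "decseq B" using B_dec by (rule decseq_SucI)
    have BE: "(\<Inter>n. B n) \<subseteq> E"
    proof
      fix z assume z: "z \<in> (\<Inter>n. B n)"
      have "\<exists>\<sigma>. \<forall>n. z \<in> P n \<sigma>"
      proof (rule koenig[of k])
        show "\<exists>\<sigma>. (\<forall>i<n. \<sigma> i \<le> k i) \<and> z \<in> P n \<sigma>" for n using z B_iff by blast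
        show "(z \<in> P n \<sigma>) = (z \<in> P n \<tau>)" if "\<forall>i<n. \<sigma> i = \<tau> i" for n \<sigma> \<tau>
          using suslin_schemeD(2)[OF P(1), of n \<sigma> \<tau>] that by auto
        show "z \<in> P n \<sigma>" if "z \<in> P (Suc n) \<sigma>" for n \<sigma>
          using suslin_schemeD(3)[OF P(1)] that by blast
      qed
      thus "z \<in> E" using P(2) by auto
    qed
    have prB: "(\<Inter>n. pr (B n)) \<subseteq> pr (\<Inter>n. B n)"
    proof
      fix x assume x: "x \<in> (\<Inter>n. pr (B n))"
      hence xs: "x \<in> space M" using pr_space[of "B 0"] by auto
      define F where "F n = L \<inter> {g. (g, x) \<in> B n}" for n
      have ne: "F n \<noteq> {}" for n
      proof -
        have "x \<in> pr (B n)" using x by blast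
        thus "F n \<noteq> {}" by (force simp: F_def pr_def)
      qed
      \<comment> \<open>The sections of the \<open>B n\<close> over \<open>x\<close> are closed,
        nested and meet the compact set \<open>L\<close>, so they have a common point there.\<close>
      have "L \<inter> (\<Inter>n\<in>UNIV. {g. (g, x) \<in> B n}) \<noteq> {}"
      proof (rule compact_imp_fip_image[OF L])
        fix I :: "nat set" assume I: "finite I"
        have "n \<le> Max (insert 0 I)" if "n \<in> I" for n using I that by (intro Max_ge) auto
        hence "B (Max (insert 0 I)) \<subseteq> B n" if "n \<in> I" for n using decB that by (simp add: decseq_def)
        hence "F (Max (insert 0 I)) \<subseteq> L \<inter> (\<Inter>n\<in>I. {g. (g, x) \<in> B n})" by (auto simp: F_def)
        thus "L \<inter> (\<Inter>n\<in>I. {g. (g, x) \<in> B n}) \<noteq> {}" using ne by blast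
      qed (rule paving_section_closed[OF B_pav])
      then obtain g where "g \<in> F n" for n unfolding F_def by blast
      hence "(g, x) \<in> (\<Inter>n. B n) \<inter> (L \<times> space M)" using xs by (auto simp: F_def)
      thus "x \<in> pr (\<Inter>n. B n)" unfolding pr_def by force
    qed
    have "c \<le> (INF n. emeasure M (pr (B n)))"
      using B_gt by (intro INF_greatest) (auto intro: less_imp_le)
    also have "\<dots> = emeasure M (\<Inter>n. pr (B n))"
      using B_sets decB by (intro INF_emeasure_decseq) (auto simp: decseq_def intro!: pr_mono)
    finally have "c \<le> emeasure M (\<Inter>n. pr (B n))" .
    moreover have "(\<Inter>n. pr (B n)) \<in> sets M" using B_sets by auto
    moreover have "(\<Inter>n. pr (B n)) \<subseteq> pr E" using prB pr_mono[OF BE] by blast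
    ultimately show ?thesis by blast
  qed
  \<comment> \<open>A measurable hull of the projection. Below, countably many inner approximations
    are joined to one measurable subset of the same measure, and the projection differs from it
    inside a null set.\<close>
  obtain H where H: "H \<in> sets M" "pr E \<subseteq> H" "?o (pr E) = emeasure M H"
    using outer_measure_of_attain[OF pr_space] by blast
  have "\<exists>T\<in>sets M. T \<subseteq> pr E \<and> emeasure M H \<le> emeasure M T"
  proof (cases "emeasure M H = 0")
    case False
    define T0 where "T0 = {T \<in> sets M. T \<subseteq> pr E}"
    have T0: "{} \<in> T0" by (auto simp: T0_def)
    have eq: "(SUP T\<in>T0. emeasure M T) = emeasure M H"
    proof (rule antisym)
      show "(SUP T\<in>T0. emeasure M T) \<le> emeasure M H"
        using H by (intro SUP_least emeasure_mono) (auto simp: T0_def)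
      show "emeasure M H \<le> (SUP T\<in>T0. emeasure M T)"
      proof (rule dense_le)
        fix c assume "c < emeasure M H"
        then obtain T where "T \<in> T0" "c \<le> emeasure M T" using inner H(3) by (auto simp: T0_def)
        thus "c \<le> (SUP T\<in>T0. emeasure M T)" by (auto intro: SUP_upper2)
      qed
    qed
    obtain f :: "nat \<Rightarrow> ennreal" where f: "range f \<subseteq> emeasure M ` T0" "(SUP T\<in>T0. emeasure M T) = (SUP n. f n)"
      using ennreal_SUP_countable_SUP[of T0 "emeasure M"] T0 by blast
    then obtain T where T: "\<And>n. T n \<in> T0" "\<And>n. f n = emeasure M (T n)" 
  proof -
      have "\<forall>n. \<exists>T. T \<in> T0 \<and> f n = emeasure M T" using f(1) by blast
      from choice[OF this] that show ?thesis by blast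
    qed
    have "(\<Union>n. T n) \<in> sets M" "(\<Union>n. T n) \<subseteq> pr E" using T(1) by (auto simp: T0_def)
    moreover have "emeasure M H \<le> emeasure M (\<Union>n. T n)"
      unfolding eq[symmetric] f(2) T(2) using T(1) by (intro SUP_least emeasure_mono) (auto simp: T0_def)
    ultimately show ?thesis by blast
  qed auto
  then obtain T where T: "T \<in> sets M" "T \<subseteq> pr E" "emeasure M H \<le> emeasure M T" by blast
  have "emeasure M (H - T) = 0"
    using T H by (subst emeasure_Diff) (auto intro: diff_eq_0_ennreal simp: less_top[symmetric])
  hence "pr E - T \<in> null_sets (completion M)"
  proof -
    have "H - T \<in> null_sets M" using \<open>emeasure M (H - T) = 0\<close> H T by (simp add: null_sets_def)
    moreover have "pr E - T \<subseteq> H - T" using H by blast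
    ultimately show ?thesis by (rule null_sets_completion_subset[rotated, OF null_sets_completionI])
  qed
  hence "pr E - T \<in> sets (completion M)" by (simp add: null_sets_def)
  moreover have "T \<in> sets (completion M)" using T(1) by simp
  ultimately have "T \<union> (pr E - T) \<in> sets (completion M)" by (rule sets.Un[rotated])
  thus ?thesis using T(2) by (simp add: pr_def Un_absorb1)
qed

theorem measurable_projection:
  fixes E :: "('g::{t2_space, second_countable_topology} \<times> 'x) set"
  assumes "locally_compact_space (euclidean :: 'g topology)" "finite_measure M"
    and "E \<in> sets (borel \<Otimes>\<^sub>M M)" "compact L"
  shows "{x \<in> space M. \<exists>g\<in>L. (g, x) \<in> E} \<in> sets (completion M)"
proof -
  have "{x \<in> space M. \<exists>g\<in>L. (g, x) \<in> E} = snd ` (E \<inter> (L \<times> space M))" by force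
  thus ?thesis
    using measurable_projection_compact[OF assms(2) suslin_if_sets[OF assms(3) open_fsigma[OF assms(1)]] assms(4)]
    by simp
qed

section \<open>Counting the points of a cross section\<close>

abbreviation cnt :: "'a set \<Rightarrow> ennreal" where "cnt \<equiv> emeasure (count_space UNIV)"

text \<open>A Dynkin argument: finiteness of \<open>K z\<close> permits subtraction for complements,
  with \<open>all\<close> as the total count, and countable additivity handles disjoint
  unions.\<close>

lemma cnt_measurable_generator:
  fixes K :: "'z \<Rightarrow> 'a set"
  assumes N: "sets N = sigma_sets (space N) \<G>" "Int_stable \<G>" "\<G> \<subseteq> Pow (space N)"
    and K: "\<And>z. z \<in> space M \<Longrightarrow> finite (K z)" "\<And>z. z \<in> space M \<Longrightarrow> K z \<subseteq> space N"
    and gen: "\<And>A. A \<in> \<G> \<Longrightarrow> (\<lambda>z. cnt (K z \<inter> A)) \<in> borel_measurable M"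
    and all: "(\<lambda>z. cnt (K z)) \<in> borel_measurable M"
    and A: "A \<in> sets N"
  shows "(\<lambda>z. cnt (K z \<inter> A)) \<in> borel_measurable M"
  using N(2,3) A[unfolded N(1)]
proof (induction A rule: sigma_sets_induct_disjoint)
  case (basic A) thus ?case by (rule gen)
next
  case (compl A)
  have "cnt (K z \<inter> (space N - A)) = cnt (K z) - cnt (K z \<inter> A)" if "z \<in> space M" for z
  proof -
    have "K z \<inter> (space N - A) = K z - K z \<inter> A" using K(2)[OF that] by auto
    thus ?thesis using K(1)[OF that] by (simp only:) (rule emeasure_Diff, auto)
  qed
  moreover have "(\<lambda>z. cnt (K z) - cnt (K z \<inter> A)) \<in> borel_measurable M" using compl.IH all by simp
  ultimately show ?case by (simp cong: measurable_cong)
next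
  case (union A)
  have "cnt (K z \<inter> (\<Union>i. A i)) = (\<Sum>i. cnt (K z \<inter> A i))" for z
  proof -
    have "disjoint_family (\<lambda>i. K z \<inter> A i)" using union(1) by (auto simp: disjoint_family_on_def)
    hence "(\<Sum>i. cnt (K z \<inter> A i)) = cnt (\<Union>i. K z \<inter> A i)" by (intro suminf_emeasure) auto
    thus ?thesis by (simp only: Int_UN_distrib)
  qed
  thus ?case using union.IH by simp
qed simp

text \<open>Replacing \<open>K z\<close> by its copy in the product over \<open>z\<close> turns a
  condition that varies with \<open>z\<close> into a fixed measurable set; on a rectangle the count
  is a product of an indicator and a count covered by \<open>gen\<close>.\<close>

lemma cnt_section_measurable:
  fixes K :: "'z \<Rightarrow> 'a set"
  assumes K: "\<And>z. z \<in> space M \<Longrightarrow> finite (K z)" "\<And>z. z \<in> space M \<Longrightarrow> K z \<subseteq> space N"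
    and gen: "\<And>A. A \<in> sets N \<Longrightarrow> (\<lambda>z. cnt (K z \<inter> A)) \<in> borel_measurable M"
    and C: "C \<in> sets (M \<Otimes>\<^sub>M N)"
  shows "(\<lambda>z. cnt {k \<in> K z. (z, k) \<in> C}) \<in> borel_measurable M"
proof -
  have cnt_image: "cnt (Pair z ` S) = cnt S" for z :: 'z and S :: "'a set"
  proof -
    have "inj_on (Pair z) S" by (simp add: inj_on_def)
    thus ?thesis by (simp add: emeasure_count_space finite_image_iff card_image)
  qed
  have "(\<lambda>z. cnt (Pair z ` K z \<inter> C)) \<in> borel_measurable M"
  proof (rule cnt_measurable_generator[where N="M \<Otimes>\<^sub>M N"])
    show "sets (M \<Otimes>\<^sub>M N) = sigma_sets (space (M \<Otimes>\<^sub>M N)) {a \<times> b |a b. a \<in> sets M \<and> b \<in> sets N}"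
      by (simp add: sets_pair_measure space_pair_measure)
    show "Int_stable {a \<times> b |a b. a \<in> sets M \<and> b \<in> sets N}" by (rule Int_stable_pair_measure_generator)
    show "{a \<times> b |a b. a \<in> sets M \<and> b \<in> sets N} \<subseteq> Pow (space (M \<Otimes>\<^sub>M N))"
      using pair_measure_closed[of M N] by (simp add: space_pair_measure)
    show "finite (Pair z ` K z)" "Pair z ` K z \<subseteq> space (M \<Otimes>\<^sub>M N)" if "z \<in> space M" for z
      using K that by (auto simp: space_pair_measure)
    have "(\<lambda>z. cnt (K z \<inter> space N)) \<in> borel_measurable M" by (rule gen) simp
    also have "?this \<longleftrightarrow> (\<lambda>z. cnt (Pair z ` K z)) \<in> borel_measurable M"
      using K(2) by (intro measurable_cong) (simp add: cnt_image Int_absorb2)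
    finally show "(\<lambda>z. cnt (Pair z ` K z)) \<in> borel_measurable M" .
  next
    fix A assume "A \<in> {a \<times> b |a b. a \<in> sets M \<and> b \<in> sets N}"
    then obtain a b where ab: "A = a \<times> b" "a \<in> sets M" "b \<in> sets N" by auto
    have "cnt (Pair z ` K z \<inter> A) = cnt (K z \<inter> b) * indicator a z" for z
    proof -
      have "Pair z ` K z \<inter> A = (if z \<in> a then Pair z ` (K z \<inter> b) else {})" using ab by auto
      thus ?thesis by (simp add: cnt_image)
    qed
    thus "(\<lambda>z. cnt (Pair z ` K z \<inter> A)) \<in> borel_measurable M" using gen[OF ab(3)] ab(2) by simp
  qed (rule C)
  moreover have "cnt (Pair z ` K z \<inter> C) = cnt {k \<in> K z. (z, k) \<in> C}" for z
  proof -
    have "Pair z ` K z \<inter> C = Pair z ` {k \<in> K z. (z, k) \<in> C}" by auto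
    thus ?thesis by (simp only: cnt_image)
  qed
  ultimately show ?thesis by simp
qed

text \<open>A point of a finite set is isolated from the others by a basic open set, because finite
  sets are closed. Peeling points off one at a time expresses cardinality through hitting conditions
  over a countable family.\<close>

lemma card_Suc_le_iff_open:
  fixes S :: "'a::{t1_space} set"
  assumes S: "finite S" and B: "topological_basis \<B>"
  shows "Suc k \<le> card S \<longleftrightarrow> (\<exists>c\<in>\<B>. S \<inter> c \<noteq> {} \<and> k \<le> card (S - c))"
proof
  assume "Suc k \<le> card S"
  then obtain p where p: "p \<in> S" by (metis Suc_le_D card_eq_0_iff ex_in_conv nat.distinct(1))
  have "open (- (S - {p}))" using S by (intro open_Compl finite_imp_closed) simp
  then obtain c where c: "c \<in> \<B>" "p \<in> c" "c \<subseteq> - (S - {p})" using B by (metis ComplI Diff_iff insertI1 topological_basisE)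
  hence "S - c = S - {p}" using p by auto
  hence "k \<le> card (S - c)" using \<open>Suc k \<le> card S\<close> p S by (simp add: card_Diff_singleton)
  thus "\<exists>c\<in>\<B>. S \<inter> c \<noteq> {} \<and> k \<le> card (S - c)" using c p by blast
next
  assume "\<exists>c\<in>\<B>. S \<inter> c \<noteq> {} \<and> k \<le> card (S - c)"
  then obtain c where c: "S \<inter> c \<noteq> {}" "k \<le> card (S - c)" by blast
  hence "S - c \<subset> S" by auto
  hence "card (S - c) < card S" using S by (rule psubset_card_mono[rotated])
  thus "Suc k \<le> card S" using c by simp
qed

section \<open>The action, Haar null sets and hitting sets\<close>

locale transverse_setup =
  fixes m :: "'g::{topological_group_add, t2_space, second_countable_topology} measure"
    and \<mu> :: "'x measure" and act :: "'g \<Rightarrow> 'x \<Rightarrow> 'x" and Y :: "'x set" and \<nu> :: "'x measure"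
  assumes lc: "locally_compact_space (euclidean :: 'g topology)"
    and haar: "haar_measure m"
    and unimod: "unimodular m"
    and trans: "transverse_system \<mu> act Y"
    and tm: "transverse_measure m \<mu> act Y \<nu>"
begin

lemma sets_m: "sets m = sets borel" using haar by (simp add: haar_measure_def)
lemma space_m: "space m = UNIV" using sets_eq_imp_space_eq[OF sets_m] by simp

lemma m_AE_left: "AE h in m. Q h \<Longrightarrow> AE h in m. Q (g + h)"
proof -
  assume *: "AE h in m. Q h"
  have "distr m borel (\<lambda>h. g + h) = m" using haar by (simp add: haar_measure_def)
  moreover have "(\<lambda>h. g + h) \<in> measurable m borel" by (simp cong: measurable_cong_sets add: sets_m)
  ultimately show ?thesis using AE_distrD[of "\<lambda>h. g + h" m borel Q] * by metis
qed

text \<open>Replacing the base point \<open>x\<close> by \<open>act a x\<close> turns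
  \<open>g\<close> into \<open>g + a\<close>, so properties holding along almost all of an orbit are
  independent of the base point only if null sets are right invariant. Unimodularity provides
  this.\<close>

lemma m_AE_right: "AE h in m. Q h \<Longrightarrow> AE h in m. Q (h + g)"
proof -
  assume *: "AE h in m. Q h"
  have "distr m borel (\<lambda>h. h + g) = m" using unimod by (simp add: unimodular_def)
  moreover have "(\<lambda>h. h + g) \<in> measurable m borel" by (simp cong: measurable_cong_sets add: sets_m)
  ultimately show ?thesis using AE_distrD[of "\<lambda>h. h + g" m borel Q] * by metis
qed

lemma m_AE_right_iff: "(AE h in m. Q (h + g)) \<longleftrightarrow> (AE h in m. Q h)"
proof
  assume "AE h in m. Q (h + g)"
  from m_AE_right[OF this, of "- g"] show "AE h in m. Q h" by (simp add: add.assoc)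
qed (rule m_AE_right)

sublocale mu: prob_space \<mu> using trans by (simp add: transverse_system_def)

sublocale m: sigma_finite_measure m
proof
  obtain L :: "nat \<Rightarrow> 'g set" where L: "\<And>n. compact (L n)" "(\<Union>n. L n) = UNIV" using compact_exhaustion[OF lc] by metis
  have "emeasure m (L n) \<noteq> \<infinity>" for n using haar L(1)[of n] by (auto simp: haar_measure_def)
  moreover have "L n \<in> sets m" for n using L(1)[of n] by (simp add: sets_m borel_closed compact_imp_closed)
  ultimately show "\<exists>A. countable A \<and> A \<subseteq> sets m \<and> \<Union> A = space m \<and> (\<forall>a\<in>A. emeasure m a \<noteq> \<infinity>)"
    using L(2) by (intro exI[of _ "range L"]) (auto simp: space_m)
qed

text \<open>Normalising a strictly positive integrable density gives a probability measure with the
  null sets of Haar measure, against which every bounded measurable function can be averaged. It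
  need not be invariant; only its null sets are.\<close>

lemma ex_equivalent_prob:
  "\<exists>p. prob_space p \<and> sets p = sets (borel :: 'g measure) \<and> (\<forall>Q. (AE g in p. Q g) \<longleftrightarrow> (AE g in m. Q g))"
proof -
  obtain h where h: "h \<in> borel_measurable m" "integral\<^sup>N m h \<noteq> \<infinity>" "\<And>x. x \<in> space m \<Longrightarrow> 0 < h x \<and> h x < \<infinity>"
    using m.Ex_finite_integrable_function by blast
  have "integral\<^sup>N m h \<noteq> 0"
  proof
    assume "integral\<^sup>N m h = 0"
    hence "AE x in m. h x = 0" using h(1) by (simp add: nn_integral_0_iff_AE)
    moreover have "AE x in m. 0 < h x" using h(3) by auto
    ultimately have "AE x in m. False" by eventually_elim simp
    hence "emeasure m {x \<in> space m. \<not> False} = 0" by (intro AE_E2) auto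
    hence "emeasure m UNIV = 0" by (simp add: space_m)
    thus False using haar by (simp add: haar_measure_def)
  qed
  define p where "p = density m (\<lambda>x. h x / integral\<^sup>N m h)"
  have "prob_space p"
  proof
    have "emeasure p (space p) = integral\<^sup>N m h / integral\<^sup>N m h"
      using h(1) by (simp add: p_def emeasure_density nn_integral_divide)
    thus "emeasure p (space p) = 1" using h(2) \<open>integral\<^sup>N m h \<noteq> 0\<close>
      by (auto simp: less_top)
  qed
  moreover have "(AE g in p. Q g) \<longleftrightarrow> (AE g in m. Q g)" for Q
  proof -
    have "0 < h x / integral\<^sup>N m h" for x
      using h(2) h(3)[of x] by (simp add: space_m ennreal_zero_less_divide less_top)
    hence "(AE x in m. 0 < h x / integral\<^sup>N m h \<longrightarrow> Q x) \<longleftrightarrow> (AE g in m. Q g)" by (simp only: simp_thms)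
    moreover have "(AE g in p. Q g) \<longleftrightarrow> (AE x in m. 0 < h x / integral\<^sup>N m h \<longrightarrow> Q x)"
      unfolding p_def by (rule AE_density) (use h(1) in simp)
    ultimately show ?thesis by simp
  qed
  ultimately show ?thesis by (intro exI[of _ p]) (auto simp: p_def sets_m)
qed

definition mp where
  "mp = (SOME p. prob_space p \<and> sets p = sets (borel :: 'g measure) \<and> (\<forall>Q. (AE g in p. Q g) \<longleftrightarrow> (AE g in m. Q g)))"

lemma mp_prob: "prob_space mp" and sets_mp[measurable_cong]: "sets mp = sets borel"
  and mp_AE: "(AE g in mp. Q g) \<longleftrightarrow> (AE g in m. Q g)"
  using someI_ex[OF ex_equivalent_prob] unfolding mp_def[symmetric] by auto

sublocale mp: prob_space mp by (rule mp_prob)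

lemma act_meas: "(\<lambda>(g, x). act g x) \<in> measurable (borel \<Otimes>\<^sub>M \<mu>) \<mu>"
  and act_zero: "x \<in> space \<mu> \<Longrightarrow> act 0 x = x"
  and act_add: "x \<in> space \<mu> \<Longrightarrow> act (g + h) x = act g (act h x)"
  and act_distr: "distr \<mu> \<mu> (act g) = \<mu>"
  using trans by (auto simp: transverse_system_def pmp_action_def)

lemma act_measurable[measurable (raw)]:
  assumes "f \<in> measurable M borel" "h \<in> measurable M \<mu>"
  shows "(\<lambda>z. act (f z) (h z)) \<in> measurable M \<mu>"
  using measurable_compose[OF measurable_Pair[OF assms] act_meas] by simp

lemma act_space: "x \<in> space \<mu> \<Longrightarrow> act g x \<in> space \<mu>"
  using measurable_space[OF act_meas, of "(g, x)"] by (simp add: space_pair_measure)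

lemma act_minus: "x \<in> space \<mu> \<Longrightarrow> act (- g) (act g x) = x" "x \<in> space \<mu> \<Longrightarrow> act g (act (- g) x) = x"
  using act_add[of x "- g" g] act_add[of x g "- g"] act_zero by auto

lemma act_measurable1: "act g \<in> measurable \<mu> \<mu>"
  by measurable

lemma mu_AE_act: "AE x in \<mu>. Q x \<Longrightarrow> AE x in \<mu>. Q (act g x)"
  using AE_distrD[OF act_measurable1, of Q g] unfolding act_distr .

lemma Y_sets[measurable]: "Y \<in> sets \<mu>" and Y_hit: "x \<in> space \<mu> \<Longrightarrow> \<exists>g. act g x \<in> Y"
  and loc_fin: "x \<in> space \<mu> \<Longrightarrow> compact L \<Longrightarrow> finite (hitting_set act Y x \<inter> L)"
proof -
  show Y: "Y \<in> sets \<mu>" and "x \<in> space \<mu> \<Longrightarrow> compact L \<Longrightarrow> finite (hitting_set act Y x \<inter> L)"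
    using trans by (auto simp: transverse_system_def cross_section_def)
  assume "x \<in> space \<mu>"
  then obtain g y where "y \<in> Y" "x = act g y" using trans unfolding transverse_system_def cross_section_def by blast
  hence "act (- g) x \<in> Y" using act_minus(1) sets.sets_into_space[OF Y] by auto
  thus "\<exists>g. act g x \<in> Y" ..
qed

lemma Y_space: "y \<in> Y \<Longrightarrow> y \<in> space \<mu>"
  using sets.sets_into_space[OF Y_sets] by auto

abbreviation H where "H \<equiv> hitting_set act Y"

lemma H_iff: "g \<in> H x \<longleftrightarrow> act g x \<in> Y" by (simp add: hitting_set_def)

text \<open>Moving the base point by \<open>a\<close> translates the hitting set on the right by the
  inverse of \<open>a\<close>.\<close>

lemma H_act: "x \<in> space \<mu> \<Longrightarrow> h \<in> H (act a x) \<longleftrightarrow> h + a \<in> H x"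
  by (simp add: H_iff act_add)

end

section \<open>Borel measurability of the counting functions\<close>

text \<open>\<open>L_pos\<close> makes the normalised indicator of each \<open>L n\<close> an
  admissible weight in the formula defining \<nu>.\<close>

locale transverse_exhaustion = transverse_setup m \<mu> act Y \<nu>
  for m :: "'g::{topological_group_add, t2_space, second_countable_topology} measure"
    and \<mu> :: "'x measure" and act :: "'g \<Rightarrow> 'x \<Rightarrow> 'x" and Y :: "'x set" and \<nu> :: "'x measure" +
  fixes L :: "nat \<Rightarrow> 'g set"
  assumes L_compact: "\<And>n. compact (L n)" and L_inc: "incseq L" and L_UN: "(\<Union>n. L n) = UNIV"
    and L_pos: "\<And>n. 0 < emeasure m (L n)"
begin

lemma L_borel[measurable]: "L n \<in> sets borel"
  using L_compact by (simp add: borel_closed compact_imp_closed)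

lemma finite_HL: "x \<in> space \<mu> \<Longrightarrow> finite (H x \<inter> L n)" "x \<in> space \<mu> \<Longrightarrow> finite (H x \<inter> L n \<inter> A)"
  using loc_fin[OF _ L_compact] by blast+

text \<open>The condition asks for some \<open>g\<close> in the compact set \<open>L n\<close> with
  \<open>(g, x)\<close> in a Borel set, hence is a projection; the projection theorem yields
  measurability for the completion of \<mu> only.\<close>

lemma hit_completion:
  assumes [measurable]: "A \<in> sets borel"
  shows "{x \<in> space \<mu>. H x \<inter> L n \<inter> A \<noteq> {}} \<in> sets (completion \<mu>)"
proof -
  define E where "E = {z \<in> space (borel \<Otimes>\<^sub>M \<mu>). fst z \<in> A \<and> act (fst z) (snd z) \<in> Y}"
  have "E \<in> sets (borel \<Otimes>\<^sub>M \<mu>)" unfolding E_def by measurable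
  from measurable_projection[OF lc mu.finite_measure this L_compact[of n]]
  have "{x \<in> space \<mu>. \<exists>g\<in>L n. (g, x) \<in> E} \<in> sets (completion \<mu>)" .
  also have "{x \<in> space \<mu>. \<exists>g\<in>L n. (g, x) \<in> E} = {x \<in> space \<mu>. H x \<inter> L n \<inter> A \<noteq> {}}"
    by (auto simp: E_def H_iff space_pair_measure)
  finally show ?thesis .
qed

text \<open>Splitting off a point inside a basic set \<open>c\<close> leaves the task of counting
  the rest outside \<open>c\<close>, so \<open>A\<close> has to vary in the induction.\<close>

lemma card_completion:
  assumes "A \<in> sets borel"
  shows "{x \<in> space \<mu>. k \<le> card (H x \<inter> L n \<inter> A)} \<in> sets (completion \<mu>)"
  using assms
proof (induction k arbitrary: A)
  case 0
  have "space \<mu> \<in> sets (completion \<mu>)" by simp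
  thus ?case by simp
next
  case (Suc k)
  obtain \<B> :: "'g set set" where \<B>: "countable \<B>" "topological_basis \<B>" using ex_countable_basis by blast
  have open_b: "c \<in> sets borel" if "c \<in> \<B>" for c using topological_basis_open[OF \<B>(2) that] by simp
  have "{x \<in> space \<mu>. Suc k \<le> card (H x \<inter> L n \<inter> A)} =
    (\<Union>c\<in>\<B>. {x \<in> space \<mu>. H x \<inter> L n \<inter> (A \<inter> c) \<noteq> {}} \<inter> {x \<in> space \<mu>. k \<le> card (H x \<inter> L n \<inter> (A - c))})"
  proof (intro set_eqI)
    fix x
    have "Suc k \<le> card (H x \<inter> L n \<inter> A) \<longleftrightarrow> (\<exists>c\<in>\<B>. H x \<inter> L n \<inter> (A \<inter> c) \<noteq> {} \<and> k \<le> card (H x \<inter> L n \<inter> (A - c)))" if "x \<in> space \<mu>"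
      unfolding card_Suc_le_iff_open[OF finite_HL(2)[OF that] \<B>(2)] by (simp add: Int_assoc Int_Diff)
    thus "x \<in> {x \<in> space \<mu>. Suc k \<le> card (H x \<inter> L n \<inter> A)} \<longleftrightarrow> x \<in> (\<Union>c\<in>\<B>. {x \<in> space \<mu>. H x \<inter> L n \<inter> (A \<inter> c) \<noteq> {}} \<inter> {x \<in> space \<mu>. k \<le> card (H x \<inter> L n \<inter> (A - c))})"
      by blast
  qed
  also have "\<dots> \<in> sets (completion \<mu>)"
    using \<B>(1) Suc.IH[of "A - c" for c] hit_completion[of "A \<inter> c" for c] open_b Suc.prems
    by (intro sets.countable_UN' sets.Int) auto
  finally show ?case .
qed

lemma cnt_completion:
  assumes "A \<in> sets borel"
  shows "(\<lambda>x. cnt (H x \<inter> L n \<inter> A)) \<in> borel_measurable (completion \<mu>)"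
proof -
  have "(\<lambda>x. card (H x \<inter> L n \<inter> A)) \<in> measurable (completion \<mu>) (count_space UNIV)"
    unfolding measurable_count_space_eq_countable[OF countableI_type]
  proof (intro conjI ballI)
    fix k :: nat
    have eq: "(\<lambda>x. card (H x \<inter> L n \<inter> A)) -` {k} \<inter> space (completion \<mu>) =
      {x \<in> space \<mu>. k \<le> card (H x \<inter> L n \<inter> A)} - {x \<in> space \<mu>. Suc k \<le> card (H x \<inter> L n \<inter> A)}" by auto
    thus "(\<lambda>x. card (H x \<inter> L n \<inter> A)) -` {k} \<inter> space (completion \<mu>) \<in> sets (completion \<mu>)"
      unfolding eq by (intro sets.Diff card_completion[OF assms])
  qed auto
  hence "(\<lambda>x. of_nat (card (H x \<inter> L n \<inter> A)) :: ennreal) \<in> borel_measurable (completion \<mu>)"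
    by (rule measurable_compose) simp
  also have "?this \<longleftrightarrow> ?thesis"
    by (intro measurable_cong) (simp add: emeasure_count_space finite_HL)
  finally show ?thesis .
qed

text \<open>Each count agrees with a Borel function off a null set depending on \<open>n\<close> and
  \<open>A\<close>. Collecting these null sets over a countable intersection-stable generator keeps
  their union null, and a Dynkin argument then reaches all Borel sets \<open>A\<close>.\<close>

lemma ex_null_set:
  "\<exists>N0\<in>null_sets \<mu>. \<forall>n. \<forall>A\<in>sets borel. (\<lambda>x. cnt ((if x \<in> N0 then {} else H x \<inter> L n) \<inter> A)) \<in> borel_measurable \<mu>"
proof -
  obtain \<B> :: "'g set set" where \<B>: "countable \<B>" "topological_basis \<B>" using ex_countable_basis by blast
  \<comment> \<open>The empty family contributes \<open>UNIV\<close>, which supplies the total count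
    needed for complements.\<close>
  define \<A> where "\<A> = Inter ` {F. finite F \<and> F \<subseteq> \<B>}"
  have "countable \<A>" unfolding \<A>_def using countable_Collect_finite_subset[OF \<B>(1)] by auto
  have open_A: "open A" if "A \<in> \<A>" for A
    using that topological_basis_open[OF \<B>(2)] by (auto simp: \<A>_def intro!: open_Inter)
  have "Int_stable \<A>"
  proof (rule Int_stableI)
    fix a b assume "a \<in> \<A>" "b \<in> \<A>"
    then obtain F F' where "finite F" "F \<subseteq> \<B>" "a = \<Inter>F" "finite F'" "F' \<subseteq> \<B>" "b = \<Inter>F'" by (auto simp: \<A>_def)
    thus "a \<inter> b \<in> \<A>" unfolding \<A>_def by (intro image_eqI[of _ _ "F \<union> F'"]) auto
  qed
  have UNIV_A: "UNIV \<in> \<A>" unfolding \<A>_def by (intro image_eqI[of _ _ "{}"]) auto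
  have "\<B> \<subseteq> \<A>"
  proof
    fix b assume "b \<in> \<B>"
    thus "b \<in> \<A>" unfolding \<A>_def by (intro image_eqI[of _ _ "{b}"]) auto
  qed
  have gen: "sets (borel :: 'g measure) = sigma_sets UNIV \<A>"
  proof
    have "sets (borel :: 'g measure) = sigma_sets UNIV \<B>"
      by (simp add: borel_eq_countable_basis[OF \<B>])
    also have "\<dots> \<subseteq> sigma_sets UNIV \<A>" using \<open>\<B> \<subseteq> \<A>\<close> by (rule sigma_sets_subseteq)
    finally show "sets (borel :: 'g measure) \<subseteq> sigma_sets UNIV \<A>" .
    show "sigma_sets UNIV \<A> \<subseteq> sets (borel :: 'g measure)"
    proof -
      have "\<A> \<subseteq> sets (borel :: 'g measure)" using open_A by auto
      thus ?thesis using sets.sigma_sets_subset[of \<A> borel] by simp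
    qed
  qed
  have ex: "\<exists>N g. N \<in> null_sets \<mu> \<and> g \<in> borel_measurable \<mu> \<and> (\<forall>x\<in>space \<mu> - N. cnt (H x \<inter> L n \<inter> A) = g x)"
    if A: "A \<in> \<A>" for n A
  proof -
    obtain g where g: "g \<in> borel_measurable \<mu>" "AE x in \<mu>. cnt (H x \<inter> L n \<inter> A) = g x"
      using completion_ex_borel_measurable[OF cnt_completion[of A n]] open_A[OF A] by auto
    obtain N where "\<And>x. x \<in> space \<mu> - N \<Longrightarrow> cnt (H x \<inter> L n \<inter> A) = g x" "N \<in> null_sets \<mu>"
      using AE_E3[OF g(2)] by blast
    thus ?thesis using g(1) by blast
  qed
  then obtain N g where N: "\<And>n A. A \<in> \<A> \<Longrightarrow> N n A \<in> null_sets \<mu>"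
    and g: "\<And>n A. A \<in> \<A> \<Longrightarrow> g n A \<in> borel_measurable \<mu>"
    and Ng: "\<And>n A x. A \<in> \<A> \<Longrightarrow> x \<in> space \<mu> - N n A \<Longrightarrow> cnt (H x \<inter> L n \<inter> A) = g n A x"
  proof -
    have "\<forall>q\<in>UNIV \<times> \<A>. \<exists>w. fst w \<in> null_sets \<mu> \<and> snd w \<in> borel_measurable \<mu> \<and>
        (\<forall>x\<in>space \<mu> - fst w. cnt (H x \<inter> L (fst q) \<inter> snd q) = snd w x)"
      using ex by fastforce
    from bchoice[OF this] obtain f where f: "\<And>n A. A \<in> \<A> \<Longrightarrow> fst (f (n, A)) \<in> null_sets \<mu> \<and> snd (f (n, A)) \<in> borel_measurable \<mu> \<and>
        (\<forall>x\<in>space \<mu> - fst (f (n, A)). cnt (H x \<inter> L n \<inter> A) = snd (f (n, A)) x)" by auto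
    show thesis
      by (rule that[of "\<lambda>n A. fst (f (n, A))" "\<lambda>n A. snd (f (n, A))"]) (use f in blast)+
  qed
  define N0 where "N0 = (\<Union>n. \<Union>A\<in>\<A>. N n A)"
  have N0: "N0 \<in> null_sets \<mu>" unfolding N0_def using N \<open>countable \<A>\<close>
    by (intro null_sets_UN' countableI_type) auto
  hence [measurable]: "N0 \<in> sets \<mu>" by auto
  have "(\<lambda>x. cnt ((if x \<in> N0 then {} else H x \<inter> L n) \<inter> A)) \<in> borel_measurable \<mu>" if "A \<in> \<A>" for n A
  proof -
    have "(\<lambda>x. if x \<in> N0 then 0 else g n A x) \<in> borel_measurable \<mu>" using g[OF that] by measurable
    also have "?this \<longleftrightarrow> ?thesis"
      using Ng[OF that] that by (intro measurable_cong) (auto simp: N0_def)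
    finally show ?thesis .
  qed
  note meas = this
  have "(\<lambda>x. cnt ((if x \<in> N0 then {} else H x \<inter> L n) \<inter> A)) \<in> borel_measurable \<mu>" if "A \<in> sets borel" for n A
  proof (rule cnt_measurable_generator[where \<G>=\<A> and N=borel])
    show "(\<lambda>x. cnt (if x \<in> N0 then {} else H x \<inter> L n)) \<in> borel_measurable \<mu>" using meas[OF UNIV_A] by simp
  qed (use gen \<open>Int_stable \<A>\<close> meas that finite_HL in auto)
  thus ?thesis using N0 by blast
qed

text \<open>Joint measurability in \<open>g\<close> and \<open>z\<close>: the condition
  \<open>h + g \<in> B\<close> is a measurable subset of the triple product, so the finite pieces
  over \<open>L j\<close> are covered by \<open>cnt_section_measurable\<close>, and the supremum
  over \<open>j\<close> recovers the full, possibly infinite, count.\<close>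

lemma cnt_translate_measurable:
  assumes N0: "N0 \<in> null_sets \<mu>"
    and meas: "\<And>n A. A \<in> sets borel \<Longrightarrow> (\<lambda>x. cnt ((if x \<in> N0 then {} else H x \<inter> L n) \<inter> A)) \<in> borel_measurable \<mu>"
    and B[measurable]: "B \<in> sets borel"
  shows "(\<lambda>(g, z). if z \<in> N0 then 0 else cnt {h \<in> H z. h + g \<in> B}) \<in> borel_measurable (borel \<Otimes>\<^sub>M \<mu>)"
proof -
  define K where "K j p = (if snd p \<in> N0 then {} else H (snd p) \<inter> L j)" for j and p :: "'g \<times> 'x"
  define C where "C = {p \<in> space (((borel :: 'g measure) \<Otimes>\<^sub>M \<mu>) \<Otimes>\<^sub>M borel). snd p + fst (fst p) \<in> B}"
  have C: "C \<in> sets ((borel \<Otimes>\<^sub>M \<mu>) \<Otimes>\<^sub>M borel)" unfolding C_def by measurable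
  have "(\<lambda>p. cnt {h \<in> K j p. (p, h) \<in> C}) \<in> borel_measurable ((borel :: 'g measure) \<Otimes>\<^sub>M \<mu>)" for j
  proof (rule cnt_section_measurable[OF _ _ _ C])
    show "finite (K j p)" if "p \<in> space ((borel :: 'g measure) \<Otimes>\<^sub>M \<mu>)" for p
      using that finite_HL by (auto simp: K_def space_pair_measure)
    fix A :: "'g set" assume "A \<in> sets borel"
    from meas[OF this] show "(\<lambda>p. cnt (K j p \<inter> A)) \<in> borel_measurable (borel \<Otimes>\<^sub>M \<mu>)"
      unfolding K_def by (rule measurable_compose[OF measurable_snd])
  qed auto
  hence "(\<lambda>p. SUP j. cnt {h \<in> K j p. (p, h) \<in> C}) \<in> borel_measurable ((borel :: 'g measure) \<Otimes>\<^sub>M \<mu>)" by (intro borel_measurable_SUP) auto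
  also have "?this \<longleftrightarrow> ?thesis"
  proof (intro measurable_cong)
    fix p assume p: "p \<in> space ((borel :: 'g measure) \<Otimes>\<^sub>M \<mu>)"
    obtain g z where gz: "p = (g, z)" "z \<in> space \<mu>" using p by (auto simp: space_pair_measure)
    show "(SUP j. cnt {h \<in> K j p. (p, h) \<in> C}) = (case p of (g, z) \<Rightarrow> if z \<in> N0 then 0 else cnt {h \<in> H z. h + g \<in> B})"
    proof (cases "z \<in> N0")
      case False
      have "(SUP j. cnt {h \<in> H z \<inter> L j. h + g \<in> B}) = cnt (\<Union>j. {h \<in> H z \<inter> L j. h + g \<in> B})"
        using L_inc by (intro SUP_emeasure_incseq) (auto simp: incseq_def)
      also have "(\<Union>j. {h \<in> H z \<inter> L j. h + g \<in> B}) = {h \<in> H z. h + g \<in> B}" using L_UN by auto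
      finally show ?thesis using False gz by (simp add: K_def C_def space_pair_measure)
    qed (simp add: gz K_def)
  qed
  finally show ?thesis .
qed

text \<open>The null set obtained above is not invariant under \<open>G\<close>.  On the invariant set of points whose
  orbit meets it in a null set of translates, the counting functions are averages over the orbit of
  functions that are already known to be measurable.\<close>

lemma ex_regular_set:
  "\<exists>X0\<in>sets \<mu>. (\<forall>a. \<forall>x\<in>space \<mu>. act a x \<in> X0 \<longleftrightarrow> x \<in> X0) \<and> (AE x in \<mu>. x \<in> X0) \<and>
    (\<forall>n. \<forall>A\<in>sets borel. (\<lambda>x. cnt ((if x \<in> X0 then H x \<inter> L n else {}) \<inter> A)) \<in> borel_measurable \<mu>)"
proof -
  obtain N0 where N0: "N0 \<in> null_sets \<mu>"
    and meas: "\<And>n A. A \<in> sets borel \<Longrightarrow> (\<lambda>x. cnt ((if x \<in> N0 then {} else H x \<inter> L n) \<inter> A)) \<in> borel_measurable \<mu>"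
    using ex_null_set by blast
  have [measurable]: "N0 \<in> sets \<mu>" using N0 by auto
  define X0 where "X0 = {x \<in> space \<mu>. AE g in mp. act g x \<notin> N0}"
  have X0_eq: "X0 = {x \<in> space \<mu>. (\<integral>\<^sup>+g. indicator N0 (act g x) \<partial>mp) = 0}"
    unfolding X0_def
  proof (intro Collect_cong conj_cong refl)
    fix x assume [simp]: "x \<in> space \<mu>"
    have [measurable]: "(\<lambda>g. act g x) \<in> measurable mp \<mu>" by measurable
    show "(AE g in mp. act g x \<notin> N0) \<longleftrightarrow> (\<integral>\<^sup>+g. indicator N0 (act g x) \<partial>mp) = 0"
      by (subst nn_integral_0_iff_AE) (auto simp: indicator_eq_0_iff)
  qed
  have "(\<lambda>x. \<integral>\<^sup>+g. indicator N0 (act g x) \<partial>mp) \<in> borel_measurable \<mu>"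
    by (rule mp.borel_measurable_nn_integral) (simp add: split_beta', measurable)
  hence X0[measurable]: "X0 \<in> sets \<mu>" unfolding X0_eq by measurable
  \<comment> \<open>Translating the base point shifts the parameter \<open>g\<close> on the right,
    and right translations preserve Haar null sets.\<close>
  have inv: "act a x \<in> X0 \<longleftrightarrow> x \<in> X0" if x: "x \<in> space \<mu>" for a x
  proof -
    have "(AE g in m. act g (act a x) \<notin> N0) \<longleftrightarrow> (AE g in m. act (g + a) x \<notin> N0)" by (simp add: act_add x)
    also have "\<dots> \<longleftrightarrow> (AE g in m. act g x \<notin> N0)" by (rule m_AE_right_iff)
    finally show ?thesis using x act_space by (simp add: X0_def mp_AE)
  qed
  interpret MP: pair_sigma_finite \<mu> mp by standard
  have AE: "AE x in \<mu>. x \<in> X0"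
  proof -
    have "AE x in \<mu>. act g x \<notin> N0" for g using mu_AE_act[OF AE_not_in[OF N0]] .
    hence "AE g in mp. AE x in \<mu>. act g x \<notin> N0" by simp
    hence "AE x in \<mu>. AE g in mp. act g x \<notin> N0"
      by (subst MP.AE_commute) measurable
    thus ?thesis by (rule AE_mp) (auto simp: X0_def)
  qed
  have "(\<lambda>x. cnt ((if x \<in> X0 then H x \<inter> L n else {}) \<inter> A)) \<in> borel_measurable \<mu>"
    if [measurable]: "A \<in> sets borel" for n A
  proof -
    \<comment> \<open>Designed so that \<open>f g (act g x)\<close> counts
      \<open>H x \<inter> L n \<inter> A\<close> whenever \<open>act g x\<close> avoids
      \<open>N0\<close>: the shift by \<open>g\<close> undoes the translation of the hitting set.
      The average over \<open>g\<close> therefore has the wanted value although \<open>x\<close>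
      itself may lie in \<open>N0\<close>.\<close>
    define f where "f g z = (if z \<in> N0 then 0 else cnt {h \<in> H z. h + g \<in> L n \<inter> A})" for g z
    have f: "(\<lambda>p. f (fst p) (snd p)) \<in> borel_measurable (borel \<Otimes>\<^sub>M \<mu>)"
      using cnt_translate_measurable[OF N0 meas, of "L n \<inter> A"] by (simp add: f_def split_beta')
    have "(\<lambda>(x, g). f g (act g x)) \<in> borel_measurable (\<mu> \<Otimes>\<^sub>M mp)"
      using measurable_compose[OF _ f, of "\<lambda>p. (snd p, act (snd p) (fst p))" "\<mu> \<Otimes>\<^sub>M mp"]
      by (simp add: split_beta')
    hence "(\<lambda>x. \<integral>\<^sup>+g. f g (act g x) \<partial>mp) \<in> borel_measurable \<mu>" by (rule mp.borel_measurable_nn_integral)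
    hence "(\<lambda>x. if x \<in> X0 then \<integral>\<^sup>+g. f g (act g x) \<partial>mp else 0) \<in> borel_measurable \<mu>" by measurable
    also have "?this \<longleftrightarrow> ?thesis"
    proof (intro measurable_cong)
      fix x assume x: "x \<in> space \<mu>"
      show "(if x \<in> X0 then \<integral>\<^sup>+g. f g (act g x) \<partial>mp else 0) = cnt ((if x \<in> X0 then H x \<inter> L n else {}) \<inter> A)"
      proof (cases "x \<in> X0")
        case True
        have "AE g in mp. act g x \<notin> N0" using True by (simp add: X0_def)
        hence "AE g in mp. f g (act g x) = cnt (H x \<inter> L n \<inter> A)"
        proof eventually_elim
          case (elim g)
          have "H x \<inter> L n \<inter> A = (\<lambda>h. h + g) ` {h \<in> H (act g x). h + g \<in> L n \<inter> A}"
          proof (intro set_eqI iffI)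
            fix h assume "h \<in> H x \<inter> L n \<inter> A"
            thus "h \<in> (\<lambda>h. h + g) ` {h \<in> H (act g x). h + g \<in> L n \<inter> A}"
              using H_act[OF x, of "h - g" g] by (intro image_eqI[of _ _ "h - g"]) auto
          qed (auto simp: H_act[OF x])
          moreover have "inj_on (\<lambda>h. h + g) S" for S by (auto simp: inj_on_def)
          ultimately show ?case using elim by (simp add: f_def emeasure_count_space finite_image_iff card_image)
        qed
        hence "(\<integral>\<^sup>+g. f g (act g x) \<partial>mp) = (\<integral>\<^sup>+g. cnt (H x \<inter> L n \<inter> A) \<partial>mp)" by (rule nn_integral_cong_AE)
        thus ?thesis using True by (simp add: mp.emeasure_space_1)
      qed simp
    qed
    finally show ?thesis .
  qed
  with X0 inv AE show ?thesis by (intro bexI[of _ X0] conjI allI ballI) simp_all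
qed

end

section \<open>Equivariant averaging of cochains\<close>

lemma borel_measurable_uminus_group[measurable (raw)]:
  fixes f :: "'a \<Rightarrow> 'g::{topological_group_add, second_countable_topology}"
  assumes "f \<in> borel_measurable M"
  shows "(\<lambda>x. - f x) \<in> borel_measurable M"
  by (rule measurable_compose[OF assms borel_measurable_continuous_onI]) (intro continuous_intros)

context transverse_setup begin

abbreviation SEQ :: "(nat \<Rightarrow> 'g) measure" where "SEQ \<equiv> PiM UNIV (\<lambda>_. borel)"

text \<open>The entry \<open>g\<close> serves as a base point: the measure at
  \<open>act (- g) x\<close> is carried back by left translation with \<open>g\<close>. Translating
  \<open>g\<close> and \<open>x\<close> by \<open>a\<close> does not change
  \<open>act (- g) x\<close>, so an arbitrary kernel \<open>\<rho>\<close> yields an equivariant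
  family. The value outside \<open>space \<mu>\<close> makes the kernel lawful for every
  \<open>x\<close>.\<close>

definition orbit_kernel :: "('x \<Rightarrow> 'g measure) \<Rightarrow> 'x \<Rightarrow> 'g \<Rightarrow> 'g measure" where
  "orbit_kernel \<rho> x g = (if x \<in> space \<mu> then distr (\<rho> (act (- g) x)) borel (\<lambda>k. g + k) else return borel g)"

lemma kernel_averaging:
  assumes \<rho>[measurable]: "\<rho> \<in> measurable \<mu> (prob_algebra borel)"
  shows "averaging borel (orbit_kernel \<rho> x)"
proof
  show "orbit_kernel \<rho> x \<in> measurable borel (prob_algebra borel)"
  proof (cases "x \<in> space \<mu>")
    case [simp]: True
    have [measurable]: "(\<lambda>g. \<rho> (act (- g) x)) \<in> measurable borel (prob_algebra borel)"
      by (rule measurable_compose[OF _ \<rho>]) (intro act_measurable borel_measurable_uminus_group measurable_ident_sets measurable_const, simp_all)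
    show ?thesis unfolding orbit_kernel_def using True by simp
  next
    case False
    thus ?thesis by (simp add: orbit_kernel_def[abs_def])
  qed
qed simp

lemma rho_sets: "\<rho> \<in> measurable \<mu> (prob_algebra borel) \<Longrightarrow> z \<in> space \<mu> \<Longrightarrow> sets (\<rho> z) = sets borel"
  and rho_prob: "\<rho> \<in> measurable \<mu> (prob_algebra borel) \<Longrightarrow> z \<in> space \<mu> \<Longrightarrow> prob_space (\<rho> z)"
  by (auto dest: measurable_space simp: space_prob_algebra)

lemma upd_SEQ: "(\<lambda>k. u(l := k)) \<in> measurable borel SEQ"
proof (rule measurable_PiM_single')
  fix i :: nat
  show "(\<lambda>k. (u(l := k)) i) \<in> borel_measurable borel" by (cases "i = l") auto
qed auto

lemma avg_kernel:
  assumes \<rho>: "\<rho> \<in> measurable \<mu> (prob_algebra borel)" and f: "f \<in> borel_measurable SEQ" and x: "x \<in> space \<mu>"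
  shows "avg (orbit_kernel \<rho> x) l f u = (\<integral>k. f (u(l := u l + k)) \<partial>\<rho> (act (- u l) x))"
proof -
  have s: "sets (\<rho> (act (- u l) x)) = sets borel" using rho_sets[OF \<rho> act_space[OF x]] .
  have "(\<lambda>k. f (u(l := k))) \<in> borel_measurable borel" using measurable_compose[OF upd_SEQ f] .
  thus ?thesis unfolding avg_def orbit_kernel_def using x
    by (simp, subst integral_distr) (auto simp: s cong: measurable_cong_sets)
qed

text \<open>Functions of \<open>n\<close> group variables, that is cochains of degree
  \<open>n - 1\<close>. Bounds, invariance and dependence on the first \<open>n\<close> entries hold
  everywhere rather than almost everywhere, so averages and prisms can be formed pointwise;
  vanishing outside \<open>space \<mu>\<close> turns their algebraic identities into equalities of
  total functions.\<close>

definition cochain :: "nat \<Rightarrow> ((nat \<Rightarrow> 'g) \<times> 'x \<Rightarrow> real) set" where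
  "cochain n = {F. F \<in> borel_measurable (SEQ \<Otimes>\<^sub>M \<mu>) \<and> (\<exists>B. \<forall>p. \<bar>F p\<bar> \<le> B) \<and>
     (\<forall>u v x. (\<forall>i<n. u i = v i) \<longrightarrow> F (u, x) = F (v, x)) \<and>
     (\<forall>a u x. x \<in> space \<mu> \<longrightarrow> F (\<lambda>i. a + u i, act a x) = F (u, x)) \<and>
     (\<forall>u x. x \<notin> space \<mu> \<longrightarrow> F (u, x) = 0)}"

lemma cochainD:
  assumes "F \<in> cochain n"
  shows "F \<in> borel_measurable (SEQ \<Otimes>\<^sub>M \<mu>)" "\<exists>B. \<forall>p. \<bar>F p\<bar> \<le> B"
    "(\<And>i. i < n \<Longrightarrow> u i = v i) \<Longrightarrow> F (u, x) = F (v, x)"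
    "x \<in> space \<mu> \<Longrightarrow> F (\<lambda>i. a + u i, act a x) = F (u, x)"
    "x \<notin> space \<mu> \<Longrightarrow> F (u, x) = 0"
  using assms by (auto simp: cochain_def)

lemma cochainI:
  assumes "F \<in> borel_measurable (SEQ \<Otimes>\<^sub>M \<mu>)" "\<And>p. \<bar>F p\<bar> \<le> B"
    "\<And>u v x. (\<And>i. i < n \<Longrightarrow> u i = v i) \<Longrightarrow> F (u, x) = F (v, x)"
    "\<And>a u x. x \<in> space \<mu> \<Longrightarrow> F (\<lambda>i. a + u i, act a x) = F (u, x)"
    "\<And>u x. x \<notin> space \<mu> \<Longrightarrow> F (u, x) = 0"
  shows "F \<in> cochain n"
  unfolding cochain_def using assms by blast

lemma cochain_section: "F \<in> cochain n \<Longrightarrow> (\<lambda>u. F (u, x)) \<in> seq_bounded borel"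
proof (cases "x \<in> space \<mu>")
  case True
  assume F: "F \<in> cochain n"
  have "(\<lambda>u. F (u, x)) \<in> borel_measurable SEQ"
    using measurable_compose[OF measurable_Pair2'[OF True] cochainD(1)[OF F]] .
  thus ?thesis using cochainD(2)[OF F] by (auto simp: seq_bounded_def)
next
  case False
  moreover assume "F \<in> cochain n"
  ultimately have "(\<lambda>u. F (u, x)) = (\<lambda>_. 0)" using cochainD(5) by auto
  thus ?thesis by (auto simp: seq_bounded_def)
qed

lemma cochain_zero: "(\<lambda>_. 0) \<in> cochain n"
  by (auto simp: cochain_def)

lemma cochain_add: "F \<in> cochain n \<Longrightarrow> G \<in> cochain n \<Longrightarrow> (\<lambda>p. F p + G p) \<in> cochain n"
proof -
  assume F: "F \<in> cochain n" and G: "G \<in> cochain n"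
  obtain B C where "\<forall>p. \<bar>F p\<bar> \<le> B" "\<forall>p. \<bar>G p\<bar> \<le> C" using cochainD(2)[OF F] cochainD(2)[OF G] by auto
  hence "\<bar>F p + G p\<bar> \<le> B + C" for p by (meson abs_triangle_ineq add_mono order_trans)
  thus ?thesis
  proof (rule cochainI[rotated])
    show "F (u, x) + G (u, x) = F (v, x) + G (v, x)" if "\<And>i. i < n \<Longrightarrow> u i = v i" for u v x
      using cochainD(3)[OF F that] cochainD(3)[OF G that] by simp
    show "(\<lambda>p. F p + G p) \<in> borel_measurable (SEQ \<Otimes>\<^sub>M \<mu>)"
      using cochainD(1)[OF F] cochainD(1)[OF G] by simp
  qed (simp_all add: cochainD(4,5)[OF F] cochainD(4,5)[OF G])
qed

lemma cochain_scale: "F \<in> cochain n \<Longrightarrow> (\<lambda>p. c * F p) \<in> cochain n"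
proof -
  assume F: "F \<in> cochain n"
  obtain B where "\<And>p. \<bar>F p\<bar> \<le> B" using cochainD(2)[OF F] by blast
  hence "\<bar>c * F p\<bar> \<le> \<bar>c\<bar> * B" for p by (simp add: abs_mult mult_left_mono)
  thus ?thesis
  proof (rule cochainI[rotated])
    show "c * F (u, x) = c * F (v, x)" if "\<And>i. i < n \<Longrightarrow> u i = v i" for u v x
      using cochainD(3)[OF F that] by simp
    show "(\<lambda>p. c * F p) \<in> borel_measurable (SEQ \<Otimes>\<^sub>M \<mu>)" using cochainD(1)[OF F] by simp
  qed (simp_all add: cochainD(4,5)[OF F])
qed

lemma cochain_sum:
  "finite I \<Longrightarrow> (\<And>i. i \<in> I \<Longrightarrow> F i \<in> cochain n) \<Longrightarrow> (\<lambda>p. \<Sum>i\<in>I. c i * F i p) \<in> cochain n"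
proof (induction I rule: finite_induct)
  case (insert i I)
  thus ?case using cochain_add[OF cochain_scale[of "F i" n "c i"], of "\<lambda>p. \<Sum>i\<in>I. c i * F i p"] by simp
qed (simp add: cochain_zero)

lemma cochain_reindex:
  assumes F: "F \<in> cochain n" and r: "\<And>i. i < n \<Longrightarrow> r i < n'"
  shows "(\<lambda>(u, x). F (\<lambda>i. u (r i), x)) \<in> cochain n'"
proof -
  have "(\<lambda>(u, x). (\<lambda>i. u (r i), x)) \<in> measurable (SEQ \<Otimes>\<^sub>M \<mu>) (SEQ \<Otimes>\<^sub>M \<mu>)"
    unfolding split_beta' by (intro measurable_Pair measurable_PiM_single') auto
  from measurable_compose[OF this cochainD(1)[OF F]]
  have "(\<lambda>(u, x). F (\<lambda>i. u (r i), x)) \<in> borel_measurable (SEQ \<Otimes>\<^sub>M \<mu>)" by (simp add: split_beta')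
  moreover obtain B where "\<And>p. \<bar>F p\<bar> \<le> B" using cochainD(2)[OF F] by blast
  hence "\<bar>(\<lambda>(u, x). F (\<lambda>i. u (r i), x)) p\<bar> \<le> B" for p by (simp add: split_beta')
  ultimately show ?thesis
  proof (rule cochainI)
    show "(\<lambda>(u, x). F (\<lambda>i. u (r i), x)) (u, x) = (\<lambda>(u, x). F (\<lambda>i. u (r i), x)) (v, x)"
      if "\<And>i. i < n' \<Longrightarrow> u i = v i" for u v x
      unfolding prod.case using that r by (intro cochainD(3)[OF F]) simp
  qed (simp_all add: cochainD(4,5)[OF F])
qed

lemma face_reindex: "face j u = (\<lambda>i. u (if i < j then i else Suc i))"
  and dup_reindex: "dup j u = (\<lambda>i. u (if i \<le> j then i else i - 1))"
  by (simp_all add: face_def dup_def)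

lemma cochain_face: "F \<in> cochain n \<Longrightarrow> (\<lambda>(u, x). F (face j u, x)) \<in> cochain (Suc n)"
  unfolding face_reindex by (rule cochain_reindex) auto

lemma cochain_dup: "F \<in> cochain (Suc n) \<Longrightarrow> j < n \<Longrightarrow> (\<lambda>(u, x). F (dup j u, x)) \<in> cochain n"
  unfolding dup_reindex by (rule cochain_reindex) auto

text \<open>Invariance survives because \<open>act (- (a + u l)) (act a x) = act (- u l) x\<close>:
  both sides integrate against the same measure, and the shifted integrands agree by invariance of
  \<open>F\<close>.\<close>

lemma cochain_avg:
  assumes \<rho>: "\<rho> \<in> measurable \<mu> (prob_algebra borel)" and F: "F \<in> cochain n" and l: "l < n"
  shows "(\<lambda>(u, x). avg (orbit_kernel \<rho> x) l (\<lambda>u. F (u, x)) u) \<in> cochain n"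
proof -
  obtain B where B: "\<And>p. \<bar>F p\<bar> \<le> B" using cochainD(2)[OF F] by auto
  have Fm: "F \<in> borel_measurable (SEQ \<Otimes>\<^sub>M \<mu>)" by (rule cochainD(1)[OF F])
  have sec: "(\<lambda>u. F (u, x)) \<in> borel_measurable SEQ" for x
    using cochain_section[OF F] by (simp add: seq_bounded_def)
  note eq = avg_kernel[OF \<rho> sec]
  have meas: "(\<lambda>(u, x). avg (orbit_kernel \<rho> x) l (\<lambda>u. F (u, x)) u) \<in> borel_measurable (SEQ \<Otimes>\<^sub>M \<mu>)"
  proof -
    have "(\<lambda>q. ((fst (fst q))(l := fst (fst q) l + snd q), snd (fst q))) \<in> measurable ((SEQ \<Otimes>\<^sub>M \<mu>) \<Otimes>\<^sub>M borel) (SEQ \<Otimes>\<^sub>M \<mu>)"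
    proof (intro measurable_Pair measurable_PiM_single')
      fix i :: nat
      show "(\<lambda>q. ((fst (fst q))(l := fst (fst q) l + snd q)) i) \<in> measurable ((SEQ \<Otimes>\<^sub>M \<mu>) \<Otimes>\<^sub>M borel) borel"
        by (cases "i = l") auto
    qed auto
    from measurable_compose[OF this Fm]
    have 1: "(\<lambda>(p, k). ennreal (F ((fst p)(l := fst p l + k), snd p) + B)) \<in> borel_measurable ((SEQ \<Otimes>\<^sub>M \<mu>) \<Otimes>\<^sub>M borel)"
      unfolding split_beta' by simp
    have "(\<lambda>p. \<rho> (act (- fst p l) (snd p))) \<in> measurable (SEQ \<Otimes>\<^sub>M \<mu>) (prob_algebra borel)"
      by (rule measurable_compose[OF _ \<rho>]) (intro act_measurable borel_measurable_uminus_group, simp_all)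
    hence 2: "(\<lambda>p. \<rho> (act (- fst p l) (snd p))) \<in> measurable (SEQ \<Otimes>\<^sub>M \<mu>) (subprob_algebra borel)"
      by (rule measurable_prob_algebraD)
    have "(\<lambda>p. enn2real (\<integral>\<^sup>+k. ennreal (F ((fst p)(l := fst p l + k), snd p) + B) \<partial>\<rho> (act (- fst p l) (snd p))) - B)
      \<in> borel_measurable (SEQ \<Otimes>\<^sub>M \<mu>)"
      using nn_integral_measurable_subprob_algebra2[OF 1 2] by simp
    also have "?this \<longleftrightarrow> ?thesis"
    proof (intro measurable_cong)
      fix p assume "p \<in> space (SEQ \<Otimes>\<^sub>M \<mu>)"
      then obtain u x where p: "p = (u, x)" and x: "x \<in> space \<mu>" by (auto simp: space_pair_measure)
      interpret R: prob_space "\<rho> (act (- u l) x)" by (rule rho_prob[OF \<rho> act_space[OF x]])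
      have "(\<lambda>k. u(l := u l + k)) \<in> measurable borel SEQ"
        by (rule measurable_compose[OF _ upd_SEQ]) simp
      from measurable_compose[OF this sec[of x]]
      have "(\<lambda>k. F (u(l := u l + k), x)) \<in> borel_measurable (\<rho> (act (- u l) x))"
        by (simp cong: measurable_cong_sets add: rho_sets[OF \<rho> act_space[OF x]])
      hence int: "integrable (\<rho> (act (- u l) x)) (\<lambda>k. F (u(l := u l + k), x))"
        by (intro R.integrable_const_bound[where B=B]) (auto simp: B)
      have "0 \<le> F q + B" for q using B[of q] by linarith
      hence "enn2real (\<integral>\<^sup>+k. ennreal (F (u(l := u l + k), x) + B) \<partial>\<rho> (act (- u l) x)) =
         (\<integral>k. F (u(l := u l + k), x) + B \<partial>\<rho> (act (- u l) x))"
        using int by (subst integral_eq_nn_integral) auto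
      thus "enn2real (\<integral>\<^sup>+k. ennreal (F ((fst p)(l := fst p l + k), snd p) + B) \<partial>\<rho> (act (- fst p l) (snd p))) - B =
          (case p of (u, x) \<Rightarrow> avg (orbit_kernel \<rho> x) l (\<lambda>u. F (u, x)) u)"
        using int by (simp add: p eq[OF x] R.prob_space)
    qed
    finally show ?thesis .
  qed
  have bdd: "\<bar>avg (orbit_kernel \<rho> x) l (\<lambda>u. F (u, x)) u\<bar> \<le> B" for u x
    by (rule averaging.avg_bounded[OF kernel_averaging[OF \<rho>]]) (rule B)
  have dep: "avg (orbit_kernel \<rho> x) l (\<lambda>u. F (u, x)) u = avg (orbit_kernel \<rho> x) l (\<lambda>u. F (u, x)) v"
    if uv: "\<And>i. i < n \<Longrightarrow> u i = v i" for u v x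
  proof -
    have "F (u(l := k), x) = F (v(l := k), x)" for k using uv by (intro cochainD(3)[OF F]) simp
    thus ?thesis using uv l by (simp add: avg_def)
  qed
  have inv: "avg (orbit_kernel \<rho> (act a x)) l (\<lambda>u. F (u, act a x)) (\<lambda>i. a + u i) = avg (orbit_kernel \<rho> x) l (\<lambda>u. F (u, x)) u"
    if x: "x \<in> space \<mu>" for a u x
  proof -
    have 1: "act (- (a + u l)) (act a x) = act (- u l) x"
      using x by (simp add: minus_add act_space flip: act_add) 
    have 2: "F ((\<lambda>i. a + u i)(l := a + u l + k), act a x) = F (u(l := u l + k), x)" for k
    proof -
      have "(\<lambda>i. a + u i)(l := a + u l + k) = (\<lambda>i. a + (u(l := u l + k)) i)" by (auto simp: add.assoc)
      thus ?thesis using cochainD(4)[OF F x, of a "u(l := u l + k)"] by simp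
    qed
    show ?thesis by (simp only: eq[OF act_space[OF x]] eq[OF x] 1 2)
  qed
  have zero: "avg (orbit_kernel \<rho> x) l (\<lambda>u. F (u, x)) u = 0" if "x \<notin> space \<mu>" for u x
    using cochainD(5)[OF F that] by (simp add: avg_def)
  show ?thesis
    by (rule cochainI[OF meas, where B=B]) (simp_all only: prod.case inv, use bdd in \<open>simp add: split_beta'\<close>, rule dep, simp, rule zero)
qed

lemma cochain_avgs:
  assumes \<rho>: "\<rho> \<in> measurable \<mu> (prob_algebra borel)" and F: "F \<in> cochain n"
  shows "j + d \<le> n \<Longrightarrow> (\<lambda>(u, x). avgs (orbit_kernel \<rho> x) j d (\<lambda>u. F (u, x)) u) \<in> cochain n"
proof (induction d arbitrary: j)
  case 0 thus ?case using F by simp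
next
  case (Suc d)
  have "(\<lambda>(u, x). avgs (orbit_kernel \<rho> x) (Suc j) d (\<lambda>u. F (u, x)) u) \<in> cochain n" using Suc by simp
  from cochain_avg[OF \<rho> this, of j] Suc.prems show ?case by simp
qed

lemma cochain_prism:
  assumes \<rho>: "\<rho> \<in> measurable \<mu> (prob_algebra borel)" and F: "F \<in> cochain (Suc n)"
  shows "(\<lambda>(u, x). prism (orbit_kernel \<rho> x) n (\<lambda>u. F (u, x)) u) \<in> cochain n"
proof -
  have "(\<lambda>(u, x). avgs (orbit_kernel \<rho> x) (Suc j) (n - j) (\<lambda>u. F (u, x)) (dup j u)) \<in> cochain n" if "j < n" for j
    using cochain_dup[OF cochain_avgs[OF \<rho> F, of "Suc j" "n - j"], of j] that by simp
  hence "(\<lambda>p. \<Sum>j\<in>{..<n}. (- 1) ^ j * (\<lambda>(u, x). avgs (orbit_kernel \<rho> x) (Suc j) (n - j) (\<lambda>u. F (u, x)) (dup j u)) p) \<in> cochain n"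
    by (intro cochain_sum) auto
  thus ?thesis by (simp add: prism_def split_beta')
qed

lemma cochain_coface:
  assumes F: "F \<in> cochain n"
  shows "(\<lambda>(u, x). coface k (\<lambda>u. F (u, x)) u) \<in> cochain (Suc n)"
proof -
  have "(\<lambda>p. \<Sum>j\<in>{..k}. (- 1) ^ j * (\<lambda>(u, x). F (face j u, x)) p) \<in> cochain (Suc n)"
    using cochain_face[OF F] by (intro cochain_sum) auto
  thus ?thesis by (simp add: coface_def split_beta')
qed

end

section \<open>The groupoid of a transverse system\<close>

locale transverse_regular = transverse_exhaustion m \<mu> act Y \<nu> L
  for m :: "'g::{topological_group_add, t2_space, second_countable_topology} measure"
    and \<mu> :: "'x measure" and act :: "'g \<Rightarrow> 'x \<Rightarrow> 'x" and Y :: "'x set" and \<nu> :: "'x measure"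
    and L :: "nat \<Rightarrow> 'g set" +
  fixes X0 :: "'x set"
  assumes X0_sets[measurable]: "X0 \<in> sets \<mu>"
    and X0_inv: "x \<in> space \<mu> \<Longrightarrow> act a x \<in> X0 \<longleftrightarrow> x \<in> X0"
    and X0_AE: "AE x in \<mu>. x \<in> X0"
    and X0_cnt: "A \<in> sets borel \<Longrightarrow> (\<lambda>x. cnt ((if x \<in> X0 then H x \<inter> L n else {}) \<inter> A)) \<in> borel_measurable \<mu>"
begin

text \<open>Emptied off \<open>X0\<close>, so that its counting functions are Borel on all of
  \<open>X\<close> and not merely almost everywhere equal to Borel functions.\<close>

definition K :: "nat \<Rightarrow> 'x \<Rightarrow> 'g set" where
  "K n x = (if x \<in> X0 then H x \<inter> L n else {})"

lemma K_meas[measurable]: "A \<in> sets borel \<Longrightarrow> (\<lambda>x. cnt (K n x \<inter> A)) \<in> borel_measurable \<mu>"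
  unfolding K_def by (rule X0_cnt)

lemma K_meas_all[measurable]: "(\<lambda>x. cnt (K n x)) \<in> borel_measurable \<mu>"
  using K_meas[of UNIV n] by simp

lemma K_finite: "x \<in> space \<mu> \<Longrightarrow> finite (K n x)"
  using finite_HL by (auto simp: K_def)

lemma cnt_eq_0_iff: "cnt S = 0 \<longleftrightarrow> S = {}"
  by (cases "finite S") (auto simp: emeasure_count_space)

lemma K_mono: "i \<le> j \<Longrightarrow> K i x \<subseteq> K j x"
  using L_inc by (auto simp: K_def incseq_def)

lemma K_UN: "x \<in> X0 \<Longrightarrow> (\<Union>n. K n x) = H x"
  using L_UN by (auto simp: K_def)

lemma K_ex: "x \<in> X0 \<Longrightarrow> \<exists>n. K n x \<noteq> {}"
proof -
  assume x: "x \<in> X0"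
  then obtain g where "act g x \<in> Y" using Y_hit[of x] sets.sets_into_space[OF X0_sets] by blast
  hence "g \<in> H x" by (simp add: H_iff)
  thus ?thesis using K_UN[OF x] by blast
qed

lemma nu_sets: "sets \<nu> = sets (restrict_space \<mu> Y)"
  using tm by (simp add: transverse_measure_def)

lemma nu_space: "space \<nu> = Y"
  using sets_eq_imp_space_eq[OF nu_sets] Y_space by (auto simp: space_restrict_space)

lemma measurable_nuD: "f \<in> measurable \<mu> N \<Longrightarrow> f \<in> measurable \<nu> N"
  by (subst measurable_cong_sets[OF nu_sets refl]) (rule measurable_restrict_space1)

lemma measurable_into_nu:
  "f \<in> measurable N \<mu> \<Longrightarrow> (\<And>z. z \<in> space N \<Longrightarrow> f z \<in> Y) \<Longrightarrow> f \<in> measurable N \<nu>"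
  by (subst measurable_cong_sets[OF refl nu_sets]) (auto intro: measurable_restrict_space2)

lemma transverse_formula:
  assumes "f \<in> borel_measurable \<nu>" "w \<in> borel_measurable borel" "(\<integral>\<^sup>+ g. w g \<partial>m) = 1"
  shows "(\<integral>\<^sup>+ y. f y \<partial>\<nu>) = (\<integral>\<^sup>+ x. (\<integral>\<^sup>+ g. f (act g x) * w g \<partial>count_space (H x)) \<partial>\<mu>)"
  by (rule tm[unfolded transverse_measure_def, THEN conjunct2, THEN conjunct2, rule_format, OF assms])

text \<open>The indicator of the complement of an invariant set is constant along orbits, so the
  inner sum in the formula for \<nu> factors into its value at \<open>x\<close> times the total
  weight of the hitting points. Every orbit meets \<open>Y\<close>, hence for almost every
  \<open>x\<close> some \<open>L n\<close> gives positive weight, and the two integrals can only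
  vanish together.\<close>

lemma null_transfer:
  assumes X1[measurable]: "X1 \<in> sets \<mu>" and inv: "\<And>a x. x \<in> space \<mu> \<Longrightarrow> act a x \<in> X1 \<longleftrightarrow> x \<in> X1"
  shows "(AE y in \<nu>. y \<in> X1) \<longleftrightarrow> (AE x in \<mu>. x \<in> X1)"
proof -
  define f :: "'x \<Rightarrow> ennreal" where "f = indicator (space \<mu> - X1)"
  define w :: "nat \<Rightarrow> 'g \<Rightarrow> ennreal" where "w n g = indicator (L n) g / emeasure m (L n)" for n g
  have f_mu: "f \<in> borel_measurable \<mu>" unfolding f_def by measurable
  hence f_nu: "f \<in> borel_measurable \<nu>" by (rule measurable_nuD)
  have fin: "emeasure m (L n) < top" for n
    using haar L_compact[of n] by (auto simp: haar_measure_def)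
  have w: "w n \<in> borel_measurable borel" for n unfolding w_def by measurable
  have w1: "(\<integral>\<^sup>+ g. w n g \<partial>m) = 1" for n
  proof -
    have "L n \<in> sets m" by (simp add: sets_m)
    thus ?thesis unfolding w_def using fin[of n] L_pos[of n] by (subst nn_integral_divide) auto
  qed
  have formula: "(\<integral>\<^sup>+ y. f y \<partial>\<nu>) = (\<integral>\<^sup>+ x. (\<integral>\<^sup>+ g. f (act g x) * w n g \<partial>count_space (H x)) \<partial>\<mu>)" for n
    by (rule transverse_formula[OF f_nu w w1])
  have f_act: "f (act g x) = f x" if "x \<in> space \<mu>" for g x
    using inv[OF that] that act_space[OF that] by (simp add: f_def indicator_def)
  have inner: "(\<integral>\<^sup>+ g. f (act g x) * w n g \<partial>count_space (H x)) = f x * (\<integral>\<^sup>+ g. w n g \<partial>count_space (H x))"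
    if "x \<in> space \<mu>" for x n
    using that by (simp add: f_act nn_integral_cmult)
  have nu_iff: "(AE y in \<nu>. y \<in> X1) \<longleftrightarrow> (\<integral>\<^sup>+ y. f y \<partial>\<nu>) = 0"
    unfolding nn_integral_0_iff_AE[OF f_nu]
    by (intro AE_cong) (auto simp: f_def indicator_def nu_space Y_space)
  show ?thesis
  proof
    assume "AE x in \<mu>. x \<in> X1"
    hence "AE x in \<mu>. (\<integral>\<^sup>+ g. f (act g x) * w 0 g \<partial>count_space (H x)) = 0"
    proof (rule AE_mp, intro AE_I2 impI)
      fix x assume x: "x \<in> space \<mu>" "x \<in> X1"
      hence "f x = 0" by (simp add: f_def)
      thus "(\<integral>\<^sup>+ g. f (act g x) * w 0 g \<partial>count_space (H x)) = 0" by (simp add: inner[OF x(1)])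
    qed
    hence "(\<integral>\<^sup>+ x. (\<integral>\<^sup>+ g. f (act g x) * w 0 g \<partial>count_space (H x)) \<partial>\<mu>) = (\<integral>\<^sup>+ x. 0 \<partial>\<mu>)"
      by (rule nn_integral_cong_AE)
    thus "AE y in \<nu>. y \<in> X1" using nu_iff formula[of 0] by simp
  next
    assume "AE y in \<nu>. y \<in> X1"
    hence 0: "(\<integral>\<^sup>+ x. (\<integral>\<^sup>+ g. f (act g x) * w n g \<partial>count_space (H x)) \<partial>\<mu>) = 0" for n
      using nu_iff formula[of n] by simp
    have "AE x in \<mu>. f x * cnt (K n x) / emeasure m (L n) = 0" for n
    proof -
      \<comment> \<open>The sum over \<open>H x\<close> is not known to be measurable in
        \<open>x\<close>. It dominates a multiple of the count of \<open>K n x\<close>, which is,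
        and a vanishing integral of the latter does force a vanishing integrand.\<close>
      have le: "f x * cnt (K n x) / emeasure m (L n) \<le> (\<integral>\<^sup>+ g. f (act g x) * w n g \<partial>count_space (H x))"
        if x: "x \<in> space \<mu>" for x
      proof (cases "x \<in> X0")
        case True
        have "(\<integral>\<^sup>+ g. w n g \<partial>count_space (H x)) = (\<integral>\<^sup>+ g. indicator (H x \<inter> L n) g \<partial>count_space (H x)) / emeasure m (L n)"
          unfolding w_def by (subst nn_integral_divide[symmetric]) (auto intro!: nn_integral_cong simp: indicator_def)
        also have "(\<integral>\<^sup>+ g. indicator (H x \<inter> L n) g \<partial>count_space (H x)) = cnt (K n x)"
          using finite_HL(1)[OF x, of n] True by (subst nn_integral_indicator) (auto simp: K_def emeasure_count_space)
        finally show ?thesis by (simp add: inner[OF x] ennreal_times_divide)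
      qed (simp add: K_def)
      have "(\<integral>\<^sup>+ x. f x * cnt (K n x) / emeasure m (L n) \<partial>\<mu>) \<le> 0"
        unfolding 0[of n, symmetric] by (intro nn_integral_mono le)
      hence "(\<integral>\<^sup>+ x. f x * cnt (K n x) / emeasure m (L n) \<partial>\<mu>) = 0" by simp
      thus ?thesis using f_mu by (subst (asm) nn_integral_0_iff_AE) auto
    qed
    hence "AE x in \<mu>. \<forall>n. f x * cnt (K n x) / emeasure m (L n) = 0" unfolding AE_all_countable by blast
    thus "AE x in \<mu>. x \<in> X1" using X0_AE AE_space
    proof eventually_elim
      case (elim x)
      obtain n where n: "K n x \<noteq> {}" using K_ex[OF elim(2)] by blast
      have "f x * cnt (K n x) / emeasure m (L n) = 0" using elim(1) by blast
      hence "f x = 0" using n fin[of n] by (auto simp: cnt_eq_0_iff)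
      thus ?case using elim by (simp add: f_def indicator_def split: if_splits)
    qed
  qed
qed

lemma X0_AE_nu: "AE y in \<nu>. y \<in> X0"
  using null_transfer[OF X0_sets X0_inv] X0_AE by simp

section \<open>Target fibres and the measure on their powers\<close>

abbreviation GG where "GG \<equiv> transverse_groupoid act Y \<nu>"

lemma GG_simps: "units GG = \<nu>" "tgt GG (g, y) = act g y"
  "arrows GG = restrict_space (borel \<Otimes>\<^sub>M \<nu>) {(g, y). y \<in> Y \<and> act g y \<in> Y}"
  "gcomp GG (g, y') (h, y) = (g + h, y)" "ginv GG (g, y) = (- g, act g y)"
  by (simp_all add: transverse_groupoid_def)

lemma arrows_space: "space (arrows GG) = {(g, y). y \<in> Y \<and> act g y \<in> Y}"
  by (auto simp: GG_simps space_restrict_space space_pair_measure nu_space)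

text \<open>The arrow into \<open>y\<close> that undoes \<open>h\<close>. Its group component is
  \<open>- h\<close>, so as \<open>h\<close> runs through the hitting set of \<open>y\<close> these
  components run through the set of inverses.\<close>

definition arr :: "'x \<Rightarrow> 'g \<Rightarrow> 'g \<times> 'x" where "arr y h = (- h, act h y)"

lemma tgt_arr: "y \<in> space \<mu> \<Longrightarrow> tgt GG (arr y h) = y"
  by (simp add: arr_def GG_simps act_minus)

lemma arr_inj: "inj (arr y)"
  by (auto simp: arr_def inj_def)

lemma tgt_fiber_eq: "y \<in> Y \<Longrightarrow> tgt_fiber GG y = arr y ` H y"
proof (intro set_eqI iffI)
  fix \<gamma> assume y: "y \<in> Y" and "\<gamma> \<in> tgt_fiber GG y"
  then obtain g y' where \<gamma>: "\<gamma> = (g, y')" "y' \<in> Y" "act g y' = y" 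
    by (cases \<gamma>) (auto simp: tgt_fiber_def arrows_space GG_simps(2))
  hence "act (- g) y = y'" using act_minus(1) Y_space by auto
  thus "\<gamma> \<in> arr y ` H y" using \<gamma> by (intro image_eqI[of _ _ "- g"]) (auto simp: arr_def H_iff)
next
  fix \<gamma> assume y: "y \<in> Y" and "\<gamma> \<in> arr y ` H y"
  then obtain h where h: "\<gamma> = arr y h" "act h y \<in> Y" by (auto simp: H_iff)
  thus "\<gamma> \<in> tgt_fiber GG y" using y act_minus(1)[OF Y_space[OF y]]
    by (auto simp: tgt_fiber_def arrows_space tgt_arr Y_space) (auto simp: arr_def)
qed

abbreviation TUP :: "nat \<Rightarrow> (nat \<Rightarrow> 'g) measure" where "TUP n \<equiv> PiM {..<n} (\<lambda>_. borel)"

text \<open>Boxes generate the product algebra, and within a box the count of tuples is the product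
  of the counts of the entries; the Dynkin lemma does the rest.\<close>

lemma PiE_K_meas:
  assumes "B \<in> sets (TUP n)"
  shows "(\<lambda>x. cnt (PiE {..<n} (\<lambda>_. K j x) \<inter> B)) \<in> borel_measurable \<mu>"
proof (rule cnt_measurable_generator[OF _ _ _ _ _ _ _ assms, where \<G>="{PiE {..<n} E | E. \<forall>i\<in>{..<n}. E i \<in> sets (borel :: 'g measure)}"])
  have "{(\<Pi>\<^sub>E i\<in>{..<n}. X i) |X. X \<in> (\<Pi> j\<in>{..<n}. sets (borel :: 'g measure))} = {PiE {..<n} E | E. \<forall>i\<in>{..<n}. E i \<in> sets (borel :: 'g measure)}"
    by auto
  thus "sets (TUP n) = sigma_sets (space (TUP n)) {PiE {..<n} E | E. \<forall>i\<in>{..<n}. E i \<in> sets (borel :: 'g measure)}"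
    by (simp add: sets_PiM prod_algebra_eq_finite space_PiM)
  show "Int_stable {PiE {..<n} E | E. \<forall>i\<in>{..<n}. E i \<in> sets (borel :: 'g measure)}"
    using Int_stable_PiE[of "{..<n}" "{..<n}" "\<lambda>_. borel :: 'g measure"] by simp
  show "{PiE {..<n} E | E. \<forall>i\<in>{..<n}. E i \<in> sets (borel :: 'g measure)} \<subseteq> Pow (space (TUP n))"
    by (auto simp: space_PiM PiE_def)
  show "finite (PiE {..<n} (\<lambda>_. K j x))" if "x \<in> space \<mu>" for x
    using K_finite[OF that] by (intro finite_PiE) auto
  show "PiE {..<n} (\<lambda>_. K j x) \<subseteq> space (TUP n)" for x by (auto simp: space_PiM PiE_def)
  have gen: "(\<lambda>x. cnt (PiE {..<n} (\<lambda>_. K j x) \<inter> PiE {..<n} E)) \<in> borel_measurable \<mu>"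
    if E: "\<forall>i\<in>{..<n}. E i \<in> sets (borel :: 'g measure)" for E
  proof -
    have "(\<lambda>x. \<Prod>i\<in>{..<n}. cnt (K j x \<inter> E i)) \<in> borel_measurable \<mu>"
      using E by (intro borel_measurable_prod_ennreal K_meas) auto
    also have "?this \<longleftrightarrow> ?thesis"
    proof (intro measurable_cong)
      fix x assume x: "x \<in> space \<mu>"
      have "finite (K j x \<inter> E i)" for i using K_finite[OF x] by auto
      moreover from this have "finite (PiE {..<n} (\<lambda>i. K j x \<inter> E i))" by (intro finite_PiE) auto
      ultimately show "(\<Prod>i\<in>{..<n}. cnt (K j x \<inter> E i)) = cnt (PiE {..<n} (\<lambda>_. K j x) \<inter> PiE {..<n} E)"
        by (simp add: PiE_Int emeasure_count_space card_PiE)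
    qed
    finally show ?thesis .
  qed
  thus "(\<lambda>x. cnt (PiE {..<n} (\<lambda>_. K j x) \<inter> A)) \<in> borel_measurable \<mu>"
    if "A \<in> {PiE {..<n} E | E. \<forall>i\<in>{..<n}. E i \<in> sets (borel :: 'g measure)}" for A
    using that by auto
  have "PiE {..<n} (\<lambda>_. K j x) \<inter> PiE {..<n} (\<lambda>_. UNIV) = PiE {..<n} (\<lambda>_. K j x)" for x by (simp add: PiE_Int)
  thus "(\<lambda>x. cnt (PiE {..<n} (\<lambda>_. K j x))) \<in> borel_measurable \<mu>"
    using gen[of "\<lambda>_. UNIV"] by simp
qed

definition tup :: "nat \<Rightarrow> 'x \<Rightarrow> (nat \<Rightarrow> 'g) \<Rightarrow> nat \<Rightarrow> 'g \<times> 'x" where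
  "tup n y u = (\<lambda>i\<in>{..<n}. arr y (u i))"

abbreviation fib where "fib n y \<equiv> PiE {..<n} (\<lambda>_. tgt_fiber GG y)"

lemma fib_eq: "y \<in> Y \<Longrightarrow> fib n y = tup n y ` PiE {..<n} (\<lambda>_. H y)"
proof (intro set_eqI iffI)
  fix \<gamma> assume y: "y \<in> Y" and \<gamma>: "\<gamma> \<in> fib n y"
  have "\<forall>i\<in>{..<n}. \<exists>h. h \<in> H y \<and> \<gamma> i = arr y h" using \<gamma> tgt_fiber_eq[OF y] by (auto simp: PiE_iff)
  from bchoice[OF this] obtain h where h: "\<And>i. i < n \<Longrightarrow> h i \<in> H y \<and> \<gamma> i = arr y (h i)" by auto
  have "\<gamma> = tup n y (restrict h {..<n})"
    using h \<gamma> by (auto simp: tup_def fun_eq_iff PiE_iff extensional_def)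
  moreover have "restrict h {..<n} \<in> PiE {..<n} (\<lambda>_. H y)" using h by auto
  ultimately show "\<gamma> \<in> tup n y ` PiE {..<n} (\<lambda>_. H y)" by blast
qed (auto simp: tup_def tgt_fiber_eq)

lemma tup_inj: "inj_on (tup n y) (PiE {..<n} (\<lambda>_. S))"
proof (rule inj_onI)
  fix u v assume uv: "u \<in> PiE {..<n} (\<lambda>_. S)" "v \<in> PiE {..<n} (\<lambda>_. S)" "tup n y u = tup n y v"
  have "u i = v i" if "i \<in> {..<n}" for i
    using fun_cong[OF uv(3), of i] that injD[OF arr_inj] by (auto simp: tup_def)
  thus "u = v" by (rule PiE_ext[OF uv(1,2)])
qed

abbreviation FPS where "FPS n \<equiv> fiber_power_space GG n"

lemma FPS_space: "space (FPS n) = {\<gamma> \<in> PiE {..<n} (\<lambda>_. space (arrows GG)). \<forall>i<n. \<forall>j<n. tgt GG (\<gamma> i) = tgt GG (\<gamma> j)}"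
  by (auto simp: fiber_power_space_def space_restrict_space space_PiM)

lemma fib_space: "y \<in> Y \<Longrightarrow> \<gamma> \<in> fib n y \<Longrightarrow> \<gamma> \<in> space (FPS n)"
  by (auto simp: FPS_space tgt_fiber_def PiE_iff)

lemma measurable_into_arrows:
  assumes a: "a \<in> measurable N borel" and b: "b \<in> measurable N \<mu>"
    and Yb: "\<And>z. z \<in> space N \<Longrightarrow> b z \<in> Y" "\<And>z. z \<in> space N \<Longrightarrow> act (a z) (b z) \<in> Y"
  shows "(\<lambda>z. (a z, b z)) \<in> measurable N (arrows GG)"
  unfolding GG_simps
  by (rule measurable_restrict_space2) (use Yb a measurable_into_nu[OF b] in auto)

lemma measurable_into_FPS:
  assumes a: "\<And>i. i < n \<Longrightarrow> a i \<in> measurable N borel" and b: "\<And>i. i < n \<Longrightarrow> b i \<in> measurable N \<mu>"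
    and Yb: "\<And>i z. i < n \<Longrightarrow> z \<in> space N \<Longrightarrow> b i z \<in> Y" "\<And>i z. i < n \<Longrightarrow> z \<in> space N \<Longrightarrow> act (a i z) (b i z) = c z"
      "\<And>z. z \<in> space N \<Longrightarrow> 0 < n \<Longrightarrow> c z \<in> Y"
  shows "(\<lambda>z. \<lambda>i\<in>{..<n}. (a i z, b i z)) \<in> measurable N (FPS n)"
  unfolding fiber_power_space_def
proof (rule measurable_restrict_space2)
  show "(\<lambda>z. \<lambda>i\<in>{..<n}. (a i z, b i z)) \<in> space N \<rightarrow> {\<gamma>. \<forall>i<n. \<forall>j<n. tgt GG (\<gamma> i) = tgt GG (\<gamma> j)}"
    using Yb by (auto simp: GG_simps)
  show "(\<lambda>z. \<lambda>i\<in>{..<n}. (a i z, b i z)) \<in> measurable N (PiM {..<n} (\<lambda>_. arrows GG))"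
  proof (rule measurable_restrict)
    fix i assume "i \<in> {..<n}"
    hence "i < n" "0 < n" by auto
    thus "(\<lambda>z. (a i z, b i z)) \<in> measurable N (arrows GG)"
      using Yb by (intro measurable_into_arrows a b) auto
  qed
qed

text \<open>\<open>tup\<close> yields arrows of the groupoid only where all points
  \<open>act (u i) y\<close> lie in \<open>Y\<close>. Measurability is therefore shown on this
  measurable subset \<open>R\<close> and then transferred to the product.\<close>

lemma tup_preimage_sets:
  assumes A: "A \<in> sets (FPS n)"
  shows "{(y, u) \<in> space (\<nu> \<Otimes>\<^sub>M TUP n). (\<forall>i<n. act (u i) y \<in> Y) \<and> tup n y u \<in> A} \<in> sets (\<nu> \<Otimes>\<^sub>M TUP n)"
proof -
  define R where "R = {p \<in> space (\<nu> \<Otimes>\<^sub>M TUP n). \<forall>i\<in>{..<n}. act (snd p i) (fst p) \<in> Y}"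
  have fst_mu: "fst \<in> measurable (\<nu> \<Otimes>\<^sub>M TUP n) \<mu>"
    by (rule measurable_compose[OF measurable_fst measurable_nuD]) simp
  have act_i: "(\<lambda>p. act (snd p i) (fst p)) \<in> measurable (\<nu> \<Otimes>\<^sub>M TUP n) \<mu>" if "i < n" for i
    by (rule act_measurable[OF _ fst_mu]) (use that in simp)
  have "{p \<in> space (\<nu> \<Otimes>\<^sub>M TUP n). act (snd p i) (fst p) \<in> Y} \<in> sets (\<nu> \<Otimes>\<^sub>M TUP n)" if "i < n" for i
    using measurable_sets[OF act_i[OF that] Y_sets] by (simp add: vimage_def Int_def conj_commute)
  hence R: "R \<in> sets (\<nu> \<Otimes>\<^sub>M TUP n)" unfolding R_def by (intro sets.sets_Collect_finite_All) auto
  have "(\<lambda>p. \<lambda>i\<in>{..<n}. (- snd p i, act (snd p i) (fst p))) \<in> measurable (restrict_space (\<nu> \<Otimes>\<^sub>M TUP n) R) (FPS n)"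
  proof (rule measurable_into_FPS[where c=fst])
    show "(\<lambda>p. - snd p i) \<in> measurable (restrict_space (\<nu> \<Otimes>\<^sub>M TUP n) R) borel" if "i < n" for i
      by (intro measurable_restrict_space1 borel_measurable_uminus_group) (use that in simp)
    show "(\<lambda>p. act (snd p i) (fst p)) \<in> measurable (restrict_space (\<nu> \<Otimes>\<^sub>M TUP n) R) \<mu>" if "i < n" for i
      by (intro measurable_restrict_space1 act_i that)
  qed (auto simp: space_restrict_space R_def space_pair_measure nu_space act_minus Y_space)
  from measurable_sets[OF this A] 
  have "(\<lambda>p. \<lambda>i\<in>{..<n}. (- snd p i, act (snd p i) (fst p))) -` A \<inter> R \<in> sets (\<nu> \<Otimes>\<^sub>M TUP n)"
    using R sets.sets_into_space[OF R] by (simp add: space_restrict_space sets_restrict_space_iff Int_absorb2 Int_absorb1)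
  also have "(\<lambda>p. \<lambda>i\<in>{..<n}. (- snd p i, act (snd p i) (fst p))) -` A \<inter> R =
    {(y, u) \<in> space (\<nu> \<Otimes>\<^sub>M TUP n). (\<forall>i<n. act (u i) y \<in> Y) \<and> tup n y u \<in> A}"
    by (auto simp: R_def tup_def arr_def)
  finally show ?thesis .
qed

text \<open>Over a point of \<open>X0\<close> the fibre power is the increasing union of the
  injective images of the finite boxes with sides \<open>K j y\<close>, whose counts are measurable.
  Off \<open>X0\<close> the boxes are emptied, hence the almost-everywhere formulation.\<close>

lemma fib_cnt_AE_measurable:
  assumes A: "A \<in> sets (FPS n)"
  shows "\<exists>f\<in>borel_measurable \<nu>. AE y in \<nu>. cnt (A \<inter> fib n y) = f y"
proof -
  define C where "C = {(y, u) \<in> space (\<nu> \<Otimes>\<^sub>M TUP n). (\<forall>i<n. act (u i) y \<in> Y) \<and> tup n y u \<in> A}"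
  define f where "f y = (SUP j. cnt {u \<in> PiE {..<n} (\<lambda>_. K j y). (y, u) \<in> C})" for y
  have "(\<lambda>y. cnt {u \<in> PiE {..<n} (\<lambda>_. K j y). (y, u) \<in> C}) \<in> borel_measurable \<nu>" for j
  proof (rule cnt_section_measurable[where N="TUP n"])
    show "C \<in> sets (\<nu> \<Otimes>\<^sub>M TUP n)" unfolding C_def by (rule tup_preimage_sets[OF A])
    show "finite (PiE {..<n} (\<lambda>_. K j y))" if "y \<in> space \<nu>" for y
      using K_finite that by (intro finite_PiE) (auto simp: nu_space Y_space)
    show "PiE {..<n} (\<lambda>_. K j y) \<subseteq> space (TUP n)" for y by (auto simp: space_PiM PiE_def)
  qed (intro measurable_nuD PiE_K_meas)
  hence "f \<in> borel_measurable \<nu>" unfolding f_def by (intro borel_measurable_SUP) auto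
  moreover have "AE y in \<nu>. cnt (A \<inter> fib n y) = f y"
    using X0_AE_nu AE_space
  proof eventually_elim
    case (elim y)
    hence y: "y \<in> Y" "y \<in> X0" by (auto simp: nu_space)
    let ?S = "\<lambda>j. {u \<in> PiE {..<n} (\<lambda>_. K j y). (y, u) \<in> C}"
    have UN: "(\<Union>j. ?S j) = {u \<in> PiE {..<n} (\<lambda>_. H y). tup n y u \<in> A}"
    proof (intro set_eqI iffI)
      fix u assume "u \<in> (\<Union>j. ?S j)"
      thus "u \<in> {u \<in> PiE {..<n} (\<lambda>_. H y). tup n y u \<in> A}" using y by (auto simp: C_def K_def PiE_iff)
    next
      fix u assume u: "u \<in> {u \<in> PiE {..<n} (\<lambda>_. H y). tup n y u \<in> A}"
      hence "\<forall>i\<in>{..<n}. \<exists>j. u i \<in> K j y" using K_UN[OF y(2)] by (auto simp: PiE_iff)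
      from bchoice[OF this] obtain j where j: "\<And>i. i < n \<Longrightarrow> u i \<in> K (j i) y" by auto
      \<comment> \<open>The sum serves as a common upper bound for the finitely many levels
        \<open>j i\<close>, also for \<open>n = 0\<close>.\<close>
      have "u i \<in> K (\<Sum>i<n. j i) y" if "i < n" for i
        using j[OF that] K_mono[of "j i" "\<Sum>i<n. j i" y] that by (auto intro!: member_le_sum)
      hence "u \<in> ?S (\<Sum>i<n. j i)" using u y
        by (auto simp: C_def space_pair_measure nu_space space_PiM PiE_iff H_iff)
      thus "u \<in> (\<Union>j. ?S j)" by blast
    qed
    have "incseq ?S" unfolding incseq_def using K_mono[of _ _ y] by (auto simp: PiE_iff)
    hence "f y = cnt (\<Union>j. ?S j)" unfolding f_def by (intro SUP_emeasure_incseq) auto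
    also have "\<dots> = cnt (tup n y ` {u \<in> PiE {..<n} (\<lambda>_. H y). tup n y u \<in> A})"
    proof -
      have "inj_on (tup n y) {u \<in> PiE {..<n} (\<lambda>_. H y). tup n y u \<in> A}"
        by (rule inj_on_subset[OF tup_inj]) auto
      thus ?thesis unfolding UN by (simp add: emeasure_count_space finite_image_iff card_image)
    qed
    also have "tup n y ` {u \<in> PiE {..<n} (\<lambda>_. H y). tup n y u \<in> A} = A \<inter> fib n y"
      unfolding fib_eq[OF y(1)] by auto
    finally show ?case by simp
  qed
  ultimately show ?thesis by blast
qed

lemma sets_fiber_power: "sets (fiber_power GG n) = sets (FPS n)"
  and space_fiber_power: "space (fiber_power GG n) = space (FPS n)"
  unfolding fiber_power_def by (simp_all add: sets.space_closed sets.sigma_sets_eq)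

text \<open>\<open>measure_of\<close> has the prescribed values once these are countably additive.
  The fibre counts are only almost everywhere equal to measurable functions, so the interchange of
  sum and integral is made for the measurable versions.\<close>

lemma emeasure_fiber_power:
  assumes "A \<in> sets (FPS n)"
  shows "emeasure (fiber_power GG n) A = (\<integral>\<^sup>+ y. cnt (A \<inter> fib n y) \<partial>\<nu>)"
proof (rule emeasure_measure_of[OF fiber_power_def[of GG n, unfolded GG_simps]])
  show "sets (FPS n) \<subseteq> Pow (space (FPS n))" by (rule sets.space_closed)
  show "positive (sets (fiber_power GG n)) (\<lambda>A. \<integral>\<^sup>+ y. cnt (A \<inter> fib n y) \<partial>\<nu>)"
    by (simp add: positive_def)
  show "countably_additive (sets (fiber_power GG n)) (\<lambda>A. \<integral>\<^sup>+ y. cnt (A \<inter> fib n y) \<partial>\<nu>)"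
  proof (rule countably_additiveI)
    fix A :: "nat \<Rightarrow> _" assume A: "range A \<subseteq> sets (fiber_power GG n)" "disjoint_family A"
    have "\<forall>i. \<exists>f. f \<in> borel_measurable \<nu> \<and> (AE y in \<nu>. cnt (A i \<inter> fib n y) = f y)"
    proof
      fix i
      have "A i \<in> sets (FPS n)" using A(1) by (auto simp: sets_fiber_power)
      from fib_cnt_AE_measurable[OF this] show "\<exists>f. f \<in> borel_measurable \<nu> \<and> (AE y in \<nu>. cnt (A i \<inter> fib n y) = f y)" by blast
    qed
    from choice[OF this] obtain f where f: "\<And>i. f i \<in> borel_measurable \<nu>"
      "\<And>i. AE y in \<nu>. cnt (A i \<inter> fib n y) = f i y" by auto
    have all: "AE y in \<nu>. \<forall>i. cnt (A i \<inter> fib n y) = f i y" using f(2) by (simp add: AE_all_countable)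
    have sum: "cnt ((\<Union>i. A i) \<inter> fib n y) = (\<Sum>i. cnt (A i \<inter> fib n y))" for y
    proof -
      have "disjoint_family (\<lambda>i. A i \<inter> fib n y)" using A(2) by (auto simp: disjoint_family_on_def)
      hence "(\<Sum>i. cnt (A i \<inter> fib n y)) = cnt (\<Union>i. A i \<inter> fib n y)" by (intro suminf_emeasure) auto
      thus ?thesis by (simp only: Int_UN_distrib2 UN_extend_simps)
    qed
    have "(\<Sum>i. \<integral>\<^sup>+ y. cnt (A i \<inter> fib n y) \<partial>\<nu>) = (\<Sum>i. \<integral>\<^sup>+ y. f i y \<partial>\<nu>)"
      using f(2) by (intro suminf_cong nn_integral_cong_AE)
    also have "\<dots> = (\<integral>\<^sup>+ y. (\<Sum>i. f i y) \<partial>\<nu>)" using f(1) by (simp add: nn_integral_suminf)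
    also have "\<dots> = (\<integral>\<^sup>+ y. cnt ((\<Union>i. A i) \<inter> fib n y) \<partial>\<nu>)"
      by (rule nn_integral_cong_AE, rule AE_mp[OF all]) (auto simp: sum)
    finally show "(\<Sum>i. \<integral>\<^sup>+ y. cnt (A i \<inter> fib n y) \<partial>\<nu>) = (\<integral>\<^sup>+ y. cnt ((\<Union>i. A i) \<inter> fib n y) \<partial>\<nu>)" .
  qed
qed (simp add: sets_fiber_power assms)

text \<open>Counting measure has no nonempty null set. Almost everywhere on the fibre power
  therefore means everywhere on the fibre powers over almost every \<open>y\<close>.\<close>

lemma null_fiber_power_iff:
  assumes A: "A \<in> sets (FPS n)"
  shows "emeasure (fiber_power GG n) A = 0 \<longleftrightarrow> (AE y in \<nu>. A \<inter> fib n y = {})"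
proof -
  obtain f where f: "f \<in> borel_measurable \<nu>" "AE y in \<nu>. cnt (A \<inter> fib n y) = f y"
    using fib_cnt_AE_measurable[OF A] by blast
  have "emeasure (fiber_power GG n) A = (\<integral>\<^sup>+ y. f y \<partial>\<nu>)"
    unfolding emeasure_fiber_power[OF A] by (rule nn_integral_cong_AE[OF f(2)])
  also have "\<dots> = 0 \<longleftrightarrow> (AE y in \<nu>. f y = 0)" by (rule nn_integral_0_iff_AE[OF f(1)])
  also have "\<dots> \<longleftrightarrow> (AE y in \<nu>. A \<inter> fib n y = {})"
  proof
    assume "AE y in \<nu>. f y = 0"
    thus "AE y in \<nu>. A \<inter> fib n y = {}" using f(2) by eventually_elim (metis cnt_eq_0_iff)
  next
    assume "AE y in \<nu>. A \<inter> fib n y = {}"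
    thus "AE y in \<nu>. f y = 0" using f(2) by eventually_elim (metis cnt_eq_0_iff)
  qed
  finally show ?thesis .
qed

lemma AE_fiber_powerD:
  assumes "AE \<gamma> in fiber_power GG n. Q \<gamma>"
  shows "AE y in \<nu>. \<forall>\<gamma>\<in>fib n y. Q \<gamma>"
proof -
  obtain N where N: "{\<gamma> \<in> space (fiber_power GG n). \<not> Q \<gamma>} \<subseteq> N" "emeasure (fiber_power GG n) N = 0" "N \<in> sets (fiber_power GG n)"
    using AE_E[OF assms] by blast
  have "AE y in \<nu>. N \<inter> fib n y = {}" using N null_fiber_power_iff by (simp add: sets_fiber_power)
  thus ?thesis using AE_space
  proof eventually_elim
    case (elim y)
    hence y: "y \<in> Y" by (simp add: nu_space)
    show ?case using elim N(1) fib_space[OF y] by (auto simp: space_fiber_power)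
  qed
qed

lemma AE_fiber_powerI:
  assumes "AE y in \<nu>. \<forall>\<gamma>\<in>fib n y. Q \<gamma>" and "{\<gamma> \<in> space (FPS n). \<not> Q \<gamma>} \<in> sets (FPS n)"
  shows "AE \<gamma> in fiber_power GG n. Q \<gamma>"
proof -
  have "AE y in \<nu>. {\<gamma> \<in> space (FPS n). \<not> Q \<gamma>} \<inter> fib n y = {}"
    using assms(1) by eventually_elim auto
  hence "emeasure (fiber_power GG n) {\<gamma> \<in> space (FPS n). \<not> Q \<gamma>} = 0"
    using null_fiber_power_iff[OF assms(2)] by simp
  thus ?thesis using assms(2)
    by (intro AE_I[of _ _ "{\<gamma> \<in> space (FPS n). \<not> Q \<gamma>}"]) (auto simp: sets_fiber_power space_fiber_power)
qed

end

section \<open>Iterated null sets and the averaging measures\<close>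

lemma iter_principal: "iter (principal V) n Q \<longleftrightarrow> (\<forall>u. (\<forall>i<n. u i \<in> V) \<longrightarrow> Q u)"
proof (induction n arbitrary: Q)
  case (Suc n)
  have "iter (principal V) (Suc n) Q \<longleftrightarrow> (\<forall>g\<in>V. \<forall>u. (\<forall>i<n. u i \<in> V) \<longrightarrow> Q (case_nat g u))"
    by (simp add: eventually_principal Suc.IH)
  also have "\<dots> \<longleftrightarrow> (\<forall>u. (\<forall>i<Suc n. u i \<in> V) \<longrightarrow> Q u)"
  proof (intro iffI allI impI ballI)
    fix u assume *: "\<forall>g\<in>V. \<forall>u. (\<forall>i<n. u i \<in> V) \<longrightarrow> Q (case_nat g u)" and u: "\<forall>i<Suc n. u i \<in> V"
    have "u 0 \<in> V" "\<forall>i<n. u (Suc i) \<in> V" using u by auto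
    hence "Q (case_nat (u 0) (\<lambda>i. u (Suc i)))" using *[rule_format, of "u 0" "\<lambda>i. u (Suc i)"] by simp
    also have "case_nat (u 0) (\<lambda>i. u (Suc i)) = u" by (auto simp: fun_eq_iff split: nat.split)
    finally show "Q u" .
  next
    fix g u assume "\<forall>u. (\<forall>i<Suc n. u i \<in> V) \<longrightarrow> Q u" "g \<in> V" "\<forall>i<n. u i \<in> V"
    thus "Q (case_nat g u)" by (auto split: nat.split)
  qed
  finally show ?case .
qed simp

lemma face_case_nat: "face 0 (case_nat g u) = u" "face (Suc j) (case_nat g u) = case_nat g (face j u)"
  by (auto simp: face_def fun_eq_iff split: nat.split)

text \<open>The entry deleted by \<open>face j\<close> is quantified without being used. This is the
  form in which null functions stay null under omission of an entry.\<close>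

lemma iter_face: "iter \<F> n Q \<Longrightarrow> j \<le> n \<Longrightarrow> iter \<F> (Suc n) (\<lambda>u. Q (face j u))"
proof (induction j arbitrary: n Q)
  case 0
  thus ?case by (simp add: face_case_nat)
next
  case (Suc j)
  then obtain n' where n: "n = Suc n'" "j \<le> n'" by (cases n) auto
  have "\<forall>\<^sub>F g in \<F>. iter \<F> n' (\<lambda>u. Q (case_nat g u))" using Suc.prems n by simp
  hence "\<forall>\<^sub>F g in \<F>. iter \<F> (Suc n') (\<lambda>u. Q (case_nat g (face j u)))"
    by (rule eventually_mono) (erule Suc.IH[OF _ n(2)])
  thus ?case unfolding n(1) by (subst iter.simps) (simp only: face_case_nat)
qed

context sigma_finite_measure begin

text \<open>Splits off the first factor, in step with the recursion of \<open>iter\<close> through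
  \<open>case_nat\<close>.\<close>

lemma PiM_lessThan_Suc:
  "PiM {..<Suc n} (\<lambda>_. M) =
    distr (M \<Otimes>\<^sub>M PiM {..<n} (\<lambda>_. M)) (PiM {..<Suc n} (\<lambda>_. M)) (\<lambda>(g, u). \<lambda>i\<in>{..<Suc n}. case_nat g u i)"
proof -
  interpret P: product_sigma_finite "\<lambda>_ :: nat. M" by standard
  interpret T: sigma_finite_measure "PiM {..<n} (\<lambda>_. M)" by (rule P.sigma_finite) simp
  have meas: "(\<lambda>(g, u). \<lambda>i\<in>{..<Suc n}. case_nat g u i) \<in> measurable (M \<Otimes>\<^sub>M PiM {..<n} (\<lambda>_. M)) (PiM {..<Suc n} (\<lambda>_. M))"
    unfolding split_beta'
  proof (rule measurable_restrict)
    fix i assume "i \<in> {..<Suc n}"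
    thus "(\<lambda>p. case_nat (fst p) (snd p) i) \<in> measurable (M \<Otimes>\<^sub>M PiM {..<n} (\<lambda>_. M)) M"
      by (cases i) auto
  qed
  show ?thesis
  proof (rule P.PiM_eqI[symmetric])
    fix A assume A: "\<And>i. i \<in> {..<Suc n} \<Longrightarrow> A i \<in> sets M"
    let ?f = "\<lambda>(g, u). \<lambda>i\<in>{..<Suc n}. case_nat g u i"
    have pre: "?f -` PiE {..<Suc n} A \<inter> space (M \<Otimes>\<^sub>M PiM {..<n} (\<lambda>_. M)) = A 0 \<times> PiE {..<n} (\<lambda>i. A (Suc i))"
    proof (intro set_eqI iffI)
      fix p assume p: "p \<in> ?f -` PiE {..<Suc n} A \<inter> space (M \<Otimes>\<^sub>M PiM {..<n} (\<lambda>_. M))"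
      obtain g u where gu: "p = (g, u)" by (cases p)
      have *: "case_nat g u i \<in> A i" if "i < Suc n" for i
        using p gu that by (auto simp: PiE_iff restrict_def split: if_splits)
      have "g \<in> A 0" using *[of 0] by simp
      moreover have "u i \<in> A (Suc i)" if "i < n" for i using *[of "Suc i"] that by simp
      moreover have "u \<in> extensional {..<n}" using p gu by (auto simp: space_pair_measure space_PiM PiE_iff)
      ultimately show "p \<in> A 0 \<times> PiE {..<n} (\<lambda>i. A (Suc i))" using gu by (auto simp: PiE_iff)
    next
      fix p assume p: "p \<in> A 0 \<times> PiE {..<n} (\<lambda>i. A (Suc i))"
      obtain g u where gu: "p = (g, u)" by (cases p)
      have "A i \<subseteq> space M" if "i < Suc n" for i using sets.sets_into_space[OF A] that by auto
      hence "p \<in> space (M \<Otimes>\<^sub>M PiM {..<n} (\<lambda>_. M))"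
        using p gu by (auto simp: space_pair_measure space_PiM PiE_iff)
      moreover have "case_nat g u i \<in> A i" if "i < Suc n" for i using p gu that by (auto simp: PiE_iff split: nat.split)
      ultimately show "p \<in> ?f -` PiE {..<Suc n} A \<inter> space (M \<Otimes>\<^sub>M PiM {..<n} (\<lambda>_. M))"
        using gu by auto
    qed
    have "emeasure (distr (M \<Otimes>\<^sub>M PiM {..<n} (\<lambda>_. M)) (PiM {..<Suc n} (\<lambda>_. M)) ?f) (PiE {..<Suc n} A) =
       emeasure (M \<Otimes>\<^sub>M PiM {..<n} (\<lambda>_. M)) (A 0 \<times> PiE {..<n} (\<lambda>i. A (Suc i)))"
      using A by (subst emeasure_distr[OF meas]) (auto simp only: pre intro!: sets_PiM_I_finite)
    also have "\<dots> = emeasure M (A 0) * emeasure (PiM {..<n} (\<lambda>_. M)) (PiE {..<n} (\<lambda>i. A (Suc i)))"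
      using A by (intro T.emeasure_pair_measure_Times sets_PiM_I_finite) auto
    also have "emeasure (PiM {..<n} (\<lambda>_. M)) (PiE {..<n} (\<lambda>i. A (Suc i))) = (\<Prod>i<n. emeasure M (A (Suc i)))"
      using A by (intro P.emeasure_PiM) auto
    finally show "emeasure (distr (M \<Otimes>\<^sub>M PiM {..<n} (\<lambda>_. M)) (PiM {..<Suc n} (\<lambda>_. M)) ?f) (PiE {..<Suc n} A) =
       (\<Prod>i\<in>{..<Suc n}. emeasure M (A i))"
      by (simp only: prod.lessThan_Suc_shift)
  qed simp_all
qed

text \<open>Fubini, one entry at a time. As \<open>Q\<close> reads only the first \<open>n\<close>
  entries, it may be evaluated on extensional tuples whatever their default value beyond
  \<open>n\<close>.\<close>

lemma AE_PiM_iff_iter: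
  assumes "space M = UNIV"
    and "\<And>u v. (\<And>i. i < n \<Longrightarrow> u i = v i) \<Longrightarrow> Q u = Q v"
    and "{u \<in> space (PiM UNIV (\<lambda>_. M)). Q u} \<in> sets (PiM UNIV (\<lambda>_. M))"
  shows "(AE u in PiM {..<n} (\<lambda>_. M). Q u) \<longleftrightarrow> iter (ae_filter M) n Q"
  using assms(2,3)
proof (induction n arbitrary: Q)
  case 0
  have "Q u \<longleftrightarrow> Q (\<lambda>_. undefined)" for u using 0(1) by blast
  hence all: "(\<forall>u. Q u) \<longleftrightarrow> Q (\<lambda>_. undefined)" by blast
  have "PiM {..<0::nat} (\<lambda>_. M) = count_space {\<lambda>_. undefined}" by (simp add: PiM_empty)
  thus ?case unfolding iter.simps all by (simp only: AE_count_space) blast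
next
  case (Suc n)
  interpret P: product_sigma_finite "\<lambda>_ :: nat. M" by standard
  interpret T: sigma_finite_measure "PiM {..<n} (\<lambda>_. M)" by (rule P.sigma_finite) simp
  interpret MT: pair_sigma_finite M "PiM {..<n} (\<lambda>_. M)" by standard
  let ?S = "PiM UNIV (\<lambda>_::nat. M)"
  obtain u0 :: 'a where True by simp
  have ext: "(\<lambda>u i. if i < N then u i else u0) \<in> measurable (PiM {..<N} (\<lambda>_. M)) ?S" for N
  proof (rule measurable_PiM_single')
    fix i show "(\<lambda>u. if i < N then u i else u0) \<in> measurable (PiM {..<N} (\<lambda>_. M)) M"
      using assms(1) by (cases "i < N") auto
  qed (use assms(1) in auto)
  have Q_tup: "{u \<in> space (PiM {..<Suc n} (\<lambda>_. M)). Q u} \<in> sets (PiM {..<Suc n} (\<lambda>_. M))"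
  proof -
    have "Q u \<longleftrightarrow> Q (\<lambda>i. if i < Suc n then u i else u0)" for u by (rule Suc.prems(1)) simp
    hence "{u \<in> space (PiM {..<Suc n} (\<lambda>_. M)). Q u} =
       (\<lambda>u i. if i < Suc n then u i else u0) -` {u \<in> space ?S. Q u} \<inter> space (PiM {..<Suc n} (\<lambda>_. M))"
      using assms(1) by (auto simp: space_PiM)
    thus ?thesis using measurable_sets[OF ext Suc.prems(2)] by simp
  qed
  have cn: "(\<lambda>u. case_nat g u) \<in> measurable ?S ?S" for g
  proof (rule measurable_PiM_single')
    fix i show "(\<lambda>u. case_nat g u i) \<in> measurable ?S M"
      using assms(1) by (cases i) auto
  qed (use assms(1) in auto)
  let ?f = "\<lambda>(g, u). \<lambda>i\<in>{..<Suc n}. case_nat g u i"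
  have meas: "?f \<in> measurable (M \<Otimes>\<^sub>M PiM {..<n} (\<lambda>_. M)) (PiM {..<Suc n} (\<lambda>_. M))"
    unfolding split_beta'
  proof (rule measurable_restrict)
    fix i assume "i \<in> {..<Suc n}"
    thus "(\<lambda>p. case_nat (fst p) (snd p) i) \<in> measurable (M \<Otimes>\<^sub>M PiM {..<n} (\<lambda>_. M)) M"
      by (cases i) auto
  qed
  have Qf: "Q (?f (g, u)) \<longleftrightarrow> Q (case_nat g u)" for g u by (rule Suc.prems(1)) simp
  have "(AE u in PiM {..<Suc n} (\<lambda>_. M). Q u) \<longleftrightarrow> (AE p in M \<Otimes>\<^sub>M PiM {..<n} (\<lambda>_. M). Q (?f p))"
    by (subst PiM_lessThan_Suc) (rule AE_distr_iff[OF meas Q_tup])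
  also have "\<dots> \<longleftrightarrow> (AE g in M. AE u in PiM {..<n} (\<lambda>_. M). Q (?f (g, u)))"
  proof -
    have "{p \<in> space (M \<Otimes>\<^sub>M PiM {..<n} (\<lambda>_. M)). Q (?f (fst p, snd p))} =
       ?f -` {u \<in> space (PiM {..<Suc n} (\<lambda>_. M)). Q u} \<inter> space (M \<Otimes>\<^sub>M PiM {..<n} (\<lambda>_. M))"
      using measurable_space[OF meas] by auto
    hence "{p \<in> space (M \<Otimes>\<^sub>M PiM {..<n} (\<lambda>_. M)). Q (?f (fst p, snd p))} \<in> sets (M \<Otimes>\<^sub>M PiM {..<n} (\<lambda>_. M))"
      using measurable_sets[OF meas Q_tup] by simp
    from MT.AE_pair_iff[of "\<lambda>g u. Q (?f (g, u))", OF this] show ?thesis by simp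
  qed
  also have "\<dots> \<longleftrightarrow> (AE g in M. AE u in PiM {..<n} (\<lambda>_. M). Q (case_nat g u))" by (simp only: Qf)
  also have "\<dots> \<longleftrightarrow> (AE g in M. iter (ae_filter M) n (\<lambda>u. Q (case_nat g u)))"
  proof (intro AE_cong Suc.IH)
    fix g and u v :: "nat \<Rightarrow> 'a" assume "\<And>i. i < n \<Longrightarrow> u i = v i"
    thus "Q (case_nat g u) = Q (case_nat g v)" by (intro Suc.prems(1)) (auto split: nat.split)
  next
    fix g
    have "{u \<in> space ?S. Q (case_nat g u)} = (\<lambda>u. case_nat g u) -` {u \<in> space ?S. Q u} \<inter> space ?S"
      using measurable_space[OF cn] by auto
    thus "{u \<in> space ?S. Q (case_nat g u)} \<in> sets ?S" using measurable_sets[OF cn Suc.prems(2)] by simp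
  qed
  finally show ?case by simp
qed

end

context transverse_setup begin

lemma mp_kernel: "(\<lambda>_. mp) \<in> measurable \<mu> (prob_algebra borel)"
  by (rule measurable_const) (simp add: space_prob_algebra sets_mp mp_prob)

text \<open>\<open>Q\<close> may fail to be measurable; enclosing its exceptional set in a Borel set
  \<open>N\<close> makes the transfer through the image measure possible.\<close>

lemma orbit_kernel_AE:
  assumes \<rho>: "\<rho> \<in> measurable \<mu> (prob_algebra borel)" and x: "x \<in> space \<mu>" and N: "N \<in> sets borel"
    and ae: "AE k in \<rho> (act (- g) x). g + k \<notin> N" and Q: "\<And>k. k \<notin> N \<Longrightarrow> Q k"
  shows "AE k in orbit_kernel \<rho> x g. Q k"
proof -
  have s: "sets (\<rho> (act (- g) x)) = sets borel" by (rule rho_sets[OF \<rho> act_space[OF x]])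
  have m: "(\<lambda>k. g + k) \<in> measurable (\<rho> (act (- g) x)) borel" by (simp cong: measurable_cong_sets add: s)
  have "AE k in distr (\<rho> (act (- g) x)) borel (\<lambda>k. g + k). k \<notin> N"
    using ae N by (subst AE_distr_iff[OF m]) auto
  moreover have "orbit_kernel \<rho> x g = distr (\<rho> (act (- g) x)) borel (\<lambda>k. g + k)"
    using x by (simp add: orbit_kernel_def)
  ultimately have "AE k in orbit_kernel \<rho> x g. k \<notin> N" by (simp only:)
  thus ?thesis by (rule AE_mp) (use Q in auto)
qed

text \<open>\<open>mp\<close> is not assumed invariant, but its null sets are those of Haar measure,
  and these are preserved by the left translation in the kernel.\<close>

lemma mp_respects:
  assumes x: "x \<in> space \<mu>" and Q: "eventually Q (ae_filter m)"
  shows "AE k in orbit_kernel (\<lambda>_. mp) x g. Q k"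
proof -
  obtain N where N: "\<And>k. k \<in> space m - N \<Longrightarrow> Q k" "N \<in> null_sets m" using AE_E3[OF Q] by blast
  show ?thesis
  proof (rule orbit_kernel_AE[OF mp_kernel x])
    show "N \<in> sets borel" using N(2) by (auto simp: sets_m)
    have "AE k in m. k \<notin> N" by (rule AE_not_in[OF N(2)])
    thus "AE k in mp. g + k \<notin> N" unfolding mp_AE by (rule m_AE_left)
    show "\<And>k. k \<notin> N \<Longrightarrow> Q k" using N(1) by (simp add: space_m)
  qed
qed

end

context transverse_regular begin

text \<open>The inverses of the hitting set: \<open>V (act a x)\<close> is the left translate of
  \<open>V x\<close> by \<open>a\<close>, in agreement with the diagonal left action on cochains,
  whereas hitting sets move by right translation.\<close>

abbreviation V where "V x \<equiv> {v. act (- v) x \<in> Y}"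

definition fst_hit :: "'x \<Rightarrow> nat" where "fst_hit x = (LEAST n. K n x \<noteq> {})"

lemma fst_hit: "x \<in> X0 \<Longrightarrow> K (fst_hit x) x \<noteq> {}"
  unfolding fst_hit_def by (rule LeastI_ex) (rule K_ex)

lemma fst_hit_meas: "fst_hit \<in> measurable \<mu> (count_space UNIV)"
proof -
  have "fst_hit = (\<lambda>x. LEAST n. cnt (K n x) \<noteq> 0)" by (simp add: fst_hit_def fun_eq_iff cnt_eq_0_iff)
  thus ?thesis by simp
qed

text \<open>The uniform distribution on the inverses of the finitely many elements of the first nonempty
  \<open>K n x\<close>.  The translate by \<open>g\<close> of \<open>rhoY (act (- g) x)\<close> is carried by \<open>V x\<close>.\<close>

definition rhoY :: "'x \<Rightarrow> 'g measure" where
  "rhoY x = (if x \<in> X0 then distr (uniform_count_measure (K (fst_hit x) x)) borel uminus else return borel 0)"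

lemma uminus_borel: "uminus \<in> measurable (borel :: 'g measure) borel"
  using borel_measurable_uminus_group[of "\<lambda>x. x" borel] by simp

text \<open>On \<open>X0\<close> the mass of a Borel set is a quotient of two counting functions,
  evaluated at the measurable integer index \<open>fst_hit x\<close>; this is where their Borel
  measurability is spent.\<close>

lemma rhoY_kernel: "rhoY \<in> measurable \<mu> (prob_algebra borel)"
proof (rule measurable_prob_algebraI)
  have um: "uminus \<in> measurable (uniform_count_measure S) (borel :: 'g measure)" for S
    by (auto simp: measurable_def)
  show prob: "prob_space (rhoY x)" if "x \<in> space \<mu>" for x
  proof (cases "x \<in> X0")
    case True
    interpret prob_space "uniform_count_measure (K (fst_hit x) x)"
      by (rule prob_space_uniform_count_measure[OF K_finite[OF that] fst_hit[OF True]])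
    show ?thesis using True by (simp add: rhoY_def prob_space_distr um)
  qed (simp add: rhoY_def prob_space_return)
  show "rhoY \<in> measurable \<mu> (subprob_algebra borel)"
  proof (rule measurable_subprob_algebra)
    show "subprob_space (rhoY x)" if "x \<in> space \<mu>" for x
      by (rule prob_space_imp_subprob_space[OF prob[OF that]])
    show "sets (rhoY x) = sets borel" for x by (simp add: rhoY_def)
    fix A :: "'g set" assume A[measurable]: "A \<in> sets borel"
    have A': "uminus -` A \<in> sets borel" using measurable_sets[OF uminus_borel A] by simp
    have 1: "(\<lambda>x. ennreal (enn2real (cnt (K n x \<inter> uminus -` A)) / enn2real (cnt (K n x)))) \<in> borel_measurable \<mu>" for n
      using K_meas[OF A', of n] K_meas_all[of n] by simp
    have "(\<lambda>x. ennreal (enn2real (cnt (K (fst_hit x) x \<inter> uminus -` A)) / enn2real (cnt (K (fst_hit x) x)))) \<in> borel_measurable \<mu>"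
      by (rule measurable_compose_countable[OF 1 fst_hit_meas])
    hence "(\<lambda>x. if x \<in> X0 then ennreal (enn2real (cnt (K (fst_hit x) x \<inter> uminus -` A)) / enn2real (cnt (K (fst_hit x) x)))
       else indicator A 0) \<in> borel_measurable \<mu>"
      by measurable
    also have "?this \<longleftrightarrow> (\<lambda>x. emeasure (rhoY x) A) \<in> borel_measurable \<mu>"
    proof (intro measurable_cong)
      fix x assume x: "x \<in> space \<mu>"
      let ?S = "K (fst_hit x) x"
      have fin: "finite ?S" by (rule K_finite[OF x])
      have "emeasure (distr (uniform_count_measure ?S) borel uminus) A = emeasure (uniform_count_measure ?S) (?S \<inter> uminus -` A)"
        using A by (subst emeasure_distr[OF um]) (auto simp: space_uniform_count_measure Int_commute)
      also have "\<dots> = ennreal (card (?S \<inter> uminus -` A) / card ?S)"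
        by (rule emeasure_uniform_count_measure[OF fin]) simp
      also have "\<dots> = ennreal (enn2real (cnt (?S \<inter> uminus -` A)) / enn2real (cnt ?S))"
        using fin by (simp add: emeasure_count_space)
      finally show "(if x \<in> X0 then ennreal (enn2real (cnt (?S \<inter> uminus -` A)) / enn2real (cnt ?S))
         else indicator A 0) = emeasure (rhoY x) A"
        using A by (simp add: rhoY_def)
    qed
    finally show "(\<lambda>x. emeasure (rhoY x) A) \<in> borel_measurable \<mu>" .
  qed
qed

lemma rhoY_respects:
  assumes x: "x \<in> space \<mu>" "x \<in> X0" and Q: "eventually Q (principal (V x))"
  shows "AE k in orbit_kernel rhoY x g. Q k"
proof -
  define z where "z = act (- g) x"
  have z: "z \<in> space \<mu>" "z \<in> X0" using x by (auto simp: z_def act_space X0_inv)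
  let ?S = "K (fst_hit z) z"
  have fin: "finite ?S" by (rule K_finite[OF z(1)])
  \<comment> \<open>The complement of the finite, hence closed, set carrying the measure. It is used
    instead of the complement of \<open>V x\<close>, whose measurability is then not at
    issue.\<close>
  let ?N = "- ((\<lambda>h. g - h) ` ?S)"
  have N: "?N \<in> sets borel" using fin by (intro borel_open open_Compl finite_imp_closed) simp
  show ?thesis
  proof (rule orbit_kernel_AE[OF rhoY_kernel x(1) N])
    have um: "uminus \<in> measurable (uniform_count_measure ?S) (borel :: 'g measure)"
      by (auto simp: measurable_def)
    have "{k \<in> space borel. g + k \<notin> ?N} \<in> sets borel"
    proof -
      have "(\<lambda>k. g + k) \<in> measurable borel (borel :: 'g measure)" by simp
      from measurable_sets[OF this borel_comp[OF N]]
      show ?thesis by (simp add: vimage_def)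
    qed
    hence "AE k in distr (uniform_count_measure ?S) borel uminus. g + k \<notin> ?N"
      by (subst AE_distr_iff[OF um]) (auto intro!: AE_I2 simp: space_uniform_count_measure)
    moreover have "rhoY (act (- g) x) = distr (uniform_count_measure ?S) borel uminus"
      using z(2) by (simp add: rhoY_def flip: z_def)
    ultimately show "AE k in rhoY (act (- g) x). g + k \<notin> ?N" by (simp only:)
  next
    fix k assume "k \<notin> ?N"
    then obtain h where h: "h \<in> ?S" "k = g - h" by auto
    hence "act h z \<in> Y" by (auto simp: K_def H_iff split: if_splits)
    also have "act h z = act (- k) x" by (simp add: h(2) z_def flip: act_add[OF x(1)])
    finally show "Q k" using Q by (simp add: eventually_principal)
  qed
qed

end

section \<open>The two seminorms and the homotopies\<close>

context transverse_setup begin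

abbreviation TUPm :: "nat \<Rightarrow> (nat \<Rightarrow> 'g) measure" where "TUPm n \<equiv> PiM {..<n} (\<lambda>_. m)"
abbreviation CB where "CB n \<equiv> cb_measure m \<mu> n"

lemma SEQm_sets: "sets (PiM UNIV (\<lambda>_::nat. m)) = sets SEQ"
  by (intro sets_PiM_cong refl sets_m)

lemma TUPm_space: "space (TUPm n) = PiE {..<n} (\<lambda>_. UNIV)"
  by (simp add: space_PiM space_m)

lemma CB_space: "space (CB n) = PiE {..<n} (\<lambda>_. UNIV) \<times> space \<mu>"
  by (simp add: cb_measure_def space_pair_measure TUPm_space)

lemma TUPm_sigma_finite: "sigma_finite_measure (TUPm n)"
proof -
  interpret P: product_sigma_finite "\<lambda>_ :: nat. m" by standard
  show ?thesis by (rule P.sigma_finite) simp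
qed

lemma extend_measurable: "(\<lambda>u i. if i < n then u i else 0) \<in> measurable (TUPm n) SEQ"
proof (rule measurable_PiM_single')
  fix i show "(\<lambda>u. if i < n then u i else 0) \<in> measurable (TUPm n) borel"
  proof (cases "i < n")
    case True
    have "(\<lambda>u. u i) \<in> measurable (TUPm n) m" using True by (intro measurable_component_singleton) simp
    thus ?thesis using True by (simp cong: measurable_cong_sets add: sets_m)
  qed simp
qed auto

lemma cochain_CB_measurable: 
  assumes F: "F \<in> cochain n" shows "F \<in> borel_measurable (CB n)"
proof -
  have "(\<lambda>p. (\<lambda>i. if i < n then fst p i else 0, snd p)) \<in> measurable (CB n) (SEQ \<Otimes>\<^sub>M \<mu>)"
    unfolding cb_measure_def by (intro measurable_Pair measurable_compose[OF measurable_fst extend_measurable] measurable_snd)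
  from measurable_compose[OF this cochainD(1)[OF F]]
  have "(\<lambda>p. F (\<lambda>i. if i < n then fst p i else 0, snd p)) \<in> borel_measurable (CB n)" .
  moreover have "F (\<lambda>i. if i < n then fst p i else 0, snd p) = F p" for p
  proof -
    have "F (\<lambda>i. if i < n then fst p i else 0, snd p) = F (fst p, snd p)" by (rule cochainD(3)[OF F]) simp
    thus ?thesis by simp
  qed
  ultimately show ?thesis by simp
qed

lemma CB_AE_iff:
  assumes "{p \<in> space (CB n). P (fst p) (snd p)} \<in> sets (CB n)"
  shows "(AE p in CB n. P (fst p) (snd p)) \<longleftrightarrow> (AE x in \<mu>. AE u in TUPm n. P u x)"
proof -
  interpret T: sigma_finite_measure "TUPm n" by (rule TUPm_sigma_finite)
  interpret TM: pair_sigma_finite "TUPm n" \<mu> by standard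
  have "(AE p in CB n. P (fst p) (snd p)) \<longleftrightarrow> (AE u in TUPm n. AE x in \<mu>. P u x)"
    using assms unfolding cb_measure_def by (rule TM.AE_pair_iff[symmetric])
  also have "\<dots> \<longleftrightarrow> (AE x in \<mu>. AE u in TUPm n. P u x)"
    using assms unfolding cb_measure_def by (rule TM.AE_commute)
  finally show ?thesis .
qed

lemma TUPm_AE_iff_iter:
  assumes "\<And>u v. (\<And>i. i < n \<Longrightarrow> u i = v i) \<Longrightarrow> Q u = Q v" "{u. Q u} \<in> sets SEQ"
  shows "(AE u in TUPm n. Q u) \<longleftrightarrow> iter (ae_filter m) n Q"
  by (rule m.AE_PiM_iff_iter[OF space_m assms(1)]) (use assms(2) in \<open>simp_all add: SEQm_sets space_PiM space_m\<close>)

text \<open>Fubini with \<open>x\<close> outermost: an almost-everywhere bound on the product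
  becomes, for almost every \<open>x\<close>, an iterated Haar quantifier over the group entries,
  the form on which averaging acts.\<close>

lemma cochain_AE_CB_iff:
  assumes F: "F \<in> cochain n"
  shows "(AE p in CB n. \<bar>F p\<bar> \<le> B) \<longleftrightarrow> (AE x in \<mu>. iter (ae_filter m) n (\<lambda>u. \<bar>F (u, x)\<bar> \<le> B))"
proof -
  have "{p \<in> space (CB n). \<bar>F p\<bar> \<le> B} \<in> sets (CB n)"
    using cochain_CB_measurable[OF F] by measurable
  hence "(AE p in CB n. \<bar>F p\<bar> \<le> B) \<longleftrightarrow> (AE x in \<mu>. AE u in TUPm n. \<bar>F (u, x)\<bar> \<le> B)"
    using CB_AE_iff[of n "\<lambda>u x. \<bar>F (u, x)\<bar> \<le> B"] by simp
  also have "\<dots> \<longleftrightarrow> (AE x in \<mu>. iter (ae_filter m) n (\<lambda>u. \<bar>F (u, x)\<bar> \<le> B))"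
  proof (intro AE_cong TUPm_AE_iff_iter)
    fix x and u v :: "nat \<Rightarrow> 'g" assume "\<And>i. i < n \<Longrightarrow> u i = v i"
    hence "F (u, x) = F (v, x)" by (rule cochainD(3)[OF F])
    thus "(\<bar>F (u, x)\<bar> \<le> B) = (\<bar>F (v, x)\<bar> \<le> B)" by simp
  next
    fix x
    have [measurable]: "(\<lambda>u. F (u, x)) \<in> borel_measurable SEQ"
      using cochain_section[OF F] by (simp add: seq_bounded_def)
    have "{u \<in> space SEQ. \<bar>F (u, x)\<bar> \<le> B} \<in> sets SEQ" by measurable
    thus "{u. \<bar>F (u, x)\<bar> \<le> B} \<in> sets SEQ" by (simp add: space_PiM)
  qed
  finally show ?thesis .
qed

text \<open>From here on \<open>k\<close> is the cohomological degree: a cochain of degree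
  \<open>k\<close> reads \<open>k + 1\<close> entries, so the differential has the faces
  \<open>0\<close> to \<open>k + 1\<close>, \<open>Avg\<close> averages \<open>k + 1\<close>
  entries, and \<open>Pri\<close> lowers the degree to \<open>k\<close>.\<close>

definition dif :: "nat \<Rightarrow> ((nat \<Rightarrow> 'g) \<times> 'x \<Rightarrow> real) \<Rightarrow> (nat \<Rightarrow> 'g) \<times> 'x \<Rightarrow> real" where
  "dif k F = (\<lambda>(u, x). coface (Suc k) (\<lambda>u. F (u, x)) u)"

definition Avg :: "('x \<Rightarrow> 'g measure) \<Rightarrow> nat \<Rightarrow> ((nat \<Rightarrow> 'g) \<times> 'x \<Rightarrow> real) \<Rightarrow> (nat \<Rightarrow> 'g) \<times> 'x \<Rightarrow> real" where
  "Avg \<rho> k F = (\<lambda>(u, x). avgs (orbit_kernel \<rho> x) 0 (Suc k) (\<lambda>u. F (u, x)) u)"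

definition Pri :: "('x \<Rightarrow> 'g measure) \<Rightarrow> nat \<Rightarrow> ((nat \<Rightarrow> 'g) \<times> 'x \<Rightarrow> real) \<Rightarrow> (nat \<Rightarrow> 'g) \<times> 'x \<Rightarrow> real" where
  "Pri \<rho> k F = (\<lambda>(u, x). prism (orbit_kernel \<rho> x) (Suc k) (\<lambda>u. F (u, x)) u)"

lemma dif_in: "F \<in> cochain n \<Longrightarrow> dif k F \<in> cochain (Suc n)"
  unfolding dif_def by (rule cochain_coface)

lemma dif_add: "dif k (\<lambda>p. F p + G p) = (\<lambda>p. dif k F p + dif k G p)"
  by (simp add: dif_def coface_def fun_eq_iff algebra_simps sum.distrib)

lemma dif_scale: "dif k (\<lambda>p. c * F p) = (\<lambda>p. c * dif k F p)"
  by (simp only: dif_def coface_def fun_eq_iff split_paired_All prod.case sum_distrib_left) (simp add: mult_ac)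

context
  fixes \<rho> :: "'x \<Rightarrow> 'g measure" assumes \<rho>: "\<rho> \<in> measurable \<mu> (prob_algebra borel)"
begin

lemma Avg_in: "F \<in> cochain (Suc k) \<Longrightarrow> Avg \<rho> k F \<in> cochain (Suc k)"
  unfolding Avg_def by (rule cochain_avgs[OF \<rho>]) auto

lemma Pri_in: "F \<in> cochain (Suc (Suc k)) \<Longrightarrow> Pri \<rho> k F \<in> cochain (Suc k)"
  unfolding Pri_def by (rule cochain_prism[OF \<rho>])

lemma Avg_add:
  assumes F: "F \<in> cochain n" and G: "G \<in> cochain n"
  shows "Avg \<rho> k (\<lambda>p. F p + G p) = (\<lambda>p. Avg \<rho> k F p + Avg \<rho> k G p)"
  unfolding Avg_def split_beta'
  using averaging.avgs_add[OF kernel_averaging[OF \<rho>] cochain_section[OF F] cochain_section[OF G]]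
  by (simp add: fun_eq_iff del: avgs.simps)

lemma Avg_scale: "Avg \<rho> k (\<lambda>p. c * F p) = (\<lambda>p. c * Avg \<rho> k F p)"
  unfolding Avg_def split_beta'
  by (simp add: fun_eq_iff averaging.avgs_scale[OF kernel_averaging[OF \<rho>]] del: avgs.simps)

lemma Avg_dif:
  assumes F: "F \<in> cochain n" shows "Avg \<rho> (Suc k) (dif k F) = dif k (Avg \<rho> k F)"
proof
  fix p :: "(nat \<Rightarrow> 'g) \<times> 'x"
  obtain u x where p: "p = (u, x)" by (cases p)
  have "(\<lambda>u. dif k F (u, x)) = coface (Suc k) (\<lambda>u. F (u, x))" by (simp add: dif_def)
  thus "Avg \<rho> (Suc k) (dif k F) p = dif k (Avg \<rho> k F) p"
    using averaging.avgs_coface[OF kernel_averaging[OF \<rho>] cochain_section[OF F], of x "Suc k" x u]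
    by (simp add: Avg_def p dif_def del: avgs.simps)
qed

text \<open>The prism identity split by degree. In degree 0 the lower prism is an empty sum and
  leaves no coboundary; otherwise \<open>E\<close> is the differential of the prism of
  \<open>F\<close> one degree below.\<close>

lemma Avg_homotopy:
  assumes F: "F \<in> cochain (Suc k)"
  shows "\<exists>E\<in>(case k of 0 \<Rightarrow> {\<lambda>_. 0} | Suc k' \<Rightarrow> dif k' ` cochain (Suc k')).
    Avg \<rho> k F = (\<lambda>p. F p + (Pri \<rho> k (dif k F) p + E p))"
proof -
  have sec: "(\<lambda>u. dif k F (u, x)) = coface (Suc k) (\<lambda>u. F (u, x))" for x by (simp add: dif_def)
  have main: "Avg \<rho> k F (u, x) = F (u, x) + (Pri \<rho> k (dif k F) (u, x) + coface k (prism (orbit_kernel \<rho> x) k (\<lambda>u. F (u, x))) u)" for u x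
    using averaging.prism_homotopy[OF kernel_averaging[OF \<rho>] cochain_section[OF F], of x k x u]
    by (simp add: Avg_def Pri_def sec del: avgs.simps)
  show ?thesis
  proof (cases k)
    case 0
    have "Avg \<rho> k F = (\<lambda>p. F p + (Pri \<rho> k (dif k F) p + 0))"
      using main 0 by (auto simp: fun_eq_iff prism_def coface_def simp del: avgs.simps)
    thus ?thesis using 0 by simp
  next
    case (Suc k')
    have "coface k (prism (orbit_kernel \<rho> x) k (\<lambda>u. F (u, x))) u = dif k' (Pri \<rho> k' F) (u, x)" for u x
      by (simp add: Suc dif_def Pri_def)
    hence "Avg \<rho> k F = (\<lambda>p. F p + (Pri \<rho> k (dif k F) p + dif k' (Pri \<rho> k' F) p))"
      using main by (auto simp: fun_eq_iff simp del: avgs.simps)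
    moreover have "Pri \<rho> k' F \<in> cochain (Suc k')" using Pri_in[of F k'] F Suc by simp
    ultimately show ?thesis unfolding Suc by auto
  qed
qed

text \<open>Averaging each entry discharges the filter condition on it. Once all
  \<open>k + 1\<close> entries are averaged no condition on \<open>u\<close> is left, so the outcome
  does not mention the filter.\<close>

lemma Avg_AE_bound:
  assumes resp: "AE x in \<mu>. \<forall>g Q. eventually Q (\<F> x) \<longrightarrow> (AE k in orbit_kernel \<rho> x g. Q k)"
    and F: "AE x in \<mu>. iter (\<F> x) (Suc k) (\<lambda>u. \<bar>F (u, x)\<bar> \<le> B)" and B: "0 \<le> B"
  shows "AE x in \<mu>. \<forall>u. \<bar>Avg \<rho> k F (u, x)\<bar> \<le> B"
  using resp F
proof eventually_elim
  case (elim x)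
  have "iter (\<F> x) 0 (\<lambda>u. \<bar>avgs (orbit_kernel \<rho> x) 0 (Suc k) (\<lambda>u. F (u, x)) u\<bar> \<le> B)"
    by (rule averaging.iter_avgs[OF kernel_averaging[OF \<rho>]]) (use elim B in auto)
  thus ?case by (simp add: Avg_def del: avgs.simps)
qed

lemma Pri_AE_null:
  assumes resp: "AE x in \<mu>. \<forall>g Q. eventually Q (\<F> x) \<longrightarrow> (AE k in orbit_kernel \<rho> x g. Q k)"
    and F: "AE x in \<mu>. iter (\<F> x) (Suc (Suc k)) (\<lambda>u. F (u, x) = 0)"
  shows "AE x in \<mu>. iter (\<F> x) (Suc k) (\<lambda>u. Pri \<rho> k F (u, x) = 0)"
  using resp F
proof eventually_elim
  case (elim x)
  have "iter (\<F> x) (Suc k) (\<lambda>u. prism (orbit_kernel \<rho> x) (Suc k) (\<lambda>u. F (u, x)) u = 0)"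
    by (rule averaging.iter_prism[OF kernel_averaging[OF \<rho>]]) (use elim in auto)
  thus ?case by (simp add: Pri_def)
qed

text \<open>The filter \<open>principal UNIV\<close> turns \<open>iter\<close> into plain universal
  quantification and is respected by every kernel.\<close>

lemma Pri_AE_null_all:
  assumes F: "AE x in \<mu>. \<forall>u. F (u, x) = 0"
  shows "AE x in \<mu>. \<forall>u. Pri \<rho> k F (u, x) = 0"
proof -
  have "AE x in \<mu>. iter (principal UNIV) (Suc (Suc k)) (\<lambda>u. F (u, x) = 0)"
    using F by eventually_elim (simp only: iter_principal simp_thms)
  hence "AE x in \<mu>. iter (principal UNIV) (Suc k) (\<lambda>u. Pri \<rho> k F (u, x) = 0)"
    by (rule Pri_AE_null[rotated]) (simp add: eventually_principal)
  thus ?thesis by (simp only: iter_principal UNIV_I simp_thms)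
qed

end

end

section \<open>Cochains evaluated on tuples of arrows\<close>

context transverse_regular begin

text \<open>An arrow is determined by its target and its group component. A tuple over
  \<open>y\<close> thus becomes a tuple of elements of \<open>V y\<close> together with the base
  point \<open>y\<close>, read off from the first arrow.\<close>

definition obs :: "((nat \<Rightarrow> 'g) \<times> 'x \<Rightarrow> real) \<Rightarrow> (nat \<Rightarrow> 'g \<times> 'x) \<Rightarrow> real" where
  "obs F \<gamma> = F (\<lambda>i. fst (\<gamma> i), tgt GG (\<gamma> 0))"

lemma FPS_component: "i < n \<Longrightarrow> (\<lambda>\<gamma>. \<gamma> i) \<in> measurable (FPS n) (arrows GG)"
  unfolding fiber_power_space_def by (intro measurable_restrict_space1 measurable_component_singleton) simp

lemma fst_arrows: "fst \<in> measurable (arrows GG) borel" and snd_arrows: "snd \<in> measurable (arrows GG) \<mu>"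
proof -
  show "fst \<in> measurable (arrows GG) borel" unfolding GG_simps by (intro measurable_restrict_space1) simp
  have "snd \<in> measurable (borel \<Otimes>\<^sub>M \<nu>) \<mu>"
    by (rule measurable_compose[OF measurable_snd measurable_nuD]) simp
  thus "snd \<in> measurable (arrows GG) \<mu>" unfolding GG_simps by (intro measurable_restrict_space1)
qed

lemma tgt_eq: "tgt GG = (\<lambda>\<gamma>. act (fst \<gamma>) (snd \<gamma>))"
  by (auto simp: fun_eq_iff GG_simps)

lemma tgt_arrows: "tgt GG \<in> measurable (arrows GG) \<mu>"
  unfolding tgt_eq by (rule act_measurable[OF fst_arrows snd_arrows])

lemma obs_measurable:
  assumes F: "F \<in> cochain n" and n: "0 < n"
  shows "obs F \<in> borel_measurable (FPS n)"
proof -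
  have "(\<lambda>\<gamma>. (\<lambda>i. if i < n then fst (\<gamma> i) else 0, tgt GG (\<gamma> 0))) \<in> measurable (FPS n) (SEQ \<Otimes>\<^sub>M \<mu>)"
  proof (intro measurable_Pair measurable_PiM_single')
    fix i :: nat
    show "(\<lambda>\<gamma>. if i < n then fst (\<gamma> i) else 0) \<in> measurable (FPS n) borel"
      using measurable_compose[OF FPS_component fst_arrows] by (cases "i < n") auto
    show "(\<lambda>\<gamma>. tgt GG (\<gamma> 0)) \<in> measurable (FPS n) \<mu>"
      using measurable_compose[OF FPS_component[OF n] tgt_arrows] .
  qed auto
  from measurable_compose[OF this cochainD(1)[OF F]]
  have "(\<lambda>\<gamma>. F (\<lambda>i. if i < n then fst (\<gamma> i) else 0, tgt GG (\<gamma> 0))) \<in> borel_measurable (FPS n)" .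
  moreover have "F (\<lambda>i. if i < n then fst (\<gamma> i) else 0, tgt GG (\<gamma> 0)) = obs F \<gamma>" for \<gamma>
    unfolding obs_def by (rule cochainD(3)[OF F]) simp
  ultimately show ?thesis by simp
qed

lemma fib_obs_iff:
  assumes F: "F \<in> cochain n" and n: "0 < n" and y: "y \<in> Y"
  shows "(\<forall>\<gamma>\<in>fib n y. P (obs F \<gamma>)) \<longleftrightarrow> (\<forall>u. (\<forall>i<n. u i \<in> V y) \<longrightarrow> P (F (u, y)))"
proof -
  have obs: "obs F (tup n y h) = F (\<lambda>i. - h i, y)" for h
  proof -
    have "tgt GG (tup n y h 0) = y" using n by (simp add: tup_def tgt_arr Y_space[OF y])
    hence "obs F (tup n y h) = F (\<lambda>i. fst (tup n y h i), y)" by (simp add: obs_def)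
    also have "\<dots> = F (\<lambda>i. - h i, y)" by (rule cochainD(3)[OF F]) (simp add: tup_def arr_def)
    finally show ?thesis .
  qed
  show ?thesis
  proof (intro iffI allI impI ballI)
    fix u assume *: "\<forall>\<gamma>\<in>fib n y. P (obs F \<gamma>)" and u: "\<forall>i<n. u i \<in> V y"
    define h where "h = (\<lambda>i\<in>{..<n}. - u i)"
    have "h \<in> PiE {..<n} (\<lambda>_. H y)" using u by (auto simp: h_def H_iff)
    hence "P (obs F (tup n y h))" using * fib_eq[OF y] by blast
    also have "obs F (tup n y h) = F (u, y)" unfolding obs by (rule cochainD(3)[OF F]) (simp add: h_def)
    finally show "P (F (u, y))" .
  next
    fix \<gamma> assume *: "\<forall>u. (\<forall>i<n. u i \<in> V y) \<longrightarrow> P (F (u, y))" and "\<gamma> \<in> fib n y"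
    hence "\<gamma> \<in> tup n y ` PiE {..<n} (\<lambda>_. H y)" by (simp only: fib_eq[OF y])
    then obtain h where h: "h \<in> PiE {..<n} (\<lambda>_. H y)" "\<gamma> = tup n y h" by blast
    have "- h i \<in> V y" if "i < n" for i using PiE_mem[OF h(1), of i] that by (simp add: H_iff)
    thus "P (obs F \<gamma>)" using *[rule_format, of "\<lambda>i. - h i"] by (simp add: h(2) obs)
  qed
qed

text \<open>The bound on all tuples from \<open>V x\<close> is an invariant condition on
  \<open>x\<close>, since both \<open>F\<close> and \<open>V\<close> are equivariant. Within
  \<open>X0\<close> it defines a Borel set, so \<open>null_transfer\<close> carries the statement
  from \<nu>-almost every point of \<open>Y\<close> to \<mu>-almost every point of
  \<open>X\<close>.\<close>

lemma cochain_AE_fiber_power_iff: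
  assumes F: "F \<in> cochain n" and n: "0 < n"
  shows "(AE \<gamma> in fiber_power GG n. \<bar>obs F \<gamma>\<bar> \<le> B) \<longleftrightarrow>
    (AE x in \<mu>. iter (principal (V x)) n (\<lambda>u. \<bar>F (u, x)\<bar> \<le> B))"
proof -
  define P where "P x \<longleftrightarrow> (\<forall>u. (\<forall>i<n. u i \<in> V x) \<longrightarrow> \<bar>F (u, x)\<bar> \<le> B)" for x
  define S where "S = {x \<in> X0. P x}"
  have X0_space: "x \<in> X0 \<Longrightarrow> x \<in> space \<mu>" for x using sets.sets_into_space[OF X0_sets] by blast
  define C where "C = {p \<in> space (\<mu> \<Otimes>\<^sub>M TUP n). B < \<bar>F (\<lambda>i. if i < n then - snd p i else 0, fst p)\<bar>}"
  have C: "C \<in> sets (\<mu> \<Otimes>\<^sub>M TUP n)"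
  proof -
    have "(\<lambda>p. (\<lambda>i. if i < n then - snd p i else 0, fst p)) \<in> measurable (\<mu> \<Otimes>\<^sub>M TUP n) (SEQ \<Otimes>\<^sub>M \<mu>)"
    proof (intro measurable_Pair measurable_PiM_single')
      fix i :: nat
      show "(\<lambda>p. if i < n then - snd p i else 0) \<in> measurable (\<mu> \<Otimes>\<^sub>M TUP n) borel"
        by (cases "i < n") (auto intro!: borel_measurable_uminus_group)
    qed auto
    from measurable_compose[OF this cochainD(1)[OF F]]
    have [measurable]: "(\<lambda>p. F (\<lambda>i. if i < n then - snd p i else 0, fst p)) \<in> borel_measurable (\<mu> \<Otimes>\<^sub>M TUP n)" .
    show ?thesis unfolding C_def by measurable
  qed
  have cnt_meas: "(\<lambda>x. cnt {h \<in> PiE {..<n} (\<lambda>_. K j x). (x, h) \<in> C}) \<in> borel_measurable \<mu>" for j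
  proof (rule cnt_section_measurable[OF _ _ _ C])
    show "finite (PiE {..<n} (\<lambda>_. K j x))" if "x \<in> space \<mu>" for x
      using K_finite[OF that] by (intro finite_PiE) auto
    show "PiE {..<n} (\<lambda>_. K j x) \<subseteq> space (TUP n)" for x by (auto simp: space_PiM PiE_def)
  qed (rule PiE_K_meas)
  \<comment> \<open>The bound holds when no finite box contains a violating tuple; the numbers of
    violations are Borel functions of \<open>x\<close>, which makes \<open>S\<close> Borel.\<close>
  have P_iff: "P x \<longleftrightarrow> (\<forall>j. cnt {h \<in> PiE {..<n} (\<lambda>_. K j x). (x, h) \<in> C} = 0)" if x: "x \<in> X0" for x
  proof
    assume P: "P x"
    show "\<forall>j. cnt {h \<in> PiE {..<n} (\<lambda>_. K j x). (x, h) \<in> C} = 0"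
      unfolding cnt_eq_0_iff
    proof (intro allI equals0I)
      fix j h assume h: "h \<in> {h \<in> PiE {..<n} (\<lambda>_. K j x). (x, h) \<in> C}"
      have "(\<lambda>i. if i < n then - h i else 0) i \<in> V x" if "i < n" for i
        using h x that by (auto simp: K_def H_iff PiE_iff)
      hence "\<bar>F (\<lambda>i. if i < n then - h i else 0, x)\<bar> \<le> B"
        using P[unfolded P_def, rule_format, of "\<lambda>i. if i < n then - h i else 0"] by simp
      thus False using h by (simp add: C_def cong: if_cong)
    qed
  next
    assume 0: "\<forall>j. cnt {h \<in> PiE {..<n} (\<lambda>_. K j x). (x, h) \<in> C} = 0"
    show "P x" unfolding P_def
    proof (intro allI impI)
      fix u assume u: "\<forall>i<n. u i \<in> V x"
      define h where "h = (\<lambda>i\<in>{..<n}. - u i)"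
      have "\<forall>i\<in>{..<n}. \<exists>j. h i \<in> K j x" using u K_UN[OF x] by (auto simp: h_def H_iff)
      from bchoice[OF this] obtain j where j: "\<And>i. i < n \<Longrightarrow> h i \<in> K (j i) x" by auto
      have "h i \<in> K (\<Sum>i<n. j i) x" if "i < n" for i
        using j[OF that] K_mono[of "j i" "\<Sum>i<n. j i" x] that by (auto intro!: member_le_sum)
      hence hK: "h \<in> PiE {..<n} (\<lambda>_. K (\<Sum>i<n. j i) x)" by (auto simp: h_def)
      hence "(x, h) \<notin> C" using 0 unfolding cnt_eq_0_iff by blast
      moreover have "(x, h) \<in> space (\<mu> \<Otimes>\<^sub>M TUP n)" using X0_space[OF x] hK by (auto simp: space_pair_measure space_PiM PiE_iff)
      ultimately have "\<bar>F (\<lambda>i. if i < n then - h i else 0, x)\<bar> \<le> B" by (simp add: C_def not_less cong: if_cong)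
      also have "F (\<lambda>i. if i < n then - h i else 0, x) = F (u, x)"
        by (rule cochainD(3)[OF F]) (simp add: h_def)
      finally show "\<bar>F (u, x)\<bar> \<le> B" .
    qed
  qed
  have S_sets: "S \<in> sets \<mu>"
  proof -
    have "S = {x \<in> space \<mu>. x \<in> X0 \<and> (\<forall>j. cnt {h \<in> PiE {..<n} (\<lambda>_. K j x). (x, h) \<in> C} = 0)}"
      unfolding S_def using P_iff X0_space by blast
    also have "\<dots> \<in> sets \<mu>" using cnt_meas by measurable
    finally show ?thesis .
  qed
  have P_mono: "P (act a x)" if x: "x \<in> space \<mu>" and P: "P x" for a x
    unfolding P_def
  proof (intro allI impI)
    fix u assume u: "\<forall>i<n. u i \<in> V (act a x)"
    have "- a + u i \<in> V x" if "i < n" for i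
      using u x that by (simp add: minus_add act_add)
    hence "\<bar>F (\<lambda>i. - a + u i, x)\<bar> \<le> B"
      using P[unfolded P_def, rule_format, of "\<lambda>i. - a + u i"] by simp
    also have "F (\<lambda>i. - a + u i, x) = F (u, act a x)"
      using cochainD(4)[OF F x, of a "\<lambda>i. - a + u i"] by (simp flip: add.assoc)
    finally show "\<bar>F (u, act a x)\<bar> \<le> B" .
  qed
  have S_inv: "act a x \<in> S \<longleftrightarrow> x \<in> S" if x: "x \<in> space \<mu>" for a x
    using P_mono[OF x, of a] P_mono[OF act_space[OF x], of a "- a"] act_minus(1)[OF x] X0_inv[OF x]
    by (auto simp: S_def)
  have "(AE \<gamma> in fiber_power GG n. \<bar>obs F \<gamma>\<bar> \<le> B) \<longleftrightarrow> (AE y in \<nu>. \<forall>\<gamma>\<in>fib n y. \<bar>obs F \<gamma>\<bar> \<le> B)"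
  proof
    assume *: "AE y in \<nu>. \<forall>\<gamma>\<in>fib n y. \<bar>obs F \<gamma>\<bar> \<le> B"
    have [measurable]: "obs F \<in> borel_measurable (FPS n)" by (rule obs_measurable[OF F n])
    show "AE \<gamma> in fiber_power GG n. \<bar>obs F \<gamma>\<bar> \<le> B" by (rule AE_fiber_powerI[OF *]) measurable
  qed (rule AE_fiber_powerD)
  also have "\<dots> \<longleftrightarrow> (AE y in \<nu>. y \<in> S)"
  proof
    assume "AE y in \<nu>. \<forall>\<gamma>\<in>fib n y. \<bar>obs F \<gamma>\<bar> \<le> B"
    thus "AE y in \<nu>. y \<in> S" using X0_AE_nu AE_space
      by eventually_elim (simp add: S_def P_def nu_space fib_obs_iff[OF F n, of _ "\<lambda>r. \<bar>r\<bar> \<le> B"])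
  next
    assume "AE y in \<nu>. y \<in> S"
    thus "AE y in \<nu>. \<forall>\<gamma>\<in>fib n y. \<bar>obs F \<gamma>\<bar> \<le> B" using AE_space
      by eventually_elim (simp add: S_def P_def nu_space fib_obs_iff[OF F n, of _ "\<lambda>r. \<bar>r\<bar> \<le> B"])
  qed
  also have "\<dots> \<longleftrightarrow> (AE x in \<mu>. x \<in> S)" by (rule null_transfer[OF S_sets S_inv])
  also have "\<dots> \<longleftrightarrow> (AE x in \<mu>. iter (principal (V x)) n (\<lambda>u. \<bar>F (u, x)\<bar> \<le> B))"
  proof
    assume "AE x in \<mu>. x \<in> S"
    thus "AE x in \<mu>. iter (principal (V x)) n (\<lambda>u. \<bar>F (u, x)\<bar> \<le> B)"
      by eventually_elim (simp add: S_def P_def iter_principal)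
  next
    assume "AE x in \<mu>. iter (principal (V x)) n (\<lambda>u. \<bar>F (u, x)\<bar> \<le> B)"
    thus "AE x in \<mu>. x \<in> S" using X0_AE
      by eventually_elim (simp add: S_def P_def iter_principal)
  qed
  finally show ?thesis .
qed

end

section \<open>Comparison of the two complexes\<close>

lemma sets_Collect_neq:
  fixes f g :: "'a \<Rightarrow> real"
  assumes [measurable]: "f \<in> borel_measurable M" "g \<in> borel_measurable M"
  shows "{x \<in> space M. \<not> f x = g x} \<in> sets M"
  by measurable

context transverse_setup begin

lemma CB_sigma_finite: "sigma_finite_measure (CB n)"
  unfolding cb_measure_def by (intro sigma_finite_pair_measure TUPm_sigma_finite mu.sigma_finite_measure_axioms)

lemma shift_measurable:
  assumes a: "a \<in> measurable N borel" and u: "\<And>i. i < n \<Longrightarrow> (\<lambda>p. u p i) \<in> measurable N borel"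
    and x: "x \<in> measurable N \<mu>"
  shows "(\<lambda>p. (\<lambda>i\<in>{..<n}. a p + u p i, act (a p) (x p))) \<in> measurable N (CB n)"
  unfolding cb_measure_def
proof (intro measurable_Pair act_measurable a x measurable_restrict)
  fix i assume "i \<in> {..<n}"
  hence "(\<lambda>p. a p + u p i) \<in> measurable N borel" using a u by (intro borel_measurable_add) auto
  thus "(\<lambda>p. a p + u p i) \<in> measurable N m" by (simp cong: measurable_cong_sets add: sets_m)
qed

text \<open>Invariance holds for each \<open>g\<close> off a null set depending on \<open>g\<close>.
  By Fubini, for almost every \<open>p\<close> the function \<open>f\<close> is essentially constant
  along the orbit of \<open>p\<close>, and \<open>F p\<close> is that constant. Base points of one
  orbit see the same function up to right translation, so \<open>F\<close> is invariant without
  exception.\<close>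

lemma cb_strict_representative:
  assumes f: "f \<in> borel_measurable (CB n)" and bd: "AE p in CB n. \<bar>f p\<bar> \<le> C"
    and inv: "group_invariant m \<mu> act n f"
  shows "\<exists>F\<in>cochain n. AE p in CB n. f p = F p"
proof -
  \<comment> \<open>The essential bound \<open>C\<close> could be negative if the measure is zero;
    the absolute value makes truncation to the interval from \<open>- c\<close> to \<open>c\<close>
    meaningful.\<close>
  define c where "c = \<bar>C\<bar>"
  define f1 where "f1 p = max (- c) (min c (f p))" for p
  define \<phi> where "\<phi> p g = f1 (\<lambda>i\<in>{..<n}. g + fst p i, act g (snd p))" for p :: "(nat \<Rightarrow> 'g) \<times> 'x" and g
  \<comment> \<open>A mean against a probability measure with the Haar null sets recovers an
    essential constant and, unlike a choice of that constant, is visibly measurable.\<close>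
  define E where "E p = (\<integral>g. \<phi> p g \<partial>mp)" for p
  \<comment> \<open>The default 0 is consistent with invariance, because failing to be essentially
    constant along the orbit is itself an invariant property.\<close>
  define F where "F p = (if snd p \<in> space \<mu> \<and> (AE g in m. \<phi> p g = E p) then E p else 0)" for p
  have c: "0 \<le> c" by (simp add: c_def)
  have f1_meas: "f1 \<in> borel_measurable (CB n)" using f unfolding f1_def by measurable
  have f1_bd: "\<bar>f1 p\<bar> \<le> c" for p using c by (auto simp: f1_def)
  have \<phi>_meas2: "(\<lambda>(p, g). \<phi> p g) \<in> borel_measurable ((SEQ \<Otimes>\<^sub>M \<mu>) \<Otimes>\<^sub>M mp)"
    unfolding \<phi>_def split_beta'
    by (rule measurable_compose[OF shift_measurable f1_meas]) (simp_all cong: measurable_cong_sets add: sets_mp)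
  have \<phi>_meas: "(\<lambda>g. \<phi> p g) \<in> borel_measurable mp" if "snd p \<in> space \<mu>" for p
    unfolding \<phi>_def by (rule measurable_compose[OF shift_measurable f1_meas]) (use that in \<open>simp_all cong: measurable_cong_sets add: sets_mp\<close>)
  have E_meas: "E \<in> borel_measurable (SEQ \<Otimes>\<^sub>M \<mu>)"
    unfolding E_def using \<phi>_meas2 by (rule mp.borel_measurable_lebesgue_integral)
  have F_const: "F p = t" if p: "snd p \<in> space \<mu>" and ae: "AE g in m. \<phi> p g = t" for p t
  proof -
    have "AE g in mp. \<phi> p g = t" using ae by (simp add: mp_AE)
    hence "E p = (\<integral>g. t \<partial>mp)" unfolding E_def using \<phi>_meas[OF p] by (intro integral_cong_AE) auto
    hence "E p = t" by (simp add: mp.prob_space)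
    thus ?thesis using p ae by (simp add: F_def)
  qed
  have F_none: "F p = 0" if "\<And>t. \<not> (AE g in m. \<phi> p g = t)" for p
    using that by (simp add: F_def)
  have F_cochain: "F \<in> cochain n"
  proof (rule cochainI)
    have "(\<lambda>p. \<integral>\<^sup>+g. ennreal \<bar>\<phi> p g - E p\<bar> \<partial>mp) \<in> borel_measurable (SEQ \<Otimes>\<^sub>M \<mu>)"
    proof (rule mp.borel_measurable_nn_integral)
      have "(\<lambda>q. E (fst q)) \<in> borel_measurable ((SEQ \<Otimes>\<^sub>M \<mu>) \<Otimes>\<^sub>M mp)" using E_meas by simp
      thus "(\<lambda>(p, g). ennreal \<bar>\<phi> p g - E p\<bar>) \<in> borel_measurable ((SEQ \<Otimes>\<^sub>M \<mu>) \<Otimes>\<^sub>M mp)"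
        using \<phi>_meas2 unfolding split_beta' by simp
    qed
    hence "(\<lambda>p. if (\<integral>\<^sup>+g. ennreal \<bar>\<phi> p g - E p\<bar> \<partial>mp) = 0 then E p else 0) \<in> borel_measurable (SEQ \<Otimes>\<^sub>M \<mu>)"
      using E_meas by measurable
    also have "?this \<longleftrightarrow> F \<in> borel_measurable (SEQ \<Otimes>\<^sub>M \<mu>)"
    proof (intro measurable_cong)
      fix p assume "p \<in> space (SEQ \<Otimes>\<^sub>M \<mu>)"
      hence p: "snd p \<in> space \<mu>" by (auto simp: space_pair_measure)
      have "(\<integral>\<^sup>+g. ennreal \<bar>\<phi> p g - E p\<bar> \<partial>mp) = 0 \<longleftrightarrow> (AE g in m. \<phi> p g = E p)"
        using \<phi>_meas[OF p] by (subst nn_integral_0_iff_AE) (auto simp: mp_AE)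
      thus "(if (\<integral>\<^sup>+g. ennreal \<bar>\<phi> p g - E p\<bar> \<partial>mp) = 0 then E p else 0) = F p"
        using p by (simp add: F_def)
    qed
    finally show "F \<in> borel_measurable (SEQ \<Otimes>\<^sub>M \<mu>)" .
    show "\<bar>F p\<bar> \<le> c" for p
    proof (cases "AE g in m. \<phi> p g = E p")
      case True
      hence "AE g in mp. \<phi> p g = E p" by (simp add: mp_AE)
      hence "AE g in mp. \<bar>E p\<bar> \<le> c" by (rule AE_mp) (metis (mono_tags, lifting) AE_I2 \<phi>_def f1_bd)
      hence "\<bar>E p\<bar> \<le> c" by simp
      thus ?thesis using c by (simp add: F_def)
    qed (use c in \<open>simp add: F_def\<close>)
    show "F (u, x) = F (v, x)" if "\<And>i. i < n \<Longrightarrow> u i = v i" for u v x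
    proof -
      have "(\<lambda>i\<in>{..<n}. g + u i) = (\<lambda>i\<in>{..<n}. g + v i)" for g using that by (auto simp: restrict_def)
      hence "\<phi> (u, x) g = \<phi> (v, x) g" for g by (simp only: \<phi>_def fst_conv snd_conv)
      hence "\<phi> (u, x) = \<phi> (v, x)" ..
      thus ?thesis by (simp add: F_def E_def)
    qed
    show "F (\<lambda>i. a + u i, act a x) = F (u, x)" if x: "x \<in> space \<mu>" for a u x
    proof -
      have \<phi>_shift: "\<phi> (\<lambda>i. a + u i, act a x) g = \<phi> (u, x) (g + a)" for g
        using x by (simp add: \<phi>_def act_add add.assoc)
      have iff: "(AE g in m. \<phi> (\<lambda>i. a + u i, act a x) g = t) \<longleftrightarrow> (AE g in m. \<phi> (u, x) g = t)" for t
        unfolding \<phi>_shift by (rule m_AE_right_iff)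
      show ?thesis
      proof (cases "\<exists>t. AE g in m. \<phi> (u, x) g = t")
        case True
        then obtain t where t: "AE g in m. \<phi> (u, x) g = t" ..
        have "F (u, x) = t" by (rule F_const) (use x t in auto)
        moreover have "F (\<lambda>i. a + u i, act a x) = t" by (rule F_const) (use act_space[OF x] t iff in auto)
        ultimately show ?thesis by simp
      next
        case False
        have "F (u, x) = 0" by (rule F_none) (use False in blast)
        moreover have "F (\<lambda>i. a + u i, act a x) = 0" by (rule F_none) (use False iff in blast)
        ultimately show ?thesis by simp
      qed
    qed
    show "F (u, x) = 0" if "x \<notin> space \<mu>" for u x using that by (simp add: F_def)
  qed
  interpret CBs: sigma_finite_measure "CB n" by (rule CB_sigma_finite)
  interpret P: pair_sigma_finite m "CB n" by standard
  have ae: "AE p in CB n. \<phi> p g = f1 p" for g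
    using inv[unfolded group_invariant_def, rule_format, of g]
    by (rule AE_mp) (auto simp: \<phi>_def f1_def)
  have AE1: "AE p in CB n. AE g in m. \<phi> p g = f1 p"
  proof (subst P.AE_commute[symmetric])
    have 1: "(\<lambda>q. \<phi> (snd q) (fst q)) \<in> borel_measurable (m \<Otimes>\<^sub>M CB n)"
      unfolding \<phi>_def
    proof (rule measurable_compose[OF shift_measurable f1_meas])
      show "fst \<in> measurable (m \<Otimes>\<^sub>M CB n) borel"
        using measurable_fst[of m "CB n"] by (simp cong: measurable_cong_sets add: sets_m)
      show "(\<lambda>p. snd (snd p)) \<in> measurable (m \<Otimes>\<^sub>M CB n) \<mu>" unfolding cb_measure_def by simp
      show "(\<lambda>p. fst (snd p) i) \<in> measurable (m \<Otimes>\<^sub>M CB n) borel" if "i < n" for i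
      proof -
        have "(\<lambda>p. fst (snd p) i) \<in> measurable (m \<Otimes>\<^sub>M CB n) m" unfolding cb_measure_def
          by (rule measurable_compose[OF measurable_compose[OF measurable_snd measurable_fst] measurable_component_singleton]) (use that in simp)
        thus ?thesis by (simp cong: measurable_cong_sets add: sets_m)
      qed
    qed
    have 2: "(\<lambda>q. f1 (snd q)) \<in> borel_measurable (m \<Otimes>\<^sub>M CB n)" using f1_meas by simp
    show "{q \<in> space (m \<Otimes>\<^sub>M CB n). \<phi> (snd q) (fst q) = f1 (snd q)} \<in> sets (m \<Otimes>\<^sub>M CB n)"
      using 1 2 by measurable
    show "AE g in m. AE p in CB n. \<phi> p g = f1 p" using ae by simp
  qed
  have key: "f p = F p" if p: "AE g in m. \<phi> p g = f1 p" "\<bar>f p\<bar> \<le> C" "p \<in> space (CB n)" for p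
  proof -
    have "snd p \<in> space \<mu>" using p(3) unfolding CB_space mem_Times_iff by (rule conjunct2)
    hence "F p = f1 p" using p(1) by (rule F_const[of p "f1 p"])
    moreover have "- c \<le> f p" "f p \<le> c" using p(2) by (auto simp: c_def)
    hence "f1 p = f p" by (simp add: f1_def)
    ultimately show ?thesis by simp
  qed
  have "AE p in CB n. (AE g in m. \<phi> p g = f1 p) \<longrightarrow> \<bar>f p\<bar> \<le> C \<longrightarrow> f p = F p"
    by (intro AE_I2 impI) (rule key)
  from eventually_mp[OF eventually_mp[OF this AE1] bd] have "AE p in CB n. f p = F p" .
  thus ?thesis using F_cochain by blast
qed

abbreviation rcb :: "nat \<Rightarrow> ((nat \<Rightarrow> 'g) \<times> 'x \<Rightarrow> real) \<Rightarrow> ((nat \<Rightarrow> 'g) \<times> 'x \<Rightarrow> real) set" where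
  "rcb k F \<equiv> Linf_class (CB (Suc k)) F"

lemma omit_face: "omit n j u = restrict (face j u) {..<n}"
  by (simp add: omit_def face_def)

lemma CB_omit_measurable: "j \<le> n \<Longrightarrow> (\<lambda>p. (omit n j (fst p), snd p)) \<in> measurable (CB (Suc n)) (CB n)"
  unfolding cb_measure_def omit_def
proof (intro measurable_Pair measurable_restrict measurable_snd)
  fix i assume "j \<le> n" "i \<in> {..<n}"
  thus "(\<lambda>p. fst p (if i < j then i else Suc i)) \<in> measurable (TUPm (Suc n) \<Otimes>\<^sub>M \<mu>) m"
    by (intro measurable_compose[OF measurable_fst measurable_component_singleton]) auto
qed

text \<open>In the iterated form the omitted entry is a free variable, so \<open>iter_face\<close>
  applies. This makes the differential independent of representatives.\<close>

lemma CB_omit_AE: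
  assumes w: "w \<in> borel_measurable (CB n)" "AE p in CB n. w p = (0::real)" and j: "j \<le> n"
  shows "AE p in CB (Suc n). w (omit n j (fst p), snd p) = 0"
proof -
  have r: "(\<lambda>u. restrict u {..<n}) \<in> measurable SEQ (TUPm n)"
  proof (rule measurable_restrict)
    fix i assume "i \<in> {..<n}"
    have "(\<lambda>u. u i) \<in> measurable SEQ borel" by simp
    thus "(\<lambda>u. u i) \<in> measurable SEQ m" by (simp cong: measurable_cong_sets add: sets_m)
  qed
  have fm: "face j \<in> measurable SEQ SEQ" by (rule measurable_PiM_single') (auto simp: face_def)
  have Qm: "{u. w (restrict u {..<n}, x) = 0} \<in> sets SEQ" if x: "x \<in> space \<mu>" for x
  proof -
    have "(\<lambda>u. (restrict u {..<n}, x)) \<in> measurable SEQ (CB n)"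
      unfolding cb_measure_def using x by (intro measurable_Pair r measurable_const)
    from measurable_compose[OF this w(1)] have [measurable]: "(\<lambda>u. w (restrict u {..<n}, x)) \<in> borel_measurable SEQ" .
    have "{u \<in> space SEQ. w (restrict u {..<n}, x) = 0} \<in> sets SEQ" by measurable
    thus ?thesis by (simp add: space_PiM)
  qed
  have Qm': "{u. w (omit n j u, x) = 0} \<in> sets SEQ" if x: "x \<in> space \<mu>" for x
    using measurable_sets[OF fm Qm[OF x]] by (simp add: omit_face vimage_def space_PiM)
  have dep: "(w (restrict u {..<n}, x) = 0) = (w (restrict v {..<n}, x) = 0)" if "\<And>i. i < n \<Longrightarrow> u i = v i" for u v x
  proof -
    have "restrict u {..<n} = restrict v {..<n}" using that by (auto simp: restrict_def)
    thus ?thesis by simp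
  qed
  have dep': "(w (omit n j u, x) = 0) = (w (omit n j v, x) = 0)" if "\<And>i. i < Suc n \<Longrightarrow> u i = v i" for u v x
  proof -
    have "omit n j u = omit n j v" using that by (auto simp: omit_def restrict_def)
    thus ?thesis by simp
  qed
  have "{p \<in> space (CB n). w p = 0} \<in> sets (CB n)" using w(1) by measurable
  hence "AE x in \<mu>. AE u in TUPm n. w (u, x) = 0"
    using CB_AE_iff[of n "\<lambda>u x. w (u, x) = 0"] w(2) by simp
  hence "AE x in \<mu>. AE u in TUPm (Suc n). w (omit n j u, x) = 0" using AE_space
  proof eventually_elim
    case (elim x)
    have "AE u in TUPm n. w (restrict u {..<n}, x) = 0"
      using elim(1) AE_space by eventually_elim (simp add: TUPm_space PiE_iff extensional_restrict)
    hence "iter (ae_filter m) n (\<lambda>u. w (restrict u {..<n}, x) = 0)"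
      using TUPm_AE_iff_iter[OF dep Qm[OF elim(2)]] by simp
    from iter_face[OF this j] have "iter (ae_filter m) (Suc n) (\<lambda>u. w (omit n j u, x) = 0)"
      by (simp only: omit_face)
    thus ?case using TUPm_AE_iff_iter[OF dep' Qm'[OF elim(2)]] by simp
  qed
  moreover have "{p \<in> space (CB (Suc n)). w (omit n j (fst p), snd p) = 0} \<in> sets (CB (Suc n))"
    using measurable_compose[OF CB_omit_measurable[OF j] w(1)] by measurable
  ultimately show ?thesis
    using CB_AE_iff[of "Suc n" "\<lambda>u x. w (omit n j u, x) = 0"] by simp
qed

text \<open>Two fields carry content: every invariant class has a strict representative, and null
  parts remain null under omission of an entry.\<close>

lemma cb_presentation:
  "cochain_presentation (\<lambda>k. cochain (Suc k)) dif (cb_cochains m \<mu> act) (cb_differential m \<mu>) rcb"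
proof
  fix k :: nat and F G :: "(nat \<Rightarrow> 'g) \<times> 'x \<Rightarrow> real" and c :: real
  show "carrier (cb_cochains m \<mu> act k) = rcb k ` cochain (Suc k)"
  proof (intro set_eqI iffI)
    fix a assume "a \<in> carrier (cb_cochains m \<mu> act k)"
    then obtain f where f: "a = rcb k f" "f \<in> carrier (ess_bounded (CB (Suc k)))" "group_invariant m \<mu> act (Suc k) f"
      by (auto simp: cb_cochains_def subspace_on_def)
    then obtain C where C: "f \<in> borel_measurable (CB (Suc k))" "AE p in CB (Suc k). \<bar>f p\<bar> \<le> C"
      by (auto simp: ess_bounded_def)
    obtain F where F: "F \<in> cochain (Suc k)" "AE p in CB (Suc k). f p = F p"
      using cb_strict_representative[OF C f(3)] by blast
    have "a = rcb k F" using F(2) C(1) cochain_CB_measurable[OF F(1)] by (simp add: f(1) Linf_class_eq_iff)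
    thus "a \<in> rcb k ` cochain (Suc k)" using F(1) by blast
  next
    fix a assume "a \<in> rcb k ` cochain (Suc k)"
    then obtain F where F: "F \<in> cochain (Suc k)" "a = rcb k F" by blast
    obtain B where "\<And>p. \<bar>F p\<bar> \<le> B" using cochainD(2)[OF F(1)] by blast
    hence "AE p in CB (Suc k). \<bar>F p\<bar> \<le> B" by (intro AE_I2)
    hence "F \<in> carrier (ess_bounded (CB (Suc k)))"
      using cochain_CB_measurable[OF F(1)] by (simp add: ess_bounded_def) blast
    moreover have "group_invariant m \<mu> act (Suc k) F"
      unfolding group_invariant_def
    proof (intro allI AE_I2)
      fix g p assume "p \<in> space (CB (Suc k))"
      then obtain u x where p: "p = (u, x)" "x \<in> space \<mu>" by (auto simp: CB_space)
      have "F (\<lambda>i\<in>{..<Suc k}. g + u i, act g x) = F (\<lambda>i. g + u i, act g x)"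
        by (rule cochainD(3)[OF F(1)]) simp
      also have "\<dots> = F (u, x)" by (rule cochainD(4)[OF F(1) p(2)])
      finally show "case p of (u, x) \<Rightarrow> F (\<lambda>i\<in>{..<Suc k}. g + u i, act g x) = F (u, x)" by (simp add: p(1))
    qed
    ultimately show "a \<in> carrier (cb_cochains m \<mu> act k)"
      using F(2) by (auto simp: cb_cochains_def subspace_on_def)
  qed
  show "vzero (cb_cochains m \<mu> act k) = rcb k (\<lambda>_. 0)"
    by (simp add: cb_cochains_def subspace_on_def Linf_vzero)
  assume F: "F \<in> cochain (Suc k)"
  show "vscale (cb_cochains m \<mu> act k) c (rcb k F) = rcb k (\<lambda>p. c * F p)"
    by (simp add: cb_cochains_def subspace_on_def Linf_vscale)
  show "0 \<le> vnorm (cb_cochains m \<mu> act k) (rcb k F)"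
    using Linf_vnorm_nonneg[OF cochain_CB_measurable[OF F]] by (simp add: cb_cochains_def subspace_on_def)
  show "cb_differential m \<mu> k (rcb k F) = rcb (Suc k) (dif k F)"
    unfolding cb_differential_def
  proof (rule Linf_lift_class)
    show Fm: "F \<in> borel_measurable (CB (Suc k))" by (rule cochain_CB_measurable[OF F])
    show "dif k F \<in> borel_measurable (CB (Suc (Suc k)))" by (rule cochain_CB_measurable[OF dif_in[OF F]])
    fix w assume "w \<in> null_functions (CB (Suc k))"
    hence w: "w \<in> borel_measurable (CB (Suc k))" "AE p in CB (Suc k). w p = 0" by (auto simp: null_functions_def)
    let ?D = "\<lambda>(u, x). \<Sum>j\<le>Suc k. (- 1) ^ j * (F (omit (Suc k) j u, x) + w (omit (Suc k) j u, x))"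
    have "(\<lambda>p. F (omit (Suc k) j (fst p), snd p) + w (omit (Suc k) j (fst p), snd p)) \<in> borel_measurable (CB (Suc (Suc k)))"
      if "j \<le> Suc k" for j
      using measurable_compose[OF CB_omit_measurable[OF that] Fm] measurable_compose[OF CB_omit_measurable[OF that] w(1)] by simp
    hence "?D \<in> borel_measurable (CB (Suc (Suc k)))"
      unfolding split_beta' by (intro borel_measurable_sum borel_measurable_times borel_measurable_const) auto
    moreover have "AE p in CB (Suc (Suc k)). ?D p = dif k F p"
    proof -
      have "AE p in CB (Suc (Suc k)). \<forall>j\<in>{..Suc k}. w (omit (Suc k) j (fst p), snd p) = 0"
        using CB_omit_AE[OF w] by (intro AE_finite_allI) auto
      thus ?thesis
      proof eventually_elim
        case (elim p)
        have "F (omit (Suc k) j (fst p), snd p) = F (face j (fst p), snd p)" for j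
          unfolding omit_face by (rule cochainD(3)[OF F]) simp
        thus ?case using elim by (simp add: split_beta' dif_def coface_def del: sum.atMost_Suc)
      qed
    qed
    ultimately show "?D \<in> borel_measurable (CB (Suc (Suc k))) \<and> (AE p in CB (Suc (Suc k)). ?D p = dif k F p)" ..
  qed
  assume G: "G \<in> cochain (Suc k)"
  show "vadd (cb_cochains m \<mu> act k) (rcb k F) (rcb k G) = rcb k (\<lambda>p. F p + G p)"
    by (simp add: cb_cochains_def subspace_on_def Linf_vadd)
qed (auto intro: cochain_zero cochain_add cochain_scale dif_in simp: dif_add dif_scale)

lemma rcb_norm_le_iff:
  assumes F: "F \<in> cochain (Suc k)" and B: "0 \<le> B"
  shows "vnorm (cb_cochains m \<mu> act k) (rcb k F) \<le> B \<longleftrightarrow> (AE x in \<mu>. iter (ae_filter m) (Suc k) (\<lambda>u. \<bar>F (u, x)\<bar> \<le> B))"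
proof -
  obtain C where "\<And>p. \<bar>F p\<bar> \<le> C" using cochainD(2)[OF F] by blast
  thus ?thesis
    using Linf_vnorm_le_iff[OF cochain_CB_measurable[OF F] _ B, of C] cochain_AE_CB_iff[OF F, of B]
    by (simp add: cb_cochains_def subspace_on_def)
qed

lemma rcb_eq_iff:
  assumes F: "F \<in> cochain (Suc k)" and G: "G \<in> cochain (Suc k)"
  shows "rcb k F = rcb k G \<longleftrightarrow> (AE x in \<mu>. iter (ae_filter m) (Suc k) (\<lambda>u. F (u, x) = G (u, x)))"
proof -
  have FG: "(\<lambda>p. F p + (- 1) * G p) \<in> cochain (Suc k)" by (intro cochain_add F cochain_scale G)
  have "rcb k F = rcb k G \<longleftrightarrow> (AE p in CB (Suc k). \<bar>F p + (- 1) * G p\<bar> \<le> 0)"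
    using Linf_class_eq_iff[OF cochain_CB_measurable[OF F] cochain_CB_measurable[OF G]] by simp
  also have "\<dots> \<longleftrightarrow> (AE x in \<mu>. iter (ae_filter m) (Suc k) (\<lambda>u. F (u, x) = G (u, x)))"
    unfolding cochain_AE_CB_iff[OF FG] by simp
  finally show ?thesis .
qed

text \<open>Only \<open>\<rho>\<close> has to respect the filter. It makes the first prism of the
  almost closed \<open>dif k F\<close> null; moreover it makes the differential of the averaged
  cochain vanish at every sequence, so the second prism vanishes for any \<open>\<rho>'\<close>. The
  coboundaries of the two homotopies add up.\<close>

lemma Avg_Avg_homotopic:
  assumes \<rho>: "\<rho> \<in> measurable \<mu> (prob_algebra borel)" "\<rho>' \<in> measurable \<mu> (prob_algebra borel)"
    and resp: "AE x in \<mu>. \<forall>g Q. eventually Q (\<F> x) \<longrightarrow> (AE k in orbit_kernel \<rho> x g. Q k)"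
    and F: "F \<in> cochain (Suc k)" and cocycle: "AE x in \<mu>. iter (\<F> x) (Suc (Suc k)) (\<lambda>u. dif k F (u, x) = 0)"
  shows "\<exists>E\<in>(case k of 0 \<Rightarrow> {\<lambda>_. 0} | Suc k' \<Rightarrow> dif k' ` cochain (Suc k')).
    AE x in \<mu>. iter (\<F> x) (Suc k) (\<lambda>u. Avg \<rho>' k (Avg \<rho> k F) (u, x) = F (u, x) + E (u, x))"
proof -
  let ?B = "case k of 0 \<Rightarrow> {\<lambda>_. 0} | Suc k' \<Rightarrow> dif k' ` cochain (Suc k')"
  have AF: "Avg \<rho> k F \<in> cochain (Suc k)" by (rule Avg_in[OF \<rho>(1) F])
  obtain E1 where E1: "E1 \<in> ?B" "Avg \<rho> k F = (\<lambda>p. F p + (Pri \<rho> k (dif k F) p + E1 p))"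
    using Avg_homotopy[OF \<rho>(1) F] by blast
  obtain E2 where E2: "E2 \<in> ?B" "Avg \<rho>' k (Avg \<rho> k F) = (\<lambda>p. Avg \<rho> k F p + (Pri \<rho>' k (dif k (Avg \<rho> k F)) p + E2 p))"
    using Avg_homotopy[OF \<rho>(2) AF] by blast
  have E: "(\<lambda>p. E1 p + E2 p) \<in> ?B"
  proof (cases k)
    case (Suc k')
    then obtain G1 G2 where "G1 \<in> cochain (Suc k')" "G2 \<in> cochain (Suc k')" "E1 = dif k' G1" "E2 = dif k' G2"
      using E1(1) E2(1) by auto
    thus ?thesis unfolding Suc using cochain_add[of G1 "Suc k'" G2] by (auto simp flip: dif_add)
  qed (use E1 E2 in auto)
  have n1: "AE x in \<mu>. iter (\<F> x) (Suc k) (\<lambda>u. Pri \<rho> k (dif k F) (u, x) = 0)"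
    by (rule Pri_AE_null[OF \<rho>(1) resp cocycle])
  \<comment> \<open>Vanishing is rewritten as the bound 0 to apply the averaging estimate to the
    differential, which commutes with \<open>Avg\<close>.\<close>
  have "AE x in \<mu>. iter (\<F> x) (Suc (Suc k)) (\<lambda>u. \<bar>dif k F (u, x)\<bar> \<le> 0)" using cocycle by simp
  from Avg_AE_bound[OF \<rho>(1) resp this]
  have "AE x in \<mu>. \<forall>u. dif k (Avg \<rho> k F) (u, x) = 0"
    unfolding Avg_dif[OF \<rho>(1) F, symmetric] by simp
  from Pri_AE_null_all[OF \<rho>(2) this, of k]
  have "AE x in \<mu>. iter (\<F> x) (Suc k) (\<lambda>u. Avg \<rho>' k (Avg \<rho> k F) (u, x) = F (u, x) + (E1 (u, x) + E2 (u, x)))"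
    using n1
  proof eventually_elim
    case (elim x)
    from elim(2) show ?case
    proof (rule iter_mono)
      fix u assume "Pri \<rho> k (dif k F) (u, x) = 0"
      thus "Avg \<rho>' k (Avg \<rho> k F) (u, x) = F (u, x) + (E1 (u, x) + E2 (u, x))"
        using elim(1) fun_cong[OF E1(2), of "(u, x)"] fun_cong[OF E2(2), of "(u, x)"] by simp
    qed
  qed
  thus ?thesis using E by (intro bexI[of _ "\<lambda>p. E1 p + E2 p"]) auto
qed

end

context transverse_regular begin

text \<open>A tuple \<open>u\<close> from \<open>V x\<close> is translated by the inverse of
  \<open>u 0\<close>, which moves \<open>x\<close> into \<open>Y\<close> and makes the entries
  arrows with a common target, where \<open>f\<close> can be evaluated. Elsewhere the value is 0.
  Strict invariance is then automatic, and agreement with \<open>f\<close> on almost every fibre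
  uses its groupoid invariance.\<close>

lemma mb_strict_representative:
  assumes f: "f \<in> borel_measurable (fiber_power GG n)" and bd: "AE \<gamma> in fiber_power GG n. \<bar>f \<gamma>\<bar> \<le> C"
    and inv: "groupoid_invariant GG n f" and n: "0 < n"
  shows "\<exists>F\<in>cochain n. AE \<gamma> in fiber_power GG n. f \<gamma> = obs F \<gamma>"
proof -
  define c where "c = \<bar>C\<bar>"
  define cl where "cl t = max (- c) (min c t)" for t
  define R where "R = {p \<in> space (SEQ \<Otimes>\<^sub>M \<mu>). \<forall>i\<in>{..<n}. act (- fst p i) (snd p) \<in> Y}"
  \<comment> \<open>Built from \<open>- u 0 + u i\<close> and \<open>act (- u i) x\<close>, neither
    of which changes when \<open>u\<close> and \<open>x\<close> are translated together.\<close>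
  define arrs where "arrs p = (\<lambda>i\<in>{..<n}. (- fst p 0 + fst p i, act (- fst p i) (snd p)))" for p :: "(nat \<Rightarrow> 'g) \<times> 'x"
  define F where "F p = (if p \<in> R then cl (f (arrs p)) else 0)" for p
  have c: "0 \<le> c" by (simp add: c_def)
  have f': "f \<in> borel_measurable (FPS n)"
    using f by (simp cong: measurable_cong_sets add: sets_fiber_power)
  have act_i: "(\<lambda>p. act (- fst p i) (snd p)) \<in> measurable (SEQ \<Otimes>\<^sub>M \<mu>) \<mu>" for i
    by (intro act_measurable borel_measurable_uminus_group) simp_all
  have "{p \<in> space (SEQ \<Otimes>\<^sub>M \<mu>). act (- fst p i) (snd p) \<in> Y} \<in> sets (SEQ \<Otimes>\<^sub>M \<mu>)" for i
    using measurable_sets[OF act_i Y_sets, of i] by (simp add: vimage_def Int_def conj_commute)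
  hence R: "R \<in> sets (SEQ \<Otimes>\<^sub>M \<mu>)" unfolding R_def by (intro sets.sets_Collect_finite_All) auto
  have R_iff: "(u, x) \<in> R \<longleftrightarrow> x \<in> space \<mu> \<and> (\<forall>i<n. act (- u i) x \<in> Y)" for u x
    by (auto simp: R_def space_pair_measure space_PiM)
  have arrs: "arrs \<in> measurable (restrict_space (SEQ \<Otimes>\<^sub>M \<mu>) R) (FPS n)"
    unfolding arrs_def
  proof (rule measurable_into_FPS[where c="\<lambda>p. act (- fst p 0) (snd p)"])
    show "(\<lambda>p. - fst p 0 + fst p i) \<in> measurable (restrict_space (SEQ \<Otimes>\<^sub>M \<mu>) R) borel" for i
      by (intro measurable_restrict_space1 borel_measurable_add borel_measurable_uminus_group) simp_all
    show "(\<lambda>p. act (- fst p i) (snd p)) \<in> measurable (restrict_space (SEQ \<Otimes>\<^sub>M \<mu>) R) \<mu>" for i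
      by (intro measurable_restrict_space1 act_i)
  next
    fix i p assume "i < n" "p \<in> space (restrict_space (SEQ \<Otimes>\<^sub>M \<mu>) R)"
    hence p: "p \<in> R" "snd p \<in> space \<mu>" by (auto simp: space_restrict_space space_pair_measure)
    thus "act (- fst p i) (snd p) \<in> Y" using \<open>i < n\<close> by (auto simp: R_def)
    show "act (- fst p 0 + fst p i) (act (- fst p i) (snd p)) = act (- fst p 0) (snd p)"
      using p(2) by (simp add: add.assoc flip: act_add)
  qed (auto simp: space_restrict_space R_def)
  have F_cochain: "F \<in> cochain n"
  proof (rule cochainI)
    have "(\<lambda>p. cl (f (arrs p))) \<in> borel_measurable (restrict_space (SEQ \<Otimes>\<^sub>M \<mu>) R)"
      using measurable_compose[OF arrs f'] unfolding cl_def by measurable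
    thus "F \<in> borel_measurable (SEQ \<Otimes>\<^sub>M \<mu>)"
      unfolding F_def[abs_def] using R sets.sets_into_space[OF R]
      by (subst measurable_restrict_space_iff[symmetric]) (simp_all add: Int_absorb2)
    show "\<bar>F p\<bar> \<le> c" for p using c by (auto simp: F_def cl_def)
    show "F (u, x) = F (v, x)" if uv: "\<And>i. i < n \<Longrightarrow> u i = v i" for u v x
    proof -
      have "(u, x) \<in> R \<longleftrightarrow> (v, x) \<in> R" using uv by (simp add: R_iff)
      moreover have "arrs (u, x) = arrs (v, x)" using uv n by (auto simp: arrs_def restrict_def)
      ultimately show ?thesis by (simp add: F_def)
    qed
    show "F (\<lambda>i. a + u i, act a x) = F (u, x)" if x: "x \<in> space \<mu>" for a u x
    proof -
      have eq: "act (- (a + u i)) (act a x) = act (- u i) x" for i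
        by (simp only: act_add[OF x, symmetric]) (simp add: minus_add add.assoc)
      have "- (a + u 0) + (a + u i) = - u 0 + u i" for i
        by (simp only: minus_add add.assoc minus_add_cancel)
      hence "arrs (\<lambda>i. a + u i, act a x) = arrs (u, x)" by (simp add: arrs_def eq)
      moreover have "(\<lambda>i. a + u i, act a x) \<in> R \<longleftrightarrow> (u, x) \<in> R" using x act_space by (simp add: R_iff eq)
      ultimately show ?thesis by (simp add: F_def)
    qed
    show "F (u, x) = 0" if "x \<notin> space \<mu>" for u x using that by (simp add: F_def R_iff)
  qed
  have "AE y in \<nu>. \<forall>\<gamma>\<in>fib n y. f \<gamma> = obs F \<gamma>"
    using AE_fiber_powerD[OF inv[unfolded groupoid_invariant_def]] AE_fiber_powerD[OF bd] AE_space
  proof eventually_elim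
    case (elim y)
    hence y: "y \<in> Y" by (simp add: nu_space)
    show ?case
    proof
      fix \<gamma> assume \<gamma>: "\<gamma> \<in> fib n y"
      hence "\<gamma> \<in> tup n y ` PiE {..<n} (\<lambda>_. H y)" by (simp only: fib_eq[OF y])
      then obtain h where h: "h \<in> PiE {..<n} (\<lambda>_. H y)" "\<gamma> = tup n y h" by blast
      have hY: "act (h i) y \<in> Y" if "i < n" for i using PiE_mem[OF h(1), of i] that by (simp add: H_iff)
      have \<gamma>i: "\<gamma> i = (- h i, act (h i) y)" if "i < n" for i using that by (simp add: h(2) tup_def arr_def)
      have \<gamma>0: "\<gamma> 0 \<in> space (arrows GG)" using PiE_mem[OF \<gamma>, of 0] n by (simp add: tgt_fiber_def)
      have tgt0: "tgt GG (\<gamma> 0) = y" using PiE_mem[OF \<gamma>, of 0] n by (simp add: tgt_fiber_def)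
      \<comment> \<open>Invariance is applied with the arrow \<open>\<gamma> 0\<close> of the tuple
        itself, which is available because \<open>0 < n\<close>.\<close>
      have "f (\<lambda>i\<in>{..<n}. gcomp GG (ginv GG (\<gamma> 0)) (\<gamma> i)) = f \<gamma>"
        using elim(1) \<gamma> \<gamma>0 by blast
      moreover have "(\<lambda>i\<in>{..<n}. gcomp GG (ginv GG (\<gamma> 0)) (\<gamma> i)) = arrs (\<lambda>i. fst (\<gamma> i), y)"
        unfolding arrs_def using n by (intro restrict_ext) (simp add: \<gamma>i GG_simps)
      moreover have "(\<lambda>i. fst (\<gamma> i), y) \<in> R" using hY Y_space[OF y] by (simp add: R_iff \<gamma>i)
      ultimately have "obs F \<gamma> = cl (f \<gamma>)" by (simp add: obs_def tgt0 F_def)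
      moreover have "cl (f \<gamma>) = f \<gamma>" using elim(2) \<gamma> by (force simp: cl_def c_def)
      ultimately show "f \<gamma> = obs F \<gamma>" by simp
    qed
  qed
  moreover have "{\<gamma> \<in> space (FPS n). \<not> f \<gamma> = obs F \<gamma>} \<in> sets (FPS n)"
    by (rule sets_Collect_neq[OF f' obs_measurable[OF F_cochain n]])
  ultimately have "AE \<gamma> in fiber_power GG n. f \<gamma> = obs F \<gamma>" by (rule AE_fiber_powerI)
  thus ?thesis using F_cochain by blast
qed

abbreviation rmb :: "nat \<Rightarrow> ((nat \<Rightarrow> 'g) \<times> 'x \<Rightarrow> real) \<Rightarrow> ((nat \<Rightarrow> 'g \<times> 'x) \<Rightarrow> real) set" where
  "rmb k F \<equiv> Linf_class (fiber_power GG (Suc k)) (obs F)"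

lemma obs_measurable': "F \<in> cochain (Suc k) \<Longrightarrow> obs F \<in> borel_measurable (fiber_power GG (Suc k))"
  using obs_measurable[of F "Suc k"] by (simp cong: measurable_cong_sets add: sets_fiber_power)

lemma FPS_omit: "\<gamma> \<in> space (FPS (Suc n)) \<Longrightarrow> omit n j \<gamma> \<in> space (FPS n)"
  by (auto simp: FPS_space omit_def PiE_iff)

lemma FPS_omit_measurable: "omit n j \<in> measurable (FPS (Suc n)) (FPS n)"
proof -
  have "omit n j \<in> measurable (FPS (Suc n)) (PiM {..<n} (\<lambda>_. arrows GG))"
    unfolding omit_def[abs_def] by (intro measurable_restrict FPS_component) auto
  moreover have "omit n j \<in> space (FPS (Suc n)) \<rightarrow> {\<gamma>. \<forall>i<n. \<forall>j<n. tgt GG (\<gamma> i) = tgt GG (\<gamma> j)}"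
  proof
    fix \<gamma> assume "\<gamma> \<in> space (FPS (Suc n))"
    from FPS_omit[OF this] show "omit n j \<gamma> \<in> {\<gamma>. \<forall>i<n. \<forall>j<n. tgt GG (\<gamma> i) = tgt GG (\<gamma> j)}"
      unfolding FPS_space by blast
  qed
  ultimately show ?thesis unfolding fiber_power_space_def[of GG n]
    by (intro measurable_restrict_space2)
qed

lemma obs_omit:
  assumes F: "F \<in> cochain n" and n: "0 < n" and \<gamma>: "\<gamma> \<in> space (FPS (Suc n))"
  shows "obs F (omit n j \<gamma>) = F (face j (\<lambda>i. fst (\<gamma> i)), tgt GG (\<gamma> 0))"
proof -
  \<comment> \<open>For \<open>j = 0\<close> the first arrow changes, but all arrows of the tuple
    have the same target.\<close>
  have "tgt GG (omit n j \<gamma> 0) = tgt GG (\<gamma> 0)" using n \<gamma> by (auto simp: omit_def FPS_space)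
  hence "obs F (omit n j \<gamma>) = F (\<lambda>i. fst (omit n j \<gamma> i), tgt GG (\<gamma> 0))" by (simp add: obs_def)
  also have "\<dots> = F (face j (\<lambda>i. fst (\<gamma> i)), tgt GG (\<gamma> 0))"
    by (rule cochainD(3)[OF F]) (simp add: omit_def face_def)
  finally show ?thesis .
qed

text \<open>Composing with the inverse of an arrow of group component \<open>a\<close> moves the
  common target \<open>t\<close> to \<open>act (- a) t\<close> and multiplies the group components
  by \<open>- a\<close> on the left: exactly the diagonal translation under which \<open>F\<close>
  is invariant.\<close>

lemma obs_invariant:
  assumes F: "F \<in> cochain n" and n: "0 < n"
  shows "groupoid_invariant GG n (obs F)"
  unfolding groupoid_invariant_def
proof (intro AE_I2 ballI impI)
  fix u \<gamma> assume "u \<in> space (fiber_power GG n)" and \<gamma>: "\<gamma> \<in> space (arrows GG)" "tgt GG \<gamma> = tgt GG (u 0)"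
  hence u: "u \<in> space (FPS n)" by (simp add: space_fiber_power)
  obtain a y where ay: "\<gamma> = (a, y)" by (cases \<gamma>)
  define t where "t = act a y"
  have y: "y \<in> Y" "t \<in> Y" using \<gamma> by (auto simp: ay arrows_space t_def)
  have u0: "u 0 \<in> space (arrows GG)" using u n by (auto simp: FPS_space)
  have u0t: "act (fst (u 0)) (snd (u 0)) = t" using \<gamma>(2) by (simp add: ay tgt_eq t_def)
  have u0Y: "snd (u 0) \<in> space \<mu>" using u0 Y_space by (auto simp: arrows_space)
  have comp: "gcomp GG (ginv GG \<gamma>) (u i) = (- a + fst (u i), snd (u i))" for i
    by (cases "u i") (simp add: ay GG_simps)
  have "obs F (\<lambda>i\<in>{..<n}. gcomp GG (ginv GG \<gamma>) (u i)) =
    F (\<lambda>i. fst ((\<lambda>i\<in>{..<n}. gcomp GG (ginv GG \<gamma>) (u i)) i), act (- a) t)"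
    unfolding obs_def using n u0t u0Y by (simp add: comp tgt_eq act_add)
  also have "\<dots> = F (\<lambda>i. - a + fst (u i), act (- a) t)"
    by (rule cochainD(3)[OF F]) (simp add: comp)
  also have "\<dots> = F (\<lambda>i. fst (u i), t)" by (rule cochainD(4)[OF F Y_space[OF y(2)]])
  also have "\<dots> = obs F u" by (simp add: obs_def tgt_eq u0t)
  finally show "obs F (\<lambda>i\<in>{..<n}. gcomp GG (ginv GG \<gamma>) (u i)) = obs F u" .
qed


lemma fib_omit: "\<gamma> \<in> fib (Suc n) y \<Longrightarrow> omit n j \<gamma> \<in> fib n y"
  by (auto simp: omit_def PiE_iff)

text \<open>Omitting an arrow stays within the same fibre, so a function vanishing on the fibre
  powers over almost every \<open>y\<close> still does so after pulling back along any face.\<close>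

lemma mb_presentation:
  "cochain_presentation (\<lambda>k. cochain (Suc k)) dif (mb_cochains GG) (mb_differential GG) rmb"
proof
  fix k :: nat and F G :: "(nat \<Rightarrow> 'g) \<times> 'x \<Rightarrow> real" and c :: real
  show "carrier (mb_cochains GG k) = rmb k ` cochain (Suc k)"
  proof (intro set_eqI iffI)
    fix a assume "a \<in> carrier (mb_cochains GG k)"
    then obtain f where f: "a = Linf_class (fiber_power GG (Suc k)) f"
      "f \<in> carrier (ess_bounded (fiber_power GG (Suc k)))" "groupoid_invariant GG (Suc k) f"
      by (auto simp: mb_cochains_def subspace_on_def)
    then obtain C where C: "f \<in> borel_measurable (fiber_power GG (Suc k))" "AE p in fiber_power GG (Suc k). \<bar>f p\<bar> \<le> C"
      by (auto simp: ess_bounded_def)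
    obtain F where F: "F \<in> cochain (Suc k)" "AE p in fiber_power GG (Suc k). f p = obs F p"
      using mb_strict_representative[OF C f(3)] by blast
    have "a = rmb k F" using F(2) C(1) obs_measurable'[OF F(1)] by (simp add: f(1) Linf_class_eq_iff)
    thus "a \<in> rmb k ` cochain (Suc k)" using F(1) by blast
  next
    fix a assume "a \<in> rmb k ` cochain (Suc k)"
    then obtain F where F: "F \<in> cochain (Suc k)" "a = rmb k F" by blast
    obtain B where "\<And>p. \<bar>F p\<bar> \<le> B" using cochainD(2)[OF F(1)] by blast
    hence "AE \<gamma> in fiber_power GG (Suc k). \<bar>obs F \<gamma>\<bar> \<le> B" by (intro AE_I2) (simp add: obs_def)
    hence "obs F \<in> carrier (ess_bounded (fiber_power GG (Suc k)))"
      using obs_measurable'[OF F(1)] by (simp add: ess_bounded_def) blast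
    moreover have "groupoid_invariant GG (Suc k) (obs F)" by (rule obs_invariant[OF F(1)]) simp
    ultimately show "a \<in> carrier (mb_cochains GG k)"
      using F(2) by (auto simp: mb_cochains_def subspace_on_def)
  qed
  show "vzero (mb_cochains GG k) = rmb k (\<lambda>_. 0)"
    by (simp add: mb_cochains_def subspace_on_def Linf_vzero obs_def[abs_def])
  assume F: "F \<in> cochain (Suc k)"
  show "vscale (mb_cochains GG k) c (rmb k F) = rmb k (\<lambda>p. c * F p)"
    by (simp add: mb_cochains_def subspace_on_def Linf_vscale obs_def[abs_def])
  show "0 \<le> vnorm (mb_cochains GG k) (rmb k F)"
    using Linf_vnorm_nonneg[OF obs_measurable'[OF F]] by (simp add: mb_cochains_def subspace_on_def)
  show "mb_differential GG k (rmb k F) = rmb (Suc k) (dif k F)"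
    unfolding mb_differential_def
  proof (rule Linf_lift_class)
    show Fm: "obs F \<in> borel_measurable (fiber_power GG (Suc k))" by (rule obs_measurable'[OF F])
    show "obs (dif k F) \<in> borel_measurable (fiber_power GG (Suc (Suc k)))" by (rule obs_measurable'[OF dif_in[OF F]])
    fix w assume "w \<in> null_functions (fiber_power GG (Suc k))"
    hence w: "w \<in> borel_measurable (FPS (Suc k))" "AE p in fiber_power GG (Suc k). w p = 0"
      by (auto simp: null_functions_def sets_fiber_power cong: measurable_cong_sets)
    have Fm': "obs F \<in> borel_measurable (FPS (Suc k))" by (rule obs_measurable[OF F]) simp
    let ?D = "\<lambda>\<gamma>. \<Sum>j\<le>Suc k. (- 1) ^ j * (obs F (omit (Suc k) j \<gamma>) + w (omit (Suc k) j \<gamma>))"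
    have Dm: "?D \<in> borel_measurable (FPS (Suc (Suc k)))"
      using measurable_compose[OF FPS_omit_measurable Fm'] measurable_compose[OF FPS_omit_measurable w(1)]
      by (intro borel_measurable_sum borel_measurable_times borel_measurable_const borel_measurable_add)
    have dm: "obs (dif k F) \<in> borel_measurable (FPS (Suc (Suc k)))" by (rule obs_measurable[OF dif_in[OF F]]) simp
    have "AE y in \<nu>. \<forall>\<gamma>\<in>fib (Suc (Suc k)) y. ?D \<gamma> = obs (dif k F) \<gamma>"
      using AE_fiber_powerD[OF w(2)] AE_space
    proof eventually_elim
      case (elim y)
      show ?case
      proof
        fix \<gamma> assume \<gamma>: "\<gamma> \<in> fib (Suc (Suc k)) y"
        have y: "y \<in> Y" using elim by (simp add: nu_space)
        have "w (omit (Suc k) j \<gamma>) = 0" for j using elim(1) fib_omit[OF \<gamma>] by blast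
        moreover have "obs F (omit (Suc k) j \<gamma>) = F (face j (\<lambda>i. fst (\<gamma> i)), tgt GG (\<gamma> 0))" for j
          by (rule obs_omit[OF F _ fib_space[OF y \<gamma>]]) simp
        ultimately show "?D \<gamma> = obs (dif k F) \<gamma>" by (simp add: obs_def dif_def coface_def del: sum.atMost_Suc)
      qed
    qed
    moreover have "{\<gamma> \<in> space (FPS (Suc (Suc k))). \<not> ?D \<gamma> = obs (dif k F) \<gamma>} \<in> sets (FPS (Suc (Suc k)))"
      by (rule sets_Collect_neq[OF Dm dm])
    ultimately have "AE \<gamma> in fiber_power GG (Suc (Suc k)). ?D \<gamma> = obs (dif k F) \<gamma>" by (rule AE_fiber_powerI)
    moreover have "?D \<in> borel_measurable (fiber_power GG (Suc (Suc k)))"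
      using Dm by (simp cong: measurable_cong_sets add: sets_fiber_power)
    ultimately show "?D \<in> borel_measurable (fiber_power GG (Suc (Suc k))) \<and>
        (AE \<gamma> in fiber_power GG (Suc (Suc k)). ?D \<gamma> = obs (dif k F) \<gamma>)" by blast
  qed
  assume G: "G \<in> cochain (Suc k)"
  show "vadd (mb_cochains GG k) (rmb k F) (rmb k G) = rmb k (\<lambda>p. F p + G p)"
    by (simp add: mb_cochains_def subspace_on_def Linf_vadd obs_def[abs_def])
qed (auto intro: cochain_zero cochain_add cochain_scale dif_in simp: dif_add dif_scale)

lemma rmb_norm_le_iff:
  assumes F: "F \<in> cochain (Suc k)" and B: "0 \<le> B"
  shows "vnorm (mb_cochains GG k) (rmb k F) \<le> B \<longleftrightarrow> (AE x in \<mu>. iter (principal (V x)) (Suc k) (\<lambda>u. \<bar>F (u, x)\<bar> \<le> B))"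
proof -
  obtain C where "\<And>p. \<bar>F p\<bar> \<le> C" using cochainD(2)[OF F] by blast
  hence "AE \<gamma> in fiber_power GG (Suc k). \<bar>obs F \<gamma>\<bar> \<le> C" by (simp add: obs_def)
  from Linf_vnorm_le_iff[OF obs_measurable'[OF F] this B] show ?thesis
    using cochain_AE_fiber_power_iff[OF F, of B] by (simp add: mb_cochains_def subspace_on_def)
qed

lemma rmb_eq_iff:
  assumes F: "F \<in> cochain (Suc k)" and G: "G \<in> cochain (Suc k)"
  shows "rmb k F = rmb k G \<longleftrightarrow> (AE x in \<mu>. iter (principal (V x)) (Suc k) (\<lambda>u. F (u, x) = G (u, x)))"
proof -
  have FG: "(\<lambda>p. F p + (- 1) * G p) \<in> cochain (Suc k)" by (intro cochain_add F cochain_scale G)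
  have "rmb k F = rmb k G \<longleftrightarrow> (AE \<gamma> in fiber_power GG (Suc k). \<bar>obs (\<lambda>p. F p + (- 1) * G p) \<gamma>\<bar> \<le> 0)"
    using Linf_class_eq_iff[OF obs_measurable'[OF F] obs_measurable'[OF G]] by (simp add: obs_def)
  also have "\<dots> \<longleftrightarrow> (AE x in \<mu>. iter (principal (V x)) (Suc k) (\<lambda>u. F (u, x) = G (u, x)))"
    unfolding cochain_AE_fiber_power_iff[OF FG zero_less_Suc] by simp
  finally show ?thesis .
qed

lemma AE_mp_respects: "AE x in \<mu>. \<forall>g Q. eventually Q (ae_filter m) \<longrightarrow> (AE k in orbit_kernel (\<lambda>_. mp) x g. Q k)"
  using AE_space by eventually_elim (use mp_respects in blast)

lemma AE_rhoY_respects: "AE x in \<mu>. \<forall>g Q. eventually Q (principal (V x)) \<longrightarrow> (AE k in orbit_kernel rhoY x g. Q k)"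
  using AE_space X0_AE by eventually_elim (use rhoY_respects in blast)

text \<open>A bound on tuples from \<open>V x\<close> is input; averaging over \<open>V x\<close>
  returns it at every tuple, in particular at Haar-almost every one. Applied with the seminorm as
  bound this is the contraction property, applied with 0 it is compatibility with null
  classes.\<close>

lemma Avg_rhoY_map:
  "presentation_map (\<lambda>k. cochain (Suc k)) dif (mb_cochains GG) (mb_differential GG) rmb
     (cb_cochains m \<mu> act) (cb_differential m \<mu>) rcb (Avg rhoY)"
proof -
  interpret P: cochain_presentation "\<lambda>k. cochain (Suc k)" dif "mb_cochains GG" "mb_differential GG" rmb
    by (rule mb_presentation)
  interpret P': cochain_presentation "\<lambda>k. cochain (Suc k)" dif "cb_cochains m \<mu> act" "cb_differential m \<mu>" rcb
    by (rule cb_presentation)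
  have bound: "AE x in \<mu>. iter (ae_filter m) (Suc k) (\<lambda>u. \<bar>Avg rhoY k F (u, x)\<bar> \<le> B)"
    if "AE x in \<mu>. iter (principal (V x)) (Suc k) (\<lambda>u. \<bar>F (u, x)\<bar> \<le> B)" "0 \<le> B" for k F B
    using Avg_AE_bound[OF rhoY_kernel AE_rhoY_respects that] by eventually_elim (rule iter_all)
  show ?thesis
  proof
    fix k F assume F: "F \<in> cochain (Suc k)"
    note AF = Avg_in[OF rhoY_kernel F]
    show "vnorm (cb_cochains m \<mu> act k) (rcb k (Avg rhoY k F)) \<le> vnorm (mb_cochains GG k) (rmb k F)"
      using bound P.norm_nonneg[OF F] rmb_norm_le_iff[OF F] rcb_norm_le_iff[OF AF] by blast
    assume "rmb k F = vzero (mb_cochains GG k)"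
    hence "AE x in \<mu>. iter (principal (V x)) (Suc k) (\<lambda>u. \<bar>F (u, x)\<bar> \<le> 0)"
      unfolding P.r_zero rmb_eq_iff[OF F cochain_zero] by simp
    from bound[OF this] show "rcb k (Avg rhoY k F) = vzero (cb_cochains m \<mu> act k)"
      unfolding P'.r_zero rcb_eq_iff[OF AF cochain_zero] by simp
  qed (auto intro: Avg_in[OF rhoY_kernel] simp: Avg_add[OF rhoY_kernel] Avg_scale[OF rhoY_kernel] Avg_dif[OF rhoY_kernel])
qed

text \<open>The same mechanism in the opposite direction: Haar-almost every tuple suffices as input,
  and the averaged cochain can then be evaluated on \<open>V x\<close>, which may well be Haar
  null.\<close>

lemma Avg_mp_map:
  "presentation_map (\<lambda>k. cochain (Suc k)) dif (cb_cochains m \<mu> act) (cb_differential m \<mu>) rcb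
     (mb_cochains GG) (mb_differential GG) rmb (Avg (\<lambda>_. mp))"
proof -
  interpret P: cochain_presentation "\<lambda>k. cochain (Suc k)" dif "mb_cochains GG" "mb_differential GG" rmb
    by (rule mb_presentation)
  interpret P': cochain_presentation "\<lambda>k. cochain (Suc k)" dif "cb_cochains m \<mu> act" "cb_differential m \<mu>" rcb
    by (rule cb_presentation)
  have bound: "AE x in \<mu>. iter (principal (V x)) (Suc k) (\<lambda>u. \<bar>Avg (\<lambda>_. mp) k F (u, x)\<bar> \<le> B)"
    if "AE x in \<mu>. iter (ae_filter m) (Suc k) (\<lambda>u. \<bar>F (u, x)\<bar> \<le> B)" "0 \<le> B" for k F B
    using Avg_AE_bound[OF mp_kernel AE_mp_respects that] by eventually_elim (rule iter_all)
  show ?thesis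
  proof
    fix k F assume F: "F \<in> cochain (Suc k)"
    note AF = Avg_in[OF mp_kernel F]
    show "vnorm (mb_cochains GG k) (rmb k (Avg (\<lambda>_. mp) k F)) \<le> vnorm (cb_cochains m \<mu> act k) (rcb k F)"
      using bound P'.norm_nonneg[OF F] rcb_norm_le_iff[OF F] rmb_norm_le_iff[OF AF] by blast
    assume "rcb k F = vzero (cb_cochains m \<mu> act k)"
    hence "AE x in \<mu>. iter (ae_filter m) (Suc k) (\<lambda>u. \<bar>F (u, x)\<bar> \<le> 0)"
      unfolding P'.r_zero rcb_eq_iff[OF F cochain_zero] by simp
    from bound[OF this] show "rmb k (Avg (\<lambda>_. mp) k F) = vzero (mb_cochains GG k)"
      unfolding P.r_zero rmb_eq_iff[OF AF cochain_zero] by simp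
  qed (auto intro: Avg_in[OF mp_kernel] simp: Avg_add[OF mp_kernel] Avg_scale[OF mp_kernel] Avg_dif[OF mp_kernel])
qed

lemma B_in_cochain: "E \<in> (case k of 0 \<Rightarrow> {\<lambda>_. 0} | Suc k' \<Rightarrow> dif k' ` cochain (Suc k')) \<Longrightarrow> E \<in> cochain (Suc k)"
  by (cases k) (auto intro: cochain_zero dif_in)

theorem H_mb_isometric_H_cb: "\<exists>\<phi>. isometric_isomorphism (H_mb GG k) (H_cb m \<mu> act k) \<phi>"
proof -
  interpret P: cochain_presentation "\<lambda>k. cochain (Suc k)" dif "mb_cochains GG" "mb_differential GG" rmb
    by (rule mb_presentation)
  interpret P': cochain_presentation "\<lambda>k. cochain (Suc k)" dif "cb_cochains m \<mu> act" "cb_differential m \<mu>" rcb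
    by (rule cb_presentation)
  show ?thesis
    unfolding H_mb_def H_cb_def
  proof (rule cohomology_isometric_isomorphism[OF Avg_rhoY_map Avg_mp_map])
    fix F assume F: "F \<in> cochain (Suc k)" and z: "rmb (Suc k) (dif k F) = vzero (mb_cochains GG (Suc k))"
    have "AE x in \<mu>. iter (principal (V x)) (Suc (Suc k)) (\<lambda>u. dif k F (u, x) = 0)"
      using z unfolding P.r_zero rmb_eq_iff[OF dif_in[OF F] cochain_zero] .
    from Avg_Avg_homotopic[OF rhoY_kernel mp_kernel AE_rhoY_respects F this]
    obtain E where E: "E \<in> (case k of 0 \<Rightarrow> {\<lambda>_. 0} | Suc k' \<Rightarrow> dif k' ` cochain (Suc k'))"
      "AE x in \<mu>. iter (principal (V x)) (Suc k) (\<lambda>u. Avg (\<lambda>_. mp) k (Avg rhoY k F) (u, x) = F (u, x) + E (u, x))" by blast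
    have "rmb k (Avg (\<lambda>_. mp) k (Avg rhoY k F)) = rmb k (\<lambda>p. F p + E p)"
      using E(2) by (subst rmb_eq_iff) (auto intro: Avg_in[OF mp_kernel] Avg_in[OF rhoY_kernel] F cochain_add B_in_cochain[OF E(1)])
    with E(1) show "\<exists>E\<in>(case k of 0 \<Rightarrow> {\<lambda>_. 0} | Suc k' \<Rightarrow> dif k' ` cochain (Suc k')).
       rmb k (Avg (\<lambda>_. mp) k (Avg rhoY k F)) = rmb k (\<lambda>p. F p + E p)" by (intro bexI)
  next
    fix F assume F: "F \<in> cochain (Suc k)" and z: "rcb (Suc k) (dif k F) = vzero (cb_cochains m \<mu> act (Suc k))"
    have "AE x in \<mu>. iter (ae_filter m) (Suc (Suc k)) (\<lambda>u. dif k F (u, x) = 0)"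
      using z unfolding P'.r_zero rcb_eq_iff[OF dif_in[OF F] cochain_zero] .
    from Avg_Avg_homotopic[OF mp_kernel rhoY_kernel AE_mp_respects F this]
    obtain E where E: "E \<in> (case k of 0 \<Rightarrow> {\<lambda>_. 0} | Suc k' \<Rightarrow> dif k' ` cochain (Suc k'))"
      "AE x in \<mu>. iter (ae_filter m) (Suc k) (\<lambda>u. Avg rhoY k (Avg (\<lambda>_. mp) k F) (u, x) = F (u, x) + E (u, x))" by blast
    have "rcb k (Avg rhoY k (Avg (\<lambda>_. mp) k F)) = rcb k (\<lambda>p. F p + E p)"
      using E(2) by (subst rcb_eq_iff) (auto intro: Avg_in[OF mp_kernel] Avg_in[OF rhoY_kernel] F cochain_add B_in_cochain[OF E(1)])
    with E(1) show "\<exists>E\<in>(case k of 0 \<Rightarrow> {\<lambda>_. 0} | Suc k' \<Rightarrow> dif k' ` cochain (Suc k')).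
       rcb k (Avg rhoY k (Avg (\<lambda>_. mp) k F)) = rcb k (\<lambda>p. F p + E p)" by (intro bexI)
  qed
qed

end

theorem theorem1:
  fixes m :: "'g::{topological_group_add, t2_space, second_countable_topology} measure"
    and \<mu> :: "'x measure"
    and act :: "'g \<Rightarrow> 'x \<Rightarrow> 'x"
    and Y :: "'x set"
    and \<nu> :: "'x measure"
  assumes "locally_compact_space (euclidean :: 'g topology)"
    and "haar_measure m"
    and "unimodular m"
    and "transverse_system \<mu> act Y"
    and "integrable_system \<mu> act Y"
    and "transverse_measure m \<mu> act Y \<nu>"
  shows "\<forall>k. \<exists>\<phi>. isometric_isomorphism (H_mb (transverse_groupoid act Y \<nu>) k) (H_cb m \<mu> act k) \<phi>"
proof -
  interpret S: transverse_setup m \<mu> act Y \<nu> by unfold_locales (rule assms)+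
  obtain L :: "nat \<Rightarrow> 'g set" where L: "\<And>n. compact (L n)" "incseq L" "(\<Union>n. L n) = UNIV"
    using compact_exhaustion[OF assms(1)] by metis
  have L_sets: "L n \<in> sets m" for n using L(1)[of n] by (simp add: S.sets_m borel_closed compact_imp_closed)
  \<comment> \<open>The first sets of the exhaustion may be Haar null; starting at a set of positive
    measure secures the positivity required of all of them.\<close>
  have "\<exists>N. 0 < emeasure m (L N)"
  proof (rule ccontr)
    assume "\<nexists>N. 0 < emeasure m (L N)"
    hence "emeasure m (\<Union>n. L n) = 0" using L_sets by (intro emeasure_UN_eq_0) auto
    thus False using assms(2) L(3) by (simp add: haar_measure_def)
  qed
  then obtain N where N: "0 < emeasure m (L N)" ..
  interpret E: transverse_exhaustion m \<mu> act Y \<nu> "\<lambda>n. L (N + n)"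
  proof
    show "compact (L (N + n))" for n by (rule L(1))
    show "incseq (\<lambda>n. L (N + n))" using L(2) by (simp add: incseq_def)
    show "(\<Union>n. L (N + n)) = UNIV"
    proof (intro set_eqI iffI UNIV_I)
      fix g
      obtain n where "g \<in> L n" using L(3) by blast
      moreover have "L n \<subseteq> L (N + n)" using L(2) by (simp add: incseq_def)
      ultimately show "g \<in> (\<Union>n. L (N + n))" by blast
    qed
    show "0 < emeasure m (L (N + n))" for n
    proof -
      have "emeasure m (L N) \<le> emeasure m (L (N + n))"
        using L(2) L_sets by (intro emeasure_mono) (auto simp: incseq_def)
      thus ?thesis using N by (rule less_le_trans[rotated])
    qed
  qed
  obtain X0 where X0: "X0 \<in> sets \<mu>" "\<And>a x. x \<in> space \<mu> \<Longrightarrow> act a x \<in> X0 \<longleftrightarrow> x \<in> X0" "AE x in \<mu>. x \<in> X0"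
    "\<And>n A. A \<in> sets borel \<Longrightarrow>
      (\<lambda>x. cnt ((if x \<in> X0 then hitting_set act Y x \<inter> L (N + n) else {}) \<inter> A)) \<in> borel_measurable \<mu>"
    using E.ex_regular_set by blast
  interpret R: transverse_regular m \<mu> act Y \<nu> "\<lambda>n. L (N + n)" X0
    by unfold_locales (use X0 in auto)
  show ?thesis using R.H_mb_isometric_H_cb by blast
qed

end
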